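(* For every irrational $\alpha$ and every real $\theta$, the spectrum $\sigma(H_{\alpha,\theta})$ of the critical almost Mathieu operator $H_{\alpha,\theta}$ has zero Lebesgue measure: $|\sigma(H_{\alpha,\theta})|=0$.
   Context: The critical almost Mathieu operator $H_{\alpha,\theta}$ is the bounded self-adjoint operator on $\ell^2(\mathbb Z)$ given by $$(H_{\alpha,\theta}\phi)(n)=\phi(n-1)+\phi(n+1)+2\cos\big(2\pi(\alpha n+\theta)\big)\phi(n),\qquad n\in\mathbb Z.$$ $|A|$ denotes the Lebesgue measure of a set $A\subset\mathbb R$. *)

theory Defs
  imports "HOL-Analysis.Analysis"
begin

definition ell2 :: "(int \<Rightarrow> complex) set" where
  "ell2 = {\<phi>. (\<lambda>n. (cmod (\<phi> n))\<^sup>2) summable_on UNIV}"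

definition ell2_norm :: "(int \<Rightarrow> complex) \<Rightarrow> real" where
  "ell2_norm \<phi> = sqrt (\<Sum>\<^sub>\<infinity>n. (cmod (\<phi> n))\<^sup>2)"

text \<open>Operators on \<open>ell2\<close> are functions on all sequences, of which only the
  restriction to \<open>ell2\<close> matters.\<close>

definition bounded_operator :: "((int \<Rightarrow> complex) \<Rightarrow> (int \<Rightarrow> complex)) \<Rightarrow> bool" where
  "bounded_operator T \<longleftrightarrow>
     (\<forall>\<phi>\<in>ell2. T \<phi> \<in> ell2) \<and>
     (\<forall>\<phi>\<in>ell2. \<forall>\<psi>\<in>ell2. T (\<lambda>n. \<phi> n + \<psi> n) = (\<lambda>n. T \<phi> n + T \<psi> n)) \<and>
     (\<forall>c. \<forall>\<phi>\<in>ell2. T (\<lambda>n. c * \<phi> n) = (\<lambda>n. c * T \<phi> n)) \<and>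
     (\<exists>C. \<forall>\<phi>\<in>ell2. ell2_norm (T \<phi>) \<le> C * ell2_norm \<phi>)"

definition spectrum :: "((int \<Rightarrow> complex) \<Rightarrow> (int \<Rightarrow> complex)) \<Rightarrow> complex set" where
  "spectrum T = {z. \<not> (\<exists>R. bounded_operator R \<and>
     (\<forall>\<phi>\<in>ell2. R (\<lambda>n. T \<phi> n - z * \<phi> n) = \<phi>) \<and>
     (\<forall>\<phi>\<in>ell2. (\<lambda>n. T (R \<phi>) n - z * R \<phi> n) = \<phi>))}"

definition critical_almost_mathieu ::
  "real \<Rightarrow> real \<Rightarrow> (int \<Rightarrow> complex) \<Rightarrow> (int \<Rightarrow> complex)" where
  "critical_almost_mathieu \<alpha> \<theta> \<phi> = (\<lambda>n. \<phi> (n - 1) + \<phi> (n + 1)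
     + complex_of_real (2 * cos (2 * pi * (\<alpha> * of_int n + \<theta>))) * \<phi> n)"

lemma ell2_shift:
  assumes "\<phi> \<in> ell2"
  shows "(\<lambda>n. (cmod (\<phi> (n + k)))\<^sup>2) summable_on UNIV"
    and "(\<Sum>\<^sub>\<infinity>n. (cmod (\<phi> (n + k)))\<^sup>2) = (\<Sum>\<^sub>\<infinity>n. (cmod (\<phi> n))\<^sup>2)"
proof -
  have b: "bij_betw (\<lambda>n::int. n + k) UNIV UNIV"
    by (rule bij_betwI[where g="\<lambda>n. n - k"]) auto
  show "(\<lambda>n. (cmod (\<phi> (n + k)))\<^sup>2) summable_on UNIV"
    using summable_on_reindex_bij_betw[OF b, of "\<lambda>n. (cmod (\<phi> n))\<^sup>2"] assms
    by (simp add: ell2_def)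
  show "(\<Sum>\<^sub>\<infinity>n. (cmod (\<phi> (n + k)))\<^sup>2) = (\<Sum>\<^sub>\<infinity>n. (cmod (\<phi> n))\<^sup>2)"
    using infsum_reindex_bij_betw[OF b, of "\<lambda>n. (cmod (\<phi> n))\<^sup>2"] by simp
qed

lemma cmod_critical_almost_mathieu_le:
  "(cmod (critical_almost_mathieu \<alpha> \<theta> \<phi> n))\<^sup>2 \<le>
     3 * (cmod (\<phi> (n + -1)))\<^sup>2 + 3 * (cmod (\<phi> (n + 1)))\<^sup>2 + 12 * (cmod (\<phi> n))\<^sup>2"
proof -
  let ?c = "complex_of_real (2 * cos (2 * pi * (\<alpha> * of_int n + \<theta>)))"
  have c: "cmod ?c \<le> 2"
    unfolding norm_of_real using abs_cos_le_one[of "2 * pi * (\<alpha> * of_int n + \<theta>)"]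
    by (simp add: abs_mult)
  have "cmod (critical_almost_mathieu \<alpha> \<theta> \<phi> n) \<le>
      cmod (\<phi> (n - 1)) + cmod (\<phi> (n + 1)) + cmod (?c * \<phi> n)"
    unfolding critical_almost_mathieu_def
    by (meson norm_triangle_ineq norm_triangle_mono order_refl)
  also have "cmod (?c * \<phi> n) \<le> 2 * cmod (\<phi> n)"
    unfolding norm_mult using c by (rule mult_right_mono) simp
  finally have "(cmod (critical_almost_mathieu \<alpha> \<theta> \<phi> n))\<^sup>2 \<le>
      (cmod (\<phi> (n - 1)) + cmod (\<phi> (n + 1)) + 2 * cmod (\<phi> n))\<^sup>2"
    by (intro power_mono) auto
  moreover have "(x + y + 2 * w)\<^sup>2 \<le> 3 * x\<^sup>2 + 3 * y\<^sup>2 + 12 * w\<^sup>2" for x y w :: real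
    using sum_squares_ge_zero[of "x - y" "x - 2 * w"] zero_le_power2[of "y - 2 * w"]
    by (simp add: power2_eq_square algebra_simps)
  ultimately show ?thesis
    by (smt (verit, best) add_uminus_conv_diff)
qed

lemma bounded_operator_critical_almost_mathieu:
  "bounded_operator (critical_almost_mathieu \<alpha> \<theta>)"
proof -
  let ?H = "critical_almost_mathieu \<alpha> \<theta>"
  have *: "?H \<phi> \<in> ell2 \<and> ell2_norm (?H \<phi>) \<le> sqrt 18 * ell2_norm \<phi>" if \<phi>: "\<phi> \<in> ell2" for \<phi>
  proof -
    define S where "S = (\<Sum>\<^sub>\<infinity>n. (cmod (\<phi> n))\<^sup>2)"
    define g where "g n = 3 * (cmod (\<phi> (n + -1)))\<^sup>2 + 3 * (cmod (\<phi> (n + 1)))\<^sup>2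
      + 12 * (cmod (\<phi> n))\<^sup>2" for n
    have s: "((\<lambda>n. (cmod (\<phi> (n + k)))\<^sup>2) has_sum S) UNIV" for k
      using ell2_shift[OF \<phi>] unfolding S_def by (metis has_sum_infsum)
    have g: "(g has_sum (3 * S + 3 * S + 12 * S)) UNIV"
      unfolding g_def using s[of 0]
      by (intro has_sum_add has_sum_cmult_right s) simp
    have le: "(cmod (?H \<phi> n))\<^sup>2 \<le> g n" for n
      unfolding g_def by (rule cmod_critical_almost_mathieu_le)
    have H: "(\<lambda>n. (cmod (?H \<phi> n))\<^sup>2) summable_on UNIV"
      by (rule summable_on_comparison_test[OF has_sum_imp_summable[OF g]]) (use le in auto)
    have "(\<Sum>\<^sub>\<infinity>n. (cmod (?H \<phi> n))\<^sup>2) \<le> 3 * S + 3 * S + 12 * S"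
      by (rule has_sum_mono[OF has_sum_infsum[OF H] g]) (rule le)
    then have "ell2_norm (?H \<phi>) \<le> sqrt (18 * S)"
      unfolding ell2_norm_def by (intro real_sqrt_le_mono) simp
    then show ?thesis
      using H by (simp add: ell2_def ell2_norm_def S_def real_sqrt_mult)
  qed
  have "\<exists>C. \<forall>\<phi>\<in>ell2. ell2_norm (?H \<phi>) \<le> C * ell2_norm \<phi>"
    using * by blast
  moreover have "?H (\<lambda>n. \<phi> n + \<psi> n) = (\<lambda>n. ?H \<phi> n + ?H \<psi> n)"
    and "?H (\<lambda>n. c * \<phi> n) = (\<lambda>n. c * ?H \<phi> n)" for \<phi> \<psi> c
    by (auto simp: critical_almost_mathieu_def algebra_simps)
  ultimately show ?thesis
    unfolding bounded_operator_def using * by blast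
qed

text \<open>The operator is symmetric, hence, being bounded, self-adjoint. Its spectrum is thus
  contained in the real line.\<close>

lemma ell2_mult_summable:
  assumes "\<phi> \<in> ell2" and "\<psi> \<in> ell2"
  shows "(\<lambda>n. cnj (\<phi> n) * \<psi> n) summable_on UNIV"
proof (rule abs_summable_summable)
  have "(\<lambda>n. (cmod (\<phi> n))\<^sup>2 + (cmod (\<psi> n))\<^sup>2) summable_on UNIV"
    using assms by (intro summable_on_add) (auto simp: ell2_def)
  moreover have "x * y \<le> x\<^sup>2 + y\<^sup>2" if "x \<ge> 0" "y \<ge> 0" for x y :: real
    using zero_le_power2[of "x - y"] mult_nonneg_nonneg[OF that]
    by (simp add: power2_eq_square algebra_simps)
  ultimately show "(\<lambda>n. norm (cnj (\<phi> n) * \<psi> n)) summable_on UNIV"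
    by (rule_tac summable_on_comparison_test) (auto simp: norm_mult)
qed

lemma critical_almost_mathieu_symmetric:
  assumes \<phi>: "\<phi> \<in> ell2" and \<psi>: "\<psi> \<in> ell2"
  shows "(\<Sum>\<^sub>\<infinity>n. cnj (\<phi> n) * critical_almost_mathieu \<alpha> \<theta> \<psi> n) =
         (\<Sum>\<^sub>\<infinity>n. cnj (critical_almost_mathieu \<alpha> \<theta> \<phi> n) * \<psi> n)"
proof -
  let ?H = "critical_almost_mathieu \<alpha> \<theta>"
  have sh: "(\<lambda>n. \<eta> (n + k)) \<in> ell2" if "\<eta> \<in> ell2" for \<eta> k
    using ell2_shift(1)[OF that] by (simp add: ell2_def)
  define w where "w n = cnj (\<phi> (n + 1)) * \<psi> n - cnj (\<phi> n) * \<psi> (n + -1)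
    + (cnj (\<phi> (n + -1)) * \<psi> n - cnj (\<phi> n) * \<psi> (n + 1))" for n
  have b: "bij_betw (\<lambda>n::int. n + k) UNIV UNIV" for k
    by (rule bij_betwI[where g="\<lambda>n. n - k"]) auto
  have eq: "(\<Sum>\<^sub>\<infinity>n. cnj (\<phi> (n + k)) * \<psi> n) = (\<Sum>\<^sub>\<infinity>n. cnj (\<phi> n) * \<psi> (n + - k))" for k
    using infsum_reindex_bij_betw[OF b[of k], of "\<lambda>n. cnj (\<phi> n) * \<psi> (n + - k)"] by simp
  have hs: "((\<lambda>n. cnj (\<phi> (n + k)) * \<psi> n - cnj (\<phi> n) * \<psi> (n + - k)) has_sum 0) UNIV" for k
  proof -
    let ?S = "\<Sum>\<^sub>\<infinity>n. cnj (\<phi> n) * \<psi> (n + - k)"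
    have "((\<lambda>n. cnj (\<phi> (n + k)) * \<psi> n) has_sum ?S) UNIV"
      unfolding eq[symmetric] by (rule has_sum_infsum[OF ell2_mult_summable[OF sh[OF \<phi>] \<psi>]])
    moreover have "((\<lambda>n. - (cnj (\<phi> n) * \<psi> (n + - k))) has_sum - ?S) UNIV"
      unfolding has_sum_uminus
      by simp (use has_sum_infsum[OF ell2_mult_summable[OF \<phi> sh[OF \<psi>, of "- k"]]] in simp)
    ultimately show ?thesis
      using has_sum_add by fastforce
  qed
  have w: "(w has_sum 0) UNIV"
    using has_sum_add[OF hs[of 1] hs[of "-1"]] by (simp add: w_def[abs_def])
  have "?H \<psi> \<in> ell2"
    using bounded_operator_critical_almost_mathieu \<psi> unfolding bounded_operator_def by blast
  then have "((\<lambda>n. cnj (\<phi> n) * ?H \<psi> n + w n) has_sum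
      (\<Sum>\<^sub>\<infinity>n. cnj (\<phi> n) * ?H \<psi> n) + 0) UNIV"
    by (intro has_sum_add w has_sum_infsum ell2_mult_summable \<phi>)
  moreover have "cnj (\<phi> n) * ?H \<psi> n + w n = cnj (?H \<phi> n) * \<psi> n" for n
    by (simp add: w_def critical_almost_mathieu_def algebra_simps)
  ultimately show ?thesis
    by (simp add: infsumI)
qed

end

theory Submission
  imports Defs "HOL-Computational_Algebra.Fundamental_Theorem_Algebra"
begin

text \<open>A point \<open>E\<close> of the spectrum has finitely supported approximate eigenvectors, and a change of
  gauge of the magnetic Laplacian on the square lattice turns them into approximate eigenvectors of
  a chiral Jacobi operator: its diagonal is zero and its off-diagonal entries \<open>1 + cis \<dots>\<close> come
  close to \<open>0\<close> along every orbit. Where these entries are small an approximate eigenvector can be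
  cut off at little cost, so that it localizes to an interval of length \<open>\<tau> q\<close> with error \<open>o(1/q)\<close>,
  for any fixed small \<open>\<tau>\<close>. On such an interval \<open>\<alpha>\<close> may be replaced by \<open>p/q\<close> with
  \<open>\<bar>\<alpha> - p/q\<bar> \<le> 1/q\<^sup>2\<close> at the cost of an error \<open>O(\<tau>/q)\<close>. Hence \<open>E\<close> has distance \<open>O(\<tau>/q)\<close> from
  an eigenvalue of a \<open>q\<close>-periodic chiral operator, and all these eigenvalues satisfy \<open>\<bar>P\<bar> \<le> 4\<close> for
  one polynomial \<open>P\<close> of degree \<open>q\<close>, which does not depend on the phase. At the phase for which the
  operator decouples, \<open>P\<close> is an orthogonal polynomial, and orthogonality gives
  \<open>(\<Sum>e. 1 / \<bar>P' e\<bar>) \<le> 1/q\<close>, the sum being over the roots of \<open>P\<close>. Therefore \<open>{\<bar>P\<bar> \<le> 4}\<close> is covered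
  by \<open>q\<close> intervals of total length \<open>O(1/q)\<close>, and enlarging them by \<open>O(\<tau>/q)\<close> shows that the
  spectrum has measure \<open>O(1/q + \<tau>)\<close>.\<close>

section \<open>Roots of orthogonal polynomials\<close>

text \<open>As \<open>q\<close> intervals get enlarged, every error must be small compared with 1/q,
  and two errors compete: an ordinary cutoff to length \<tau> q costs about 1/(\<tau> q), while a
  longer interval makes the replacement of \<alpha> by p/q too expensive. The way out is to use two
  rational approximations of \<alpha>. One with denominator \<open>n\<close> forces every block of
  \<open>n\<close> consecutive sites to contain hopping terms as small as (i + 2)/n up to a
  constant, for each i < n. Cutoffs that vary in a variable whose increments are inverse hopping
  terms then gain the factor L, the sum of 1/(i + 2) over i < n. Since the harmonic series diverges,
  \<open>n\<close> can be fixed with L at least a multiple of 1/\<tau>^2, and only afterwards is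
  \<open>q\<close> taken large compared with n/\<tau>; the cutoff error 1/(\<tau> q L) is then of
  order \<tau>/q. Both times only |\<alpha> - p/q| \<le> 1/q^2 enters, so every irrational \<alpha>
  is covered without a Diophantine condition. The bound 1/q on the sum of 1/|P'| rests on the
  product of |1 - w^k| over 0 < k < q being q, for a primitive q-th root of unity w.\<close>

lemma root_near_point_aux:
  fixes S :: "real set" and x :: real
  assumes "finite S" "x \<notin> S" "S \<noteq> {}" and L: "(\<Sum>d\<in>S. 1 / (x - d)) \<ge> 0"
  shows "\<exists>e\<in>S. \<bar>x - e\<bar> * (\<Prod>d\<in>S - {e}. \<bar>e - d\<bar>) \<le> exp 1 * (\<Prod>d\<in>S. \<bar>x - d\<bar>)"
proof -
  have "\<exists>d\<in>S. d < x"
  proof (rule ccontr)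
    assume "\<not> (\<exists>d\<in>S. d < x)"
    then have "1 / (x - d) < 0" if "d \<in> S" for d
      using that assms(2) by (metis diff_gt_0_iff_gt divide_less_0_1_iff
        linorder_neqE_linordered_idom minus_diff_eq neg_0_less_iff_less)
    then have "(\<Sum>d\<in>S. 1 / (x - d)) < (\<Sum>d\<in>S. 0)"
      using assms by (intro sum_strict_mono) auto
    with L show False by simp
  qed
  define e where "e = Max {d\<in>S. d < x}"
  have "e \<in> {d\<in>S. d < x}"
    unfolding e_def using \<open>\<exists>d\<in>S. d < x\<close> assms(1) by (intro Max_in) auto
  then have e: "e \<in> S" "e < x" and emax: "\<And>d. d \<in> S \<Longrightarrow> d < x \<Longrightarrow> d \<le> e"
    using assms(1) by (simp_all add: e_def)
  \<comment> \<open>No root lies strictly between \<open>e\<close> and \<open>x\<close>, so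
    \<open>(e - d) / (x - d)\<close> is positive and absolute values can be taken without losing a
    sign.\<close>
  have factor: "\<bar>e - d\<bar> \<le> \<bar>x - d\<bar> * exp (- (x - e) / (x - d))" if d: "d \<in> S - {e}" for d
  proof -
    have nz: "x - d \<noteq> 0" using d assms(2) by auto
    have "\<bar>e - d\<bar> = \<bar>x - d\<bar> * (1 - (x - e) / (x - d))"
    proof (cases "d < x")
      case True
      then have "d < e" using emax d by force
      then show ?thesis using True nz by (simp add: field_simps)
    next
      case False
      then show ?thesis using nz e by (simp add: field_simps)
    qed
    also have "\<dots> \<le> \<bar>x - d\<bar> * exp (- (x - e) / (x - d))"
    proof (intro mult_left_mono)
      show "1 - (x - e) / (x - d) \<le> exp (- (x - e) / (x - d))"
        using exp_ge_add_one_self[of "- ((x - e) / (x - d))"] by (simp only: minus_divide_left)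
    qed auto
    finally show ?thesis .
  qed
  have "(\<Prod>d\<in>S - {e}. \<bar>e - d\<bar>) \<le> (\<Prod>d\<in>S - {e}. \<bar>x - d\<bar> * exp (- (x - e) / (x - d)))"
    by (intro prod_mono) (use factor in auto)
  also have "\<dots> = (\<Prod>d\<in>S - {e}. \<bar>x - d\<bar>) * exp (\<Sum>d\<in>S - {e}. - (x - e) / (x - d))"
    using assms(1) by (simp add: prod.distrib exp_sum)
  also have "(\<Sum>d\<in>S - {e}. - (x - e) / (x - d)) = - (x - e) * (\<Sum>d\<in>S - {e}. 1 / (x - d))"
    by (simp add: sum_distrib_left)
  also have "(\<Sum>d\<in>S - {e}. 1 / (x - d)) = (\<Sum>d\<in>S. 1 / (x - d)) - 1 / (x - e)"
    using assms(1) e by (simp add: sum_diff1)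
  also have "(\<Prod>d\<in>S - {e}. \<bar>x - d\<bar>) * exp (- (x - e) * ((\<Sum>d\<in>S. 1 / (x - d)) - 1 / (x - e)))
      \<le> (\<Prod>d\<in>S - {e}. \<bar>x - d\<bar>) * exp 1"
  proof (intro mult_left_mono prod_nonneg)
    \<comment> \<open>The missing term \<open>d = e\<close> contributes exactly the 1 in the
      exponent; the remaining part has the sign given by the hypothesis \<open>L\<close>.\<close>
    have "- (x - e) * ((\<Sum>d\<in>S. 1 / (x - d)) - 1 / (x - e)) = 1 - (x - e) * (\<Sum>d\<in>S. 1 / (x - d))"
      using e by (simp add: right_diff_distrib) (simp add: field_simps)
    moreover have "(x - e) * (\<Sum>d\<in>S. 1 / (x - d)) \<ge> 0" using L e by simp
    ultimately show "exp (- (x - e) * ((\<Sum>d\<in>S. 1 / (x - d)) - 1 / (x - e))) \<le> exp 1"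
      by simp
  qed auto
  finally have "\<bar>x - e\<bar> * (\<Prod>d\<in>S - {e}. \<bar>e - d\<bar>) \<le> \<bar>x - e\<bar> * ((\<Prod>d\<in>S - {e}. \<bar>x - d\<bar>) * exp 1)"
    by (intro mult_left_mono) auto
  also have "\<dots> = exp 1 * (\<Prod>d\<in>S. \<bar>x - d\<bar>)"
    using assms(1) e(1) by (subst prod.remove[of S e]) auto
  finally show ?thesis using e(1) by blast
qed

text \<open>The root \<open>e\<close> is the neighbour of \<open>x\<close> on the side selected by the sign of the logarithmic
  derivative of \<open>\<Prod>d\<in>S. x - d\<close>; the factor \<open>exp 1\<close> then comes from \<open>1 + t \<le> exp t\<close>.\<close>

lemma root_near_point:
  fixes S :: "real set" and x :: real
  assumes "finite S" "S \<noteq> {}"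
  shows "\<exists>e\<in>S. \<bar>x - e\<bar> * (\<Prod>d\<in>S - {e}. \<bar>e - d\<bar>) \<le> exp 1 * (\<Prod>d\<in>S. \<bar>x - d\<bar>)"
proof (cases "x \<in> S")
  case True
  moreover have "0 \<le> exp 1 * (\<Prod>d\<in>S. \<bar>x - d\<bar>)"
    by (intro mult_nonneg_nonneg prod_nonneg) auto
  ultimately show ?thesis by (intro bexI[of _ x]) auto
next
  case False
  show ?thesis
  proof (cases "(\<Sum>d\<in>S. 1 / (x - d)) \<ge> 0")
    case True
    then show ?thesis using root_near_point_aux assms False by blast
  next
    case neg: False
    \<comment> \<open>Reflecting \<open>S\<close> and \<open>x\<close> at the origin reverses the
      sign of the logarithmic derivative.\<close>
    have "(\<Sum>d\<in>uminus ` S. 1 / (- x - d)) = (\<Sum>d\<in>S. 1 / (- x + d))"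
      by (subst sum.reindex) auto
    also have "\<dots> = - (\<Sum>d\<in>S. 1 / (x - d))"
      unfolding sum_negf[symmetric] by (intro sum.cong) (auto simp: divide_simps)
    finally have "(\<Sum>d\<in>uminus ` S. 1 / (- x - d)) \<ge> 0" using neg by simp
    moreover have "finite (uminus ` S)" "- x \<notin> uminus ` S" "uminus ` S \<noteq> {}"
      using assms False by auto
    ultimately obtain e where e: "e \<in> uminus ` S"
      "\<bar>- x - e\<bar> * (\<Prod>d\<in>uminus ` S - {e}. \<bar>e - d\<bar>) \<le> exp 1 * (\<Prod>d\<in>uminus ` S. \<bar>- x - d\<bar>)"
      using root_near_point_aux[of "uminus ` S" "- x"] by blast
    have "uminus ` S - {e} = uminus ` (S - {- e})"
      by auto
    then have 1: "(\<Prod>d\<in>uminus ` S - {e}. \<bar>e - d\<bar>) = (\<Prod>d\<in>S - {- e}. \<bar>- e - d\<bar>)"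
      by (simp add: prod.reindex abs_minus_commute add.commute)
    have 2: "(\<Prod>d\<in>uminus ` S. \<bar>- x - d\<bar>) = (\<Prod>d\<in>S. \<bar>x - d\<bar>)"
      by (simp add: prod.reindex) (intro prod.cong refl, linarith)
    have "\<bar>- x - e\<bar> = \<bar>x - - e\<bar>" by linarith
    then show ?thesis using e unfolding 1 2 by (intro bexI[of _ "- e"]) auto
  qed
qed

text \<open>The characteristic polynomials of the truncations of a Jacobi matrix with zero diagonal whose
  off-diagonal entries have squared absolute values \<open>b 1, b 2, \<dots>\<close>; the value \<open>b 0\<close> is not used.\<close>

fun jacobi_poly :: "(nat \<Rightarrow> real) \<Rightarrow> nat \<Rightarrow> complex poly" where
  "jacobi_poly b 0 = 1"
| "jacobi_poly b (Suc 0) = [:0, 1:]"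
| "jacobi_poly b (Suc (Suc n)) =
     [:0, 1:] * jacobi_poly b (Suc n) - smult (of_real (b (Suc n))) (jacobi_poly b n)"

lemma jacobi_poly_monic: "degree (jacobi_poly b n) = n \<and> lead_coeff (jacobi_poly b n) = 1"
proof (induction b n rule: jacobi_poly.induct)
  case (3 b n)
  define P where "P = [:0, 1:] * jacobi_poly b (Suc n)"
  define Q where "Q = smult (of_real (b (Suc n))) (jacobi_poly b n)"
  have P0: "jacobi_poly b (Suc n) \<noteq> 0" using 3(1) by force
  then have P: "degree P = Suc (Suc n)" "lead_coeff P = 1"
    using 3(1) unfolding P_def by (auto simp: degree_mult_eq lead_coeff_mult)
  have "degree Q \<le> n" using 3(2) unfolding Q_def by (metis degree_smult_le)
  then have Q: "degree Q < degree P" using P by simp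
  have "degree (P - Q) = degree P"
    using degree_add_eq_left[of "- Q" P] Q by simp
  moreover have "coeff Q (degree P) = 0" using Q by (rule coeff_eq_0)
  ultimately show ?case using P unfolding jacobi_poly.simps P_def[symmetric] Q_def[symmetric]
    by simp
qed auto

lemma jacobi_poly_cnj: "poly (jacobi_poly b n) (cnj z) = cnj (poly (jacobi_poly b n) z)"
  by (induction b n rule: jacobi_poly.induct) auto

lemma jacobi_poly_real: "poly (jacobi_poly b n) (of_real x) \<in> \<real>"
  using jacobi_poly_cnj[of b n "of_real x"] by (simp add: Reals_cnj_iff)

text \<open>These are the squared norms of the monic polynomials with respect to their normalized
  orthogonality measure.\<close>

definition jacobi_weight :: "(nat \<Rightarrow> real) \<Rightarrow> nat \<Rightarrow> real" where
  "jacobi_weight b n = (\<Prod>k=1..n. b k)"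

lemma jacobi_weight_Suc: "jacobi_weight b (Suc n) = jacobi_weight b n * b (Suc n)"
  by (simp add: jacobi_weight_def mult.commute)

lemma jacobi_weight_pos: "(\<And>k. 1 \<le> k \<Longrightarrow> k \<le> n \<Longrightarrow> b k > 0) \<Longrightarrow> jacobi_weight b n > 0"
  unfolding jacobi_weight_def by (intro prod_pos) auto

text \<open>At two different roots of \<open>jacobi_poly b (Suc m)\<close> the right-hand side
  vanishes: the vectors of values P 0, ..., P m at the roots are orthogonal for the weights
  \<open>1 / jacobi_weight b n\<close>. Up to scaling they are the eigenvectors of the truncated
  Jacobi matrix.\<close>

lemma christoffel_darboux:
  fixes x y :: complex
  assumes "\<And>k. 1 \<le> k \<Longrightarrow> k \<le> m \<Longrightarrow> b k > 0"
  defines "P \<equiv> \<lambda>n. poly (jacobi_poly b n)"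
  shows "(x - y) * (\<Sum>n\<le>m. P n x * P n y / of_real (jacobi_weight b n))
    = (P (Suc m) x * P m y - P m x * P (Suc m) y) / of_real (jacobi_weight b m)"
  using assms(1)
proof (induction m)
  case 0
  then show ?case by (simp add: jacobi_weight_def P_def)
next
  case (Suc m)
  have w: "jacobi_weight b m \<noteq> 0" "b (Suc m) \<noteq> 0"
    using jacobi_weight_pos[of m b] Suc.prems[of "Suc m"] Suc.prems by force+
  have IH: "(x - y) * (\<Sum>n\<le>m. P n x * P n y / of_real (jacobi_weight b n))
    = (P (Suc m) x * P m y - P m x * P (Suc m) y) / of_real (jacobi_weight b m)"
    using Suc by simp
  have r: "P (Suc (Suc m)) z = z * P (Suc m) z - of_real (b (Suc m)) * P m z" for z
    by (simp add: P_def)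
  show ?case
    unfolding sum.atMost_Suc distrib_left IH r jacobi_weight_Suc
    using w by (simp add: field_simps)
qed

text \<open>The limit of the previous formula as y tends to x, obtained by its own induction. At a
  root of the last polynomial it ties the derivative there to the squared norm of the
  eigenvector.\<close>

lemma christoffel_darboux_confluent:
  fixes x :: complex
  assumes "\<And>k. 1 \<le> k \<Longrightarrow> k \<le> m \<Longrightarrow> b k > 0"
  defines "P \<equiv> \<lambda>n. poly (jacobi_poly b n)" and "P' \<equiv> \<lambda>n. poly (pderiv (jacobi_poly b n))"
  shows "(\<Sum>n\<le>m. P n x * P n x / of_real (jacobi_weight b n))
    = (P' (Suc m) x * P m x - P' m x * P (Suc m) x) / of_real (jacobi_weight b m)"
  using assms(1)
proof (induction m)
  case 0
  then show ?case by (simp add: jacobi_weight_def P_def P'_def pderiv_pCons)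
next
  case (Suc m)
  have w: "jacobi_weight b m \<noteq> 0" "b (Suc m) \<noteq> 0"
    using jacobi_weight_pos[of m b] Suc.prems[of "Suc m"] Suc.prems by force+
  have IH: "(\<Sum>n\<le>m. P n x * P n x / of_real (jacobi_weight b n))
    = (P' (Suc m) x * P m x - P' m x * P (Suc m) x) / of_real (jacobi_weight b m)"
    using Suc by simp
  have r: "P (Suc (Suc m)) z = z * P (Suc m) z - of_real (b (Suc m)) * P m z" for z
    by (simp add: P_def)
  have r': "P' (Suc (Suc m)) z = P (Suc m) z + z * P' (Suc m) z - of_real (b (Suc m)) * P' m z"
    for z
    by (simp add: P_def P'_def pderiv_mult pderiv_diff pderiv_smult pderiv_pCons)
  show ?case
    unfolding sum.atMost_Suc IH r r' jacobi_weight_Suc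
    using w by (simp add: field_simps)
qed

text \<open>Bessel's inequality for a coordinate vector: \<open>v\<close> is the projection of the
  k-th unit vector onto the span of the \<open>u e\<close>, so its squared norm equals its own k-th
  entry, which therefore cannot exceed 1.\<close>

lemma bessel_finite:
  fixes u :: "'a \<Rightarrow> 'b \<Rightarrow> real"
  assumes "finite S" "finite N" "k \<in> N"
    and orth: "\<And>d e. d \<in> S \<Longrightarrow> e \<in> S \<Longrightarrow> (\<Sum>n\<in>N. u d n * u e n) = (if d = e then 1 else 0)"
  shows "(\<Sum>e\<in>S. (u e k)\<^sup>2) \<le> 1"
proof -
  define v where "v n = (\<Sum>e\<in>S. u e k * u e n)" for n
  have vv: "(\<Sum>n\<in>N. (v n)\<^sup>2) = (\<Sum>e\<in>S. (u e k)\<^sup>2)"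
  proof -
    have "(\<Sum>n\<in>N. (v n)\<^sup>2) = (\<Sum>n\<in>N. \<Sum>d\<in>S. \<Sum>e\<in>S. u d k * u e k * (u d n * u e n))"
      unfolding v_def power2_eq_square sum_product by (simp add: mult_ac)
    also have "\<dots> = (\<Sum>d\<in>S. \<Sum>e\<in>S. \<Sum>n\<in>N. u d k * u e k * (u d n * u e n))"
      by (subst sum.swap, intro sum.cong refl, rule sum.swap)
    also have "\<dots> = (\<Sum>d\<in>S. \<Sum>e\<in>S. u d k * u e k * (if d = e then 1 else 0))"
      by (intro sum.cong refl) (simp add: sum_distrib_left[symmetric] orth)
    also have "\<dots> = (\<Sum>e\<in>S. (u e k)\<^sup>2)"
      using assms(1) by (simp add: power2_eq_square if_distrib[of "\<lambda>t. _ * t"] cong: if_cong)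
    finally show ?thesis .
  qed
  have vk: "v k = (\<Sum>e\<in>S. (u e k)\<^sup>2)" unfolding v_def by (simp add: power2_eq_square)
  have "(v k)\<^sup>2 \<le> (\<Sum>n\<in>N. (v n)\<^sup>2)"
    using assms(2,3) by (intro member_le_sum) auto
  then have "v k * v k \<le> v k * 1" unfolding vv vk by (simp add: power2_eq_square)
  moreover have "v k \<ge> 0" unfolding vk by (intro sum_nonneg) auto
  ultimately show ?thesis using vk by (metis leI mult_le_cancel_left_pos zero_less_one less_trans)
qed

text \<open>By the confluent formula, 1/|P' e| is the product of the first and the last entry of the
  normalized eigenvector at \<open>e\<close>, divided by the square root of the last weight. The
  products are split by the arithmetic-geometric mean inequality, and Bessel bounds the sum of the
  squared first entries and that of the squared last entries by 1 each.\<close>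

lemma jacobi_poly_roots:
  assumes b: "\<And>k. 1 \<le> k \<Longrightarrow> k < q \<Longrightarrow> b k > 0" and q: "q > 0"
  obtains S :: "real set" where "finite S" "card S = q"
    "\<And>x. poly (jacobi_poly b q) (of_real x) = of_real (\<Prod>e\<in>S. x - e)"
    "(\<Sum>e\<in>S. 1 / (\<Prod>d\<in>S - {e}. \<bar>e - d\<bar>)) \<le> 1 / sqrt (\<Prod>k=1..<q. b k)"
proof -
  obtain m where m: "q = Suc m" using q by (cases q) auto
  define P where "P = (\<lambda>n. poly (jacobi_poly b n))"
  define w where "w = jacobi_weight b"
  have wpos: "w n > 0" if "n \<le> m" for n
    unfolding w_def using that b m by (intro jacobi_weight_pos) auto
  have b': "\<And>k. 1 \<le> k \<Longrightarrow> k \<le> m \<Longrightarrow> b k > 0" using b m by auto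
  define Z where "Z = {z. P q z = 0}"
  have nz: "jacobi_poly b q \<noteq> 0" using jacobi_poly_monic[of b q] q by auto
  have finZ: "finite Z" unfolding Z_def P_def by (rule poly_roots_finite[OF nz])
  have norm0: "(\<Sum>n\<le>m. (cmod (P n z))\<^sup>2 / w n) > 0" for z
  proof -
    have "(cmod (P 0 z))\<^sup>2 / w 0 \<le> (\<Sum>n\<le>m. (cmod (P n z))\<^sup>2 / w n)"
      using wpos by (intro member_le_sum) (auto intro!: divide_nonneg_pos)
    then show ?thesis by (simp add: P_def w_def jacobi_weight_def)
  qed
  have real: "z \<in> \<real>" if "z \<in> Z" for z
  proof -
    have "P (Suc m) z = 0" using that m Z_def by simp
    moreover from this have "P (Suc m) (cnj z) = 0" by (simp add: P_def jacobi_poly_cnj del: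
      jacobi_poly.simps)
    \<comment> \<open>Both \<open>z\<close> and \<open>cnj z\<close> are roots, and the sum
      belonging to this pair is a positive weighted norm, so \<open>z - cnj z\<close> must
      vanish.\<close>
    ultimately have "(z - cnj z) * (\<Sum>n\<le>m. P n z * P n (cnj z) / of_real (w n)) = 0"
      using christoffel_darboux[of m b z "cnj z"] b' unfolding P_def w_def by simp
    moreover have "(\<Sum>n\<le>m. P n z * P n (cnj z) / of_real (w n))
      = of_real (\<Sum>n\<le>m. (cmod (P n z))\<^sup>2 / w n)"
      unfolding of_real_sum unfolding of_real_divide complex_norm_square
        by (simp add: P_def jacobi_poly_cnj)
    ultimately have "z - cnj z = 0" using norm0[of z] by (simp only: mult_eq_0_iff of_real_eq_0_iff)
      simp
    then show ?thesis by (simp add: Reals_cnj_iff)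
  qed
  define S where "S = Re ` Z"
  have ZS: "Z = of_real ` S" unfolding S_def using real by (auto simp: image_iff)
  have finS: "finite S" using finZ S_def by simp
  define p where "p n x = Re (P n (of_real x))" for n x
  have pP: "P n (of_real x) = of_real (p n x)" for n x
    using jacobi_poly_real[of b n x] unfolding p_def P_def by (simp)
  define N where "N x = (\<Sum>n\<le>m. (p n x)\<^sup>2 / w n)" for x
  have Npos: "N x > 0" for x using norm0[of "of_real x"] unfolding N_def pP by (simp add: pP)
  have SZ: "P q (of_real e) = 0" if "e \<in> S" for e using that ZS Z_def by auto
  have deriv: "poly (pderiv (jacobi_poly b q)) (of_real e) * of_real (p m e) / of_real (w m)
    = of_real (N e)" if "e \<in> S" for e
  proof -
    have "(\<Sum>n\<le>m. P n (of_real e) * P n (of_real e) / of_real (w n))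
      = poly (pderiv (jacobi_poly b q)) (of_real e) * P m (of_real e) / of_real (w m)"
      using christoffel_darboux_confluent[of m b "of_real e"] b' SZ[OF that] unfolding P_def w_def m
        by simp
    then show ?thesis unfolding pP N_def by (simp add: power2_eq_square)
  qed
  \<comment> \<open>The positive number \<open>N e\<close> is a multiple of the derivative at
    \<open>e\<close>, so all roots are simple.\<close>
  have dnz: "poly (pderiv (jacobi_poly b q)) z \<noteq> 0" if "z \<in> Z" for z
    using deriv that Npos unfolding ZS by (metis (no_types, lifting) imageE divide_eq_0_iff
      less_irrefl mult_eq_0_iff of_real_eq_0_iff)
  have "rsquarefree (jacobi_poly b q)"
    unfolding rsquarefree_roots using dnz Z_def P_def by auto
  then have "jacobi_poly b q = (\<Prod>z\<in>Z. [:-z, 1:])"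
    using complex_poly_decompose_rsquarefree[of "jacobi_poly b q"] conjunct2[OF jacobi_poly_monic[of
      b q]]
    unfolding Z_def P_def by (simp only: smult_1_left)
  also have "\<dots> = (\<Prod>e\<in>S. [:- of_real e, 1:])"
    unfolding ZS by (subst prod.reindex) (auto simp: inj_on_def)
  finally have fac: "jacobi_poly b q = (\<Prod>e\<in>S. [:- of_real e, 1:])" .
  have card: "card S = q"
    using jacobi_poly_monic[of b q] unfolding fac by (simp add: degree_prod_eq_sum_degree)
  have pd: "poly (pderiv (jacobi_poly b q)) (of_real e) = of_real (\<Prod>d\<in>S - {e}. e - d)" if "e \<in> S"
    for e
  proof -
    have "jacobi_poly b q = [:- of_real e, 1:] * (\<Prod>d\<in>S - {e}. [:- of_real d, 1:])"
      unfolding fac using finS that by (rule prod.remove)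
    then show ?thesis by (simp only: pderiv_mult) (simp add: pderiv_pCons poly_prod)
  qed
  define D where "D e = (\<Prod>d\<in>S - {e}. \<bar>e - d\<bar>)" for e
  have Dpos: "D e > 0" for e unfolding D_def by (intro prod_pos) auto
  have DN: "D e * \<bar>p m e\<bar> / w m = N e" if "e \<in> S" for e
  proof -
    have "(\<Prod>d\<in>S - {e}. e - d) * p m e / w m = N e"
      using deriv[OF that] unfolding pd[OF that] of_real_mult[symmetric] of_real_divide[symmetric]
        of_real_eq_iff .
    then have "\<bar>(\<Prod>d\<in>S - {e}. e - d) * p m e / w m\<bar> = N e" using Npos[of e] by simp
    then show ?thesis using wpos[of m] by (simp add: abs_mult D_def abs_prod)
  qed
  define u where "u e n = p n e / sqrt (w n * N e)" for e n
  have orth: "(\<Sum>n\<le>m. u d n * u e n) = (if d = e then 1 else 0)" if "d \<in> S" "e \<in> S" for d e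
  proof -
    have "(\<Sum>n\<le>m. u d n * u e n) = (\<Sum>n\<le>m. p n d * p n e / w n) / sqrt (N d * N e)"
      unfolding sum_divide_distrib u_def using wpos
      by (intro sum.cong refl) (auto simp: real_sqrt_mult field_simps less_imp_le)
    moreover have "(\<Sum>n\<le>m. p n d * p n e / w n) = (if d = e then N e else 0)"
    proof (cases "d = e")
      case True
      then show ?thesis by (simp add: N_def power2_eq_square)
    next
      case False
      have "(of_real d - of_real e) * (\<Sum>n\<le>m. P n (of_real d) * P n (of_real e) / of_real (w n)) = 0"
        using christoffel_darboux[of m b "of_real d" "of_real e"] b' SZ[OF that(1)] SZ[OF that(2)]
          unfolding P_def w_def m by simp
      then have "of_real (\<Sum>n\<le>m. p n d * p n e / w n) = (0::complex)"
        unfolding pP using False by simp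
      then show ?thesis using False by (simp only: of_real_eq_0_iff if_False)
    qed
    ultimately show ?thesis using Npos[of e] by simp
  qed
  have bound: "1 / D e \<le> 1 / sqrt (w m) * ((u e m)\<^sup>2 / 2 + (u e 0)\<^sup>2 / 2)" if "e \<in> S" for e
  proof -
    have "1 / D e = \<bar>p m e\<bar> / (w m * N e)"
      unfolding DN[OF that, symmetric] using Dpos[of e] wpos[of m] DN[OF that] Npos[of e]
      by (auto simp: field_simps)
    also have "\<dots> = 1 / sqrt (w m) * (\<bar>u e m\<bar> * \<bar>u e 0\<bar>)"
    proof -
      have "w m * N e = sqrt (w m) * sqrt (w m) * (sqrt (N e) * sqrt (N e))"
        using wpos[of m] Npos[of e] by simp
      then show ?thesis using wpos[of m] Npos[of e]
        unfolding u_def by (simp add: p_def P_def w_def jacobi_weight_def real_sqrt_mult abs_mult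
          del: real_sqrt_mult_self)
    qed
    also have "\<bar>u e m\<bar> * \<bar>u e 0\<bar> \<le> (u e m)\<^sup>2 / 2 + (u e 0)\<^sup>2 / 2"
      using sum_squares_bound[of "\<bar>u e m\<bar>" "\<bar>u e 0\<bar>"] by simp
    finally show ?thesis using wpos[of m] by (simp add: divide_simps)
  qed
  have "(\<Sum>e\<in>S. 1 / D e) \<le> (\<Sum>e\<in>S. 1 / sqrt (w m) * ((u e m)\<^sup>2 / 2 + (u e 0)\<^sup>2 / 2))"
    by (intro sum_mono bound)
  also have "\<dots> = 1 / sqrt (w m) * ((\<Sum>e\<in>S. (u e m)\<^sup>2) / 2 + (\<Sum>e\<in>S. (u e 0)\<^sup>2) / 2)"
    unfolding sum_distrib_left[symmetric] sum.distrib sum_divide_distrib ..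
  also have "\<dots> \<le> 1 / sqrt (w m) * (1 / 2 + 1 / 2)"
    using wpos[of m] bessel_finite[OF finS, of "{..m}" m u, OF _ _ orth] bessel_finite[OF finS, of
      "{..m}" 0 u, OF _ _ orth]
    by (intro mult_left_mono add_mono divide_right_mono) auto
  finally have "(\<Sum>e\<in>S. 1 / D e) \<le> 1 / sqrt (w m)" by simp
  moreover have "w m = (\<Prod>k=1..<q. b k)"
    unfolding w_def jacobi_weight_def m by (intro prod.cong) auto
  moreover have "poly (jacobi_poly b q) (of_real x) = of_real (\<Prod>e\<in>S. x - e)" for x
    unfolding fac by (simp add: poly_prod)
  ultimately show ?thesis using that[OF finS card] unfolding D_def by simp
qed

section \<open>Eigenvalues of periodic chiral operators\<close>

text \<open>The entry \<open>a s\<close> sits on the bond between \<open>s - 1\<close> and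
  \<open>s\<close>; this convention makes the operator symmetric.\<close>

definition chiral :: "(int \<Rightarrow> complex) \<Rightarrow> (int \<Rightarrow> complex) \<Rightarrow> int \<Rightarrow> complex" where
  "chiral a f s = a s * f (s - 1) + cnj (a (s + 1)) * f (s + 1)"

lemma sum_periodic_shift:
  fixes F :: "int \<Rightarrow> 'a::ab_group_add"
  assumes "\<And>s. F (s + int q) = F s"
  shows "(\<Sum>s\<in>{0..<int q}. F (s + 1)) = (\<Sum>s\<in>{0..<int q}. F s)"
proof (cases "q = 0")
  case False
  have "(\<Sum>s\<in>{0..<int q}. F (s + 1)) = (\<Sum>s\<in>{1..<int q + 1}. F s)"
    by (rule sum.reindex_bij_witness[of _ "\<lambda>s. s - 1" "\<lambda>s. s + 1"]) auto
  also have "{1..<int q + 1} = insert (int q) {1..<int q}" using False by auto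
  also have "(\<Sum>s\<in>\<dots>. F s) = F 0 + (\<Sum>s\<in>{1..<int q}. F s)" using assms[of 0] by simp
  also have "\<dots> = (\<Sum>s\<in>insert 0 {1..<int q}. F s)" by simp
  also have "insert 0 {1..<int q} = {0..<int q}" using False by auto
  finally show ?thesis .
qed simp

lemma periodic_mod:
  fixes f :: "int \<Rightarrow> 'a"
  assumes "\<And>s. f (s + int q) = f s"
  shows "f (s mod int q) = f s"
proof -
  have nat: "f (s + int (k * q)) = f s" for s k
  proof (induction k)
    case (Suc k)
    have "f (s + int (Suc k * q)) = f ((s + int (k * q)) + int q)" by (simp add: algebra_simps)
    then show ?case using Suc assms by simp
  qed simp
  show ?thesis
  proof (cases "s div int q \<ge> 0")
    case True
    then obtain k where "s div int q = int k" by (metis nonneg_int_cases)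
    then have "s = s mod int q + int (k * q)" by (metis add.commute div_mult_mod_eq of_nat_mult)
    then show ?thesis using nat[of "s mod int q" k] by simp
  next
    case False
    then obtain k where "- (s div int q) = int k" by (metis nonneg_int_cases linear neg_0_le_iff_le)
    then have "s mod int q = s + int (k * q)"
      by (metis add.commute minus_mult_left minus_div_mult_eq_mod of_nat_mult uminus_add_conv_diff)
    then show ?thesis using nat[of s k] by simp
  qed
qed

lemma cmod_add_real_mult_squared:
  "(cmod (x + of_real t * y))\<^sup>2 = (cmod x)\<^sup>2 + 2 * t * Re (cnj y * x) + t\<^sup>2 * (cmod y)\<^sup>2"
  unfolding cmod_power2 by (simp add: power2_eq_square algebra_simps)

text \<open>For small negative t the linear term would win; \<open>- (A / k)\<close> with
  \<open>k\<close> above |C| is small enough.\<close>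

lemma nonneg_quadratic_imp_zero:
  fixes A C :: real
  assumes "\<And>t. 0 \<le> 2 * t * A + t\<^sup>2 * C" "A \<ge> 0"
  shows "A = 0"
proof (rule ccontr)
  assume "A \<noteq> 0"
  then have A: "A > 0" using assms(2) by simp
  define k where "k = \<bar>C\<bar> + 1"
  have k: "k > 0" "C \<le> k" by (auto simp: k_def)
  have "0 \<le> 2 * (- (A / k)) * A + (A / k)\<^sup>2 * C" using assms(1)[of "- (A / k)"] by simp
  also have "(A / k)\<^sup>2 * C \<le> (A / k)\<^sup>2 * k" using k by (intro mult_left_mono) auto
  also have "2 * (- (A / k)) * A + (A / k)\<^sup>2 * k = - (A * A / k)"
    using k by (simp add: field_simps power2_eq_square)
  finally have "A * A / k \<le> 0" by simp
  moreover have "A * A / k > 0" using A k by simp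
  ultimately show False by simp
qed

text \<open>Let D be the chiral operator minus E on periodic sequences. A unit vector
  \<open>v\<close> minimizing the norm of D v satisfies D (D v) = m^2 v, where m \<le> \<delta> is
  the minimum. Factoring D^2 - m^2 yields an eigenvector of D for m or for -m.\<close>

lemma periodic_near_eigenvalue:
  fixes a g :: "int \<Rightarrow> complex" and E \<delta> :: real
  assumes q: "q > 0" and aper: "\<And>s. a (s + int q) = a s"
    and gper: "\<And>s. g (s + int q) = g s" and g0: "g \<noteq> (\<lambda>s. 0)" and \<delta>: "\<delta> \<ge> 0"
    and le: "(\<Sum>s\<in>{0..<int q}. (cmod (chiral a g s - of_real E * g s))\<^sup>2)
      \<le> \<delta>\<^sup>2 * (\<Sum>s\<in>{0..<int q}. (cmod (g s))\<^sup>2)"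
  obtains E' f where "\<bar>E' - E\<bar> \<le> \<delta>" "\<And>s. f (s + int q) = f s" "f \<noteq> (\<lambda>s. 0)"
    "\<And>s. chiral a f s = of_real E' * f s"
proof -
  define I where "I = {0..<int q}"
  define V where "V = {f :: int \<Rightarrow> complex. \<forall>s. f (s + int q) = f s}"
  define D where "D f s = chiral a f s - of_real E * f s" for f s
  define N where "N f = (\<Sum>s\<in>I. (cmod (f s))\<^sup>2)" for f :: "int \<Rightarrow> complex"
  define ip where "ip f h = (\<Sum>s\<in>I. cnj (f s) * h s)" for f h :: "int \<Rightarrow> complex"
  have finI: "finite I" by (simp add: I_def)
  have DV: "D f \<in> V" if "f \<in> V" for f
  proof -
    have "f (s + int q - 1) = f (s - 1)" "f (s + int q + 1) = f (s + 1)" "a (s + int q + 1)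
      = a (s + 1)" for s
    proof -
      have "f (s - 1 + int q) = f (s - 1)" "f (s + 1 + int q) = f (s + 1)" using that
        by (auto simp: V_def)
      then show "f (s + int q - 1) = f (s - 1)" "f (s + int q + 1) = f (s + 1)"
        by (simp_all add: algebra_simps)
      show "a (s + int q + 1) = a (s + 1)" using aper[of "s + 1"] by (simp add: algebra_simps)
    qed
    then show ?thesis using that aper by (simp add: V_def D_def chiral_def)
  qed
  have Dlin: "D (\<lambda>s. f s + c * h s) = (\<lambda>s. D f s + c * D h s)" for f h c
    by (auto simp: D_def chiral_def algebra_simps)
  have sym: "ip (D f) h = ip f (D h)" if "f \<in> V" "h \<in> V" for f h
  proof -
    have fs: "f (s + int q) = f s" "h (s + int q) = h s" for s using that by (auto simp: V_def)
    have fs1: "f (s + int q - 1) = f (s - 1)" "h (s + int q - 1) = h (s - 1)" for s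
      using fs(1)[of "s - 1"] fs(2)[of "s - 1"] by (simp_all add: algebra_simps)
    have 1: "(\<Sum>s\<in>I. cnj (a (s + 1)) * cnj (f s) * h (s + 1))
      = (\<Sum>s\<in>I. cnj (a s) * cnj (f (s - 1)) * h s)"
      unfolding I_def using sum_periodic_shift[of "\<lambda>s. cnj (a s) * cnj (f (s - 1)) * h s" q] fs fs1
        aper by simp
    have 2: "(\<Sum>s\<in>I. a (s + 1) * cnj (f (s + 1)) * h s) = (\<Sum>s\<in>I. a s * cnj (f s) * h (s - 1))"
      unfolding I_def using sum_periodic_shift[of "\<lambda>s. a s * cnj (f s) * h (s - 1)" q] fs fs1 aper
        by simp
    have "ip (D f) h = (\<Sum>s\<in>I. cnj (a s) * cnj (f (s - 1)) * h s) + (\<Sum>s\<in>I. a (s + 1) * cnj (f (s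
      + 1)) * h s)
        - (\<Sum>s\<in>I. of_real E * cnj (f s) * h s)"
      unfolding ip_def D_def chiral_def sum.distrib[symmetric] sum_subtractf[symmetric]
      by (intro sum.cong refl) (simp add: algebra_simps)
    also have "\<dots> = (\<Sum>s\<in>I. cnj (a (s + 1)) * cnj (f s) * h (s + 1)) + (\<Sum>s\<in>I. a s * cnj (f s) * h (s -
      1))
        - (\<Sum>s\<in>I. of_real E * cnj (f s) * h s)"
      by (simp only: 1 2)
    also have "\<dots> = ip f (D h)"
      unfolding ip_def D_def chiral_def sum.distrib[symmetric] sum_subtractf[symmetric]
      by (intro sum.cong refl) (simp add: algebra_simps)
    finally show ?thesis .
  qed
  have Nadd: "N (\<lambda>s. f s + of_real t * h s) = N f + 2 * t * Re (ip h f) + t\<^sup>2 * N h" for f h t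
    unfolding N_def ip_def cmod_add_real_mult_squared sum.distrib sum_distrib_left[symmetric] Re_sum
      ..
  have ipN: "ip f f = of_real (N f)" for f
    unfolding ip_def N_def of_real_sum complex_norm_square by (intro sum.cong refl mult.commute)
  have N0: "f = (\<lambda>s. 0)" if "N f = 0" "f \<in> V" for f
  proof
    fix s
    have "\<forall>s\<in>I. (cmod (f s))\<^sup>2 = 0" using that(1) finI unfolding N_def
      by (subst (asm) sum_nonneg_eq_0_iff) auto
    then have fI: "f s = 0" if "s \<in> I" for s using that by auto
    have "s mod int q \<in> I" using q by (simp add: I_def)
    then have "f (s mod int q) = 0" by (rule fI)
    moreover have "f (s mod int q) = f s" using that(2) by (intro periodic_mod) (simp add: V_def)
    ultimately show "f s = 0" by simp
  qed
  define K where "K = {f \<in> V. N f = 1}"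
  have coord: "continuous_on UNIV (\<lambda>f::int \<Rightarrow> complex. f s)" for s
    by simp
  \<comment> \<open>The unit sphere of the periodic sequences is realized as a closed subset of a
    product of closed discs, which is compact by Tychonoff.\<close>
  have "compactin (product_topology (\<lambda>i::int. euclidean) UNIV) (PiE UNIV (\<lambda>i. cball (0::complex)
    1))"
    by (subst compactin_PiE) auto
  then have comp: "compact (PiE UNIV (\<lambda>i::int. cball (0::complex) 1))"
    by (simp add: euclidean_product_topology)
  have closedV: "closed V"
  proof -
    have "V = (\<Inter>s. {f. f (s + int q) = f s})" by (auto simp: V_def)
    then show ?thesis by (auto intro!: closed_INT closed_Collect_eq)
  qed
  have contN: "continuous_on UNIV N" unfolding N_def by (intro continuous_intros coord)
  have contQ: "continuous_on UNIV (\<lambda>f. N (D f))" unfolding N_def D_def chiral_def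
    by (intro continuous_intros coord)
  have closedK: "closed K"
  proof -
    have "K = V \<inter> {f. N f = 1}" by (auto simp: K_def)
    then show ?thesis using closedV contN by (auto intro!: closed_Int closed_Collect_eq)
  qed
  have "K \<subseteq> PiE UNIV (\<lambda>i. cball 0 1)"
  proof
    fix f assume f: "f \<in> K"
    have "cmod (f s) \<le> 1" for s
    proof (rule ccontr)
      assume s: "\<not> cmod (f s) \<le> 1"
      have "(cmod (f (s mod int q)))\<^sup>2 \<le> N f"
        unfolding N_def using q finI by (intro member_le_sum) (auto simp: I_def)
      moreover have "f (s mod int q) = f s" using f by (intro periodic_mod) (simp add: K_def V_def)
      ultimately show False using s f by (simp add: K_def power_le_one_iff)
    qed
    then show "f \<in> PiE UNIV (\<lambda>i. cball 0 1)" by (auto simp: PiE_def)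
  qed
  then have compK: "compact K" using comp closedK by (metis compact_Int_closed inf.absorb_iff2)
  have gV: "g \<in> V" using gper by (simp add: V_def)
  have Nnn: "N f \<ge> 0" for f unfolding N_def by (intro sum_nonneg) auto
  have Nsc: "N (\<lambda>s. of_real c * f s) = c\<^sup>2 * N f" for c f
    by (simp add: N_def norm_mult power_mult_distrib sum_distrib_left)
  have Dsc: "D (\<lambda>s. of_real c * f s) = (\<lambda>s. of_real c * D f s)" for c f
    by (auto simp: D_def chiral_def algebra_simps)
  have Vsc: "(\<lambda>s. c * f s) \<in> V" if "f \<in> V" for f c using that by (simp add: V_def)
  have norml: "(\<lambda>s. of_real (1 / sqrt (N f)) * f s) \<in> K" if "f \<in> V" "f \<noteq> (\<lambda>s. 0)" for f
  proof -
    have "N f > 0" using N0 that Nnn[of f] by (metis less_eq_real_def)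
    then have "N (\<lambda>s. of_real (1 / sqrt (N f)) * f s) = 1" unfolding Nsc by (simp add: power_divide)
    then show ?thesis using Vsc[OF that(1), of "of_real (1 / sqrt (N f))"] unfolding K_def by blast
  qed
  have "K \<noteq> {}" using norml[OF gV g0] by blast
  then obtain v where v: "v \<in> K" and vmin: "\<And>f. f \<in> K \<Longrightarrow> N (D v) \<le> N (D f)"
    using continuous_attains_inf[OF compK _ continuous_on_subset[OF contQ]] by blast
  define m2 where "m2 = N (D v)"
  have vV: "v \<in> V" "N v = 1" using v by (auto simp: K_def)
  have min: "m2 * N f \<le> N (D f)" if f: "f \<in> V" for f
  proof (cases "f = (\<lambda>s. 0)")
    case True
    then show ?thesis using Nnn[of "D f"] by (simp add: N_def)
  next
    case False
    then have pos: "N f > 0" using N0 f Nnn[of f] by (metis less_eq_real_def)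
    have "m2 \<le> (1 / sqrt (N f))\<^sup>2 * N (D f)"
      using vmin[OF norml[OF f False]] unfolding Dsc Nsc m2_def .
    then show ?thesis using pos by (simp add: power_divide field_simps)
  qed
  define u where "u s = D (D v) s - of_real m2 * v s" for s
  have uV: "u \<in> V" using DV[OF DV[OF vV(1)]] vV(1) by (simp add: V_def u_def)
  have ipu: "Re (ip u (D (D v))) - m2 * Re (ip u v) = N u"
  proof -
    have "ip u (D (D v)) - of_real m2 * ip u v = ip u u"
      unfolding ip_def u_def sum_distrib_left sum_subtractf[symmetric]
      by (intro sum.cong refl) (simp add: algebra_simps)
    then have "Re (ip u (D (D v)) - of_real m2 * ip u v) = Re (of_real (N u))" unfolding ipN
      by (simp only:)
    then show ?thesis by simp
  qed
  \<comment> \<open>First variation at the minimizer in the direction of the residual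
    \<open>u\<close> of D (D v) = m2 v; its linear coefficient is the squared norm of
    \<open>u\<close> itself.\<close>
  have "0 \<le> 2 * t * N u + t\<^sup>2 * (N (D u) - m2 * N u)" for t
  proof -
    have "(\<lambda>s. v s + of_real t * u s) \<in> V" using uV vV by (simp add: V_def)
    from min[OF this] have "m2 * (N v + 2 * t * Re (ip u v) + t\<^sup>2 * N u)
        \<le> N (D v) + 2 * t * Re (ip (D u) (D v)) + t\<^sup>2 * N (D u)"
      unfolding Dlin Nadd .
    then have "0 \<le> 2 * t * (Re (ip u (D (D v))) - m2 * Re (ip u v)) + t\<^sup>2 * (N (D u) - m2 * N u)"
      unfolding sym[OF uV DV[OF vV(1)]] vV(2) m2_def[symmetric] by (simp add: algebra_simps)
    then show ?thesis unfolding ipu .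
  qed
  then have "N u = 0" by (rule nonneg_quadratic_imp_zero) (rule Nnn)
  then have u0: "u = (\<lambda>s. 0)" using N0 uV by blast
  define m where "m = sqrt m2"
  have m: "m \<ge> 0" "m\<^sup>2 = m2" using Nnn by (auto simp: m_def m2_def)
  have DDv: "D (D v) s = of_real m * (of_real m * v s)" for s
    using fun_cong[OF u0, of s] m(2) by (simp add: u_def power2_eq_square flip: of_real_mult
      mult.assoc)
  have "m2 * N g \<le> \<delta>\<^sup>2 * N g"
    using min[OF gV] le unfolding N_def D_def I_def by linarith
  moreover have "N g > 0" using N0 gV g0 Nnn[of g] by (metis less_eq_real_def)
  ultimately have "m \<le> \<delta>" using m \<delta> by (metis mult_le_cancel_right_pos power2_le_imp_le)
  \<comment> \<open>\<open>w\<close> is (D + m) v: if it vanishes, \<open>v\<close> is an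
    eigenvector of D for -m, otherwise \<open>w\<close> is one for m.\<close>
  define w where "w s = D v s + of_real m * v s" for s
  show thesis
  proof (cases "w = (\<lambda>s. 0)")
    case True
    have "v \<noteq> (\<lambda>s. 0)" using vV(2) by (auto simp: N_def)
    moreover have "chiral a v s = of_real (E - m) * v s" for s
      using fun_cong[OF True, of s] by (simp add: w_def D_def algebra_simps)
    ultimately show thesis using that[of "E - m" v] m \<open>m \<le> \<delta>\<close> vV(1) by (simp add: V_def)
  next
    case False
    have "D w = (\<lambda>s. D (D v) s + of_real m * D v s)" unfolding w_def Dlin ..
    then have "D w s = of_real m * w s" for s by (simp add: DDv w_def algebra_simps)
    then have "chiral a w s = of_real (E + m) * w s" for s by (simp add: D_def algebra_simps)
    moreover have "w \<in> V" using vV(1) DV[OF vV(1)] by (simp add: V_def w_def)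
    ultimately show thesis using that[of "E + m" w] m \<open>m \<le> \<delta>\<close> False by (simp add: V_def)
  qed
qed

section \<open>Transfer matrices and independence of the phase\<close>

lemma monom_minus_one_factor:
  fixes w :: complex
  assumes q: "q > 0" and wq: "w ^ q = 1" and prim: "\<And>k. 0 < k \<Longrightarrow> k < q \<Longrightarrow> w ^ k \<noteq> 1"
  shows "monom 1 q - 1 = (\<Prod>k<q. [:- (w ^ k), 1:])"
proof -
  have w0: "w \<noteq> 0" using wq q by (auto simp: power_0_left)
  have inj: "inj_on (\<lambda>k. w ^ k) {..<q}"
  proof (rule linorder_inj_onI')
    fix i j assume ij: "i \<in> {..<q}" "j \<in> {..<q}" "i < j"
    show "w ^ i \<noteq> w ^ j"
    proof
      assume "w ^ i = w ^ j"
      also have "w ^ j = w ^ i * w ^ (j - i)" using ij by (simp flip: power_add)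
      finally have "w ^ (j - i) = 1" using w0 by simp
      with prim[of "j - i"] ij show False by (simp add: less_imp_diff_less)
    qed
  qed
  have deg: "degree (monom 1 q - 1 :: complex poly) = q"
    using q degree_add_eq_left[of "-1" "monom (1::complex) q"] by (simp add: degree_monom_eq)
  have lead: "lead_coeff (monom 1 q - 1 :: complex poly) = 1"
    unfolding deg using q by (simp add: coeff_1)
  show ?thesis
  proof (rule poly_eqI_degree_lead_coeff[where A = "(\<lambda>k. w ^ k) ` {..<q}" and n = q])
    show "coeff (monom 1 q - 1) q = coeff (\<Prod>k<q. [:- (w ^ k), 1:]) q"
    proof -
      have "degree (\<Prod>k<q. [:- (w ^ k), 1:]) = q" by (simp add: degree_prod_eq_sum_degree)
      moreover have "lead_coeff (\<Prod>k<q. [:- (w ^ k), 1:]) = 1" by (simp add: lead_coeff_prod)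
      ultimately show ?thesis using lead deg by simp
    qed
    show "q \<le> card ((\<lambda>k. w ^ k) ` {..<q})" using card_image[OF inj] by simp
    show "degree (monom 1 q - 1 :: complex poly) \<le> q" using deg by simp
    show "degree (\<Prod>k<q. [:- (w ^ k), 1:]) \<le> q" by (simp add: degree_prod_eq_sum_degree)
    fix z assume "z \<in> (\<lambda>k. w ^ k) ` {..<q}"
    then obtain k where k: "k < q" "z = w ^ k" by auto
    have "z ^ q = 1" using k wq by (metis mult.commute power_mult power_one)
    moreover have "poly (\<Prod>k<q. [:- (w ^ k), 1:]) z = 0"
      unfolding poly_prod using k by (intro prod_zero) auto
    ultimately show "poly (monom 1 q - 1) z = poly (\<Prod>k<q. [:- (w ^ k), 1:]) z"
      by (simp add: poly_monom)
  qed
qed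

text \<open>The factorization of X^q - 1 at \<open>- 1 / u\<close>. It makes the product of the
  hopping terms over one period explicit, hence of modulus at most 2 when \<open>u\<close> lies on
  the unit circle.\<close>

lemma prod_one_plus_roots:
  fixes w :: complex
  assumes q: "q > 0" and wq: "w ^ q = 1" and prim: "\<And>k. 0 < k \<Longrightarrow> k < q \<Longrightarrow> w ^ k \<noteq> 1"
  shows "(\<Prod>k<q. 1 + w ^ k * u) = 1 - (- u) ^ q"
proof (cases "u = 0")
  case True
  then show ?thesis using q by simp
next
  case False
  have fac: "monom 1 q - 1 = (\<Prod>k<q. [:- (w ^ k), 1:])"
    using assms by (rule monom_minus_one_factor)
  have "(\<Prod>k<q. 1 + w ^ k * u) = (\<Prod>k<q. (- u) * (- 1 / u - w ^ k))"
    using False by (intro prod.cong refl) (simp add: field_simps)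
  also have "\<dots> = (- u) ^ q * (\<Prod>k<q. - 1 / u - w ^ k)"
    unfolding prod.distrib prod_constant by simp
  also have "(\<Prod>k<q. - 1 / u - w ^ k) = (\<Prod>k<q. poly [:- (w ^ k), 1:] (- 1 / u))"
    by (intro prod.cong refl) simp
  also have "(- u) ^ q * \<dots> = (- u) ^ q * poly (\<Prod>k<q. [:- (w ^ k), 1:]) (- 1 / u)"
    unfolding poly_prod ..
  also have "\<dots> = (- u) ^ q * ((- 1 / u) ^ q - 1)"
    unfolding fac[symmetric] by (simp add: poly_monom)
  also have "\<dots> = ((- u) * (- 1 / u)) ^ q - (- u) ^ q"
    by (simp only: right_diff_distrib power_mult_distrib mult_1_right)
  finally show ?thesis using False by simp
qed

text \<open>The derivative of X^q - 1 at 1. This is the source of the factor 1/q in the estimate on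
  the roots.\<close>

lemma prod_one_minus_roots:
  fixes w :: complex
  assumes q: "q > 0" and wq: "w ^ q = 1" and prim: "\<And>k. 0 < k \<Longrightarrow> k < q \<Longrightarrow> w ^ k \<noteq> 1"
  shows "(\<Prod>k=1..<q. 1 - w ^ k) = of_nat q"
proof -
  have fac: "monom 1 q - 1 = (\<Prod>k<q. [:- (w ^ k), 1:])"
    using assms by (rule monom_minus_one_factor)
  have s: "{..<q} - {0} = {1..<q}" using q by auto
  have "monom 1 q - 1 = [:-1, 1:] * (\<Prod>k=1..<q. [:- (w ^ k), 1:])"
    unfolding fac using q s by (subst prod.remove[of _ 0]) auto
  then have "pderiv (monom 1 q - 1) = pderiv ([:-1, 1:] * (\<Prod>k=1..<q. [:- (w ^ k), 1:]))" by simp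
  then have "poly (pderiv (monom 1 q - 1)) 1 = poly (pderiv ([:-1, 1:] * (\<Prod>k=1..<q. [:- (w ^ k),
    1:]))) 1" by simp
  then show ?thesis
    by (simp only: pderiv_mult) (simp add: pderiv_pCons poly_prod pderiv_diff pderiv_monom
      poly_monom)
qed

text \<open>Here \<open>b\<close> stands for the squared modulus of \<open>a s\<close>. In the
  variables \<open>cnj (a s) * f s\<close> and \<open>f (s - 1)\<close>, multiplying the eigenvalue
  equation by \<open>cnj (a s)\<close> clears all denominators, so that only \<open>E\<close> and
  the squared moduli enter; in exchange the determinant is \<open>b\<close> instead of 1.\<close>

definition transfer :: "complex \<Rightarrow> complex \<Rightarrow> complex^2^2" where
  "transfer E b = vector [vector [E, - b], vector [1, 0]]"

fun monodromy :: "complex \<Rightarrow> (nat \<Rightarrow> complex) \<Rightarrow> nat \<Rightarrow> complex^2^2" where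
  "monodromy E b 0 = mat 1"
| "monodromy E b (Suc n) = transfer E (b n) ** monodromy E b n"

lemma monodromy_Suc_entries:
  "monodromy E b (Suc n) $ 1 $ j = E * monodromy E b n $ 1 $ j - b n * monodromy E b n $ 2 $ j"
  "monodromy E b (Suc n) $ 2 $ j = monodromy E b n $ 1 $ j"
  by (simp_all add: matrix_matrix_mult_def transfer_def sum_2)

lemma monodromy_0_entries:
  "monodromy E b 0 $ 1 $ 1 = 1" "monodromy E b 0 $ 1 $ 2 = 0"
  "monodromy E b 0 $ 2 $ 1 = 0" "monodromy E b 0 $ 2 $ 2 = 1"
  by (simp_all add: mat_def)

lemma monodromy_Suc_right: "monodromy E b (Suc n) = monodromy E (\<lambda>k. b (Suc k)) n ** transfer E (b
  0)"
proof (induction n)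
  case (Suc n)
  have "monodromy E b (Suc (Suc n)) = transfer E (b (Suc n)) ** monodromy E b (Suc n)" by simp
  then show ?case unfolding Suc by (simp add: matrix_mul_assoc)
qed simp

text \<open>By cyclicity of the trace, the factor dropped at the right end may return at the left
  end.\<close>

lemma trace_monodromy_shift:
  assumes "b n = b 0"
  shows "trace (monodromy E (\<lambda>k. b (Suc k)) n) = trace (monodromy E b n)"
proof (cases n)
  case (Suc m)
  have "trace (monodromy E b n) = trace (transfer E (b (Suc m)) ** monodromy E (\<lambda>k. b (Suc k)) m)"
    unfolding Suc monodromy_Suc_right using assms Suc by (metis trace_mul_sym)
  then show ?thesis by (simp add: Suc)
qed simp

lemma det_monodromy:
  "monodromy E b n $ 1 $ 1 * monodromy E b n $ 2 $ 2 - monodromy E b n $ 1 $ 2 * monodromy E b n $ 2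
    $ 1 = (\<Prod>k<n. b k)"
proof (induction n)
  case (Suc n)
  then show ?case unfolding monodromy_Suc_entries prod.lessThan_Suc Suc[symmetric]
    by (simp add: algebra_simps)
qed (simp add: monodromy_0_entries del: monodromy.simps)

lemma trace_monodromy: "trace (monodromy E b n) = monodromy E b n $ 1 $ 1 + monodromy E b n $ 2 $ 2"
  by (simp add: trace_def sum_2)

text \<open>Laurent polynomials in z with exponents between -d and d, encoded by clearing the
  denominator z^d.\<close>

definition laurent_bound :: "nat \<Rightarrow> (complex \<Rightarrow> complex) \<Rightarrow> bool" where
  "laurent_bound d F \<longleftrightarrow> (\<exists>P. degree P \<le> 2 * d \<and> (\<forall>z. z \<noteq> 0 \<longrightarrow> F z * z ^ d = poly P z))"

lemma laurent_bound_mono: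
  assumes "laurent_bound d F" "d \<le> e"
  shows "laurent_bound e F"
proof -
  obtain P where P: "degree P \<le> 2 * d" "\<And>z. z \<noteq> 0 \<Longrightarrow> F z * z ^ d = poly P z"
    using assms(1) unfolding laurent_bound_def by blast
  have "degree (P * monom 1 (e - d)) \<le> 2 * e"
    using degree_mult_le[of P "monom 1 (e - d)"] P(1) assms(2) by (simp add: degree_monom_eq)
  moreover have "F z * z ^ e = poly (P * monom 1 (e - d)) z" if "z \<noteq> 0" for z
  proof -
    have "z ^ e = z ^ d * z ^ (e - d)" using assms(2) by (simp flip: power_add)
    then show ?thesis using P(2)[OF that] by (simp add: poly_monom mult.assoc[symmetric])
  qed
  ultimately show ?thesis unfolding laurent_bound_def by blast
qed

lemma laurent_bound_diff:
  assumes "laurent_bound d F" "laurent_bound d G"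
  shows "laurent_bound d (\<lambda>z. F z - G z)"
proof -
  obtain P Q where "degree P \<le> 2 * d" "\<And>z. z \<noteq> 0 \<Longrightarrow> F z * z ^ d = poly P z"
    "degree Q \<le> 2 * d" "\<And>z. z \<noteq> 0 \<Longrightarrow> G z * z ^ d = poly Q z"
    using assms unfolding laurent_bound_def by blast
  then show ?thesis unfolding laurent_bound_def
    by (intro exI[of _ "P - Q"]) (auto simp: degree_diff_le left_diff_distrib)
qed

lemma laurent_bound_add:
  assumes "laurent_bound d F" "laurent_bound d G"
  shows "laurent_bound d (\<lambda>z. F z + G z)"
proof -
  obtain P Q where "degree P \<le> 2 * d" "\<And>z. z \<noteq> 0 \<Longrightarrow> F z * z ^ d = poly P z"
    "degree Q \<le> 2 * d" "\<And>z. z \<noteq> 0 \<Longrightarrow> G z * z ^ d = poly Q z"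
    using assms unfolding laurent_bound_def by blast
  then show ?thesis unfolding laurent_bound_def
    by (intro exI[of _ "P + Q"]) (auto simp: degree_add_le distrib_right)
qed

lemma laurent_bound_mult:
  assumes "laurent_bound d F" "laurent_bound e G"
  shows "laurent_bound (d + e) (\<lambda>z. F z * G z)"
proof -
  obtain P Q where *: "degree P \<le> 2 * d" "\<And>z. z \<noteq> 0 \<Longrightarrow> F z * z ^ d = poly P z"
    "degree Q \<le> 2 * e" "\<And>z. z \<noteq> 0 \<Longrightarrow> G z * z ^ e = poly Q z"
    using assms unfolding laurent_bound_def by blast
  have "degree (P * Q) \<le> 2 * (d + e)" using degree_mult_le[of P Q] * by simp
  moreover have "F z * G z * z ^ (d + e) = poly (P * Q) z" if "z \<noteq> 0" for z
    unfolding poly_mult *(2)[OF that, symmetric] *(4)[OF that, symmetric] by (simp add: power_add)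
  ultimately show ?thesis unfolding laurent_bound_def by blast
qed

lemma laurent_bound_const: "laurent_bound 0 (\<lambda>z. c)"
  unfolding laurent_bound_def by (intro exI[of _ "[:c:]"]) auto

text \<open>The lower row is the upper row one step earlier, so each factor \<open>b z k\<close>
  uses up two steps of the recursion and the degree is n div 2. The naive degree n would admit the
  exponents n and -n, which the invariance under an n-th root of unity cannot exclude.\<close>

lemma laurent_bound_trace_monodromy:
  assumes b: "\<And>k. laurent_bound 1 (\<lambda>z. b z k)" and n: "n > 0"
  shows "laurent_bound (n div 2) (\<lambda>z. trace (monodromy E (b z) n))"
proof -
  have c: "laurent_bound d (\<lambda>z. c)" for d c
    using laurent_bound_mono[OF laurent_bound_const] by simp
  have m: "laurent_bound d (\<lambda>z. E * F z)" if "laurent_bound d F" for d F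
    using laurent_bound_mult[OF laurent_bound_const that] by simp
  have col1: "laurent_bound (Suc n div 2) (\<lambda>z. monodromy E (b z) (Suc n) $ 1 $ 1) \<and>
      laurent_bound (n div 2) (\<lambda>z. monodromy E (b z) (Suc n) $ 2 $ 1)" for n
  proof (induction n)
    case 0
    show ?case unfolding monodromy_Suc_entries monodromy_0_entries by (simp add: c)
  next
    case (Suc n)
    show ?case unfolding monodromy_Suc_entries(1)[of _ _ "Suc n"] monodromy_Suc_entries(2)[of _ _
      "Suc n"]
    proof (intro conjI laurent_bound_diff m)
      show "laurent_bound (Suc (Suc n) div 2) (\<lambda>z. monodromy E (b z) (Suc n) $ 1 $ 1)"
        using Suc by (rule laurent_bound_mono[OF conjunct1]) simp
      show "laurent_bound (Suc (Suc n) div 2) (\<lambda>z. b z (Suc n) * monodromy E (b z) (Suc n) $ 2 $ 1)"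
        using laurent_bound_mult[OF b[of "Suc n"] conjunct2[OF Suc]] by simp
      show "laurent_bound (Suc n div 2) (\<lambda>z. monodromy E (b z) (Suc n) $ 1 $ 1)"
        using Suc by simp
    qed
  qed
  \<comment> \<open>The second column starts from the lower unit vector and meets a factor
    \<open>b\<close> in its first step; its bounds at index n are those of the first column at index
    n + 1.\<close>
  have col2: "laurent_bound (Suc n div 2) (\<lambda>z. monodromy E (b z) n $ 1 $ 2) \<and>
      laurent_bound (n div 2) (\<lambda>z. monodromy E (b z) n $ 2 $ 2)" for n
  proof (induction n)
    case 0
    show ?case unfolding monodromy_0_entries by (simp add: c)
  next
    case (Suc n)
    show ?case unfolding monodromy_Suc_entries(1)[of _ _ n] monodromy_Suc_entries(2)[of _ _ n]
    proof (intro conjI laurent_bound_diff m)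
      show "laurent_bound (Suc (Suc n) div 2) (\<lambda>z. monodromy E (b z) n $ 1 $ 2)"
        using Suc by (rule laurent_bound_mono[OF conjunct1]) simp
      show "laurent_bound (Suc (Suc n) div 2) (\<lambda>z. b z n * monodromy E (b z) n $ 2 $ 2)"
        using laurent_bound_mult[OF b[of n] conjunct2[OF Suc]] by simp
      show "laurent_bound (Suc n div 2) (\<lambda>z. monodromy E (b z) n $ 1 $ 2)"
        using Suc by simp
    qed
  qed
  obtain k where k: "n = Suc k" using n by (cases n) auto
  show ?thesis unfolding trace_monodromy
    using col1[of k] col2[of n] k by (intro laurent_bound_add) auto
qed

text \<open>Invariance under multiplication by \<open>w\<close> removes every exponent j with w^j
  \<noteq> 1. All nonzero exponents have modulus at most \<open>d < q\<close>, so only the constant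
  term survives.\<close>

lemma laurent_invariant_const:
  assumes F: "laurent_bound d F" and dq: "d < q" and w0: "w \<noteq> 0"
    and prim: "\<And>k. 0 < k \<Longrightarrow> k < q \<Longrightarrow> w ^ k \<noteq> 1"
    and inv: "\<And>z. z \<noteq> 0 \<Longrightarrow> F (w * z) = F z"
    and "x \<noteq> 0" "y \<noteq> 0"
  shows "F x = F y"
proof -
  obtain P where P: "degree P \<le> 2 * d" "\<And>z. z \<noteq> 0 \<Longrightarrow> F z * z ^ d = poly P z"
    using F unfolding laurent_bound_def by blast
  have "poly (pcompose P [:0, w:] - smult (w ^ d) P) z = 0" if "z \<noteq> 0" for z
  proof -
    have "poly P (w * z) = F z * (w * z) ^ d" using P(2)[of "w * z"] inv[OF that] w0 that by simp
    also have "\<dots> = w ^ d * poly P z" unfolding P(2)[OF that, symmetric]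
      by (simp add: power_mult_distrib)
    finally show ?thesis by (simp add: poly_pcompose mult.commute)
  qed
  then have "UNIV - {0} \<subseteq> {z. poly (pcompose P [:0, w:] - smult (w ^ d) P) z = 0}" by auto
  moreover have "infinite (UNIV - {0 :: complex})" by (simp add: infinite_UNIV_char_0)
  ultimately have "pcompose P [:0, w:] - smult (w ^ d) P = 0"
    using poly_roots_finite finite_subset by blast
  then have eq: "pcompose P [:0, w:] = smult (w ^ d) P" by simp
  have c0: "coeff P k = 0" if "k \<noteq> d" for k
  proof (rule ccontr)
    assume nz: "coeff P k \<noteq> 0"
    then have kd: "k \<le> 2 * d" using P(1) le_degree order_trans by blast
    have "w ^ k * coeff P k = w ^ d * coeff P k"
      using arg_cong[OF eq, of "\<lambda>Q. coeff Q k"] by (simp add: coeff_pcompose_linear)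
    then have wkd: "w ^ k = w ^ d" using nz by simp
    show False
    proof (cases "k < d")
      case True
      then have "w ^ k * w ^ (d - k) = w ^ k" unfolding power_add[symmetric] using wkd by simp
      then show False using w0 prim[of "d - k"] True dq by simp
    next
      case False
      then have "w ^ d * w ^ (k - d) = w ^ d" unfolding power_add[symmetric] using wkd by simp
      then show False using w0 prim[of "k - d"] False dq kd that by simp
    qed
  qed
  have "P = monom (coeff P d) d" by (rule poly_eqI) (auto simp: c0)
  then have "F z = coeff P d" if "z \<noteq> 0" for z
    using P(2)[OF that] that by (metis mult_right_cancel poly_monom power_not_zero)
  then show ?thesis using assms by simp
qed

lemma monodromy_eq_jacobi_poly:
  "monodromy E (\<lambda>k. of_real (b k)) n $ 1 $ 1 = poly (jacobi_poly b n) E"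
proof (induction b n rule: jacobi_poly.induct)
  case (3 b n)
  then show ?case unfolding monodromy_Suc_entries
    by (simp del: monodromy.simps add: monodromy_Suc_entries)
qed (simp_all add: monodromy_Suc_entries monodromy_0_entries del: monodromy.simps)

text \<open>With \<open>b 0 = 0\<close> the first transfer matrix annihilates the lower unit vector:
  the periodic chain is cut open, and only the upper left entry of the monodromy matrix is left in
  the trace.\<close>

lemma trace_monodromy_zero_phase:
  assumes "b 0 = 0" "n > 0"
  shows "trace (monodromy E (\<lambda>k. of_real (b k)) n) = poly (jacobi_poly b n) E"
proof -
  have z: "monodromy E (\<lambda>k. of_real (b k)) n $ 1 $ 2 = 0 \<and>
      (n = 0 \<or> monodromy E (\<lambda>k. of_real (b k)) n $ 2 $ 2 = 0)" for n
    by (induction n) (auto simp: monodromy_Suc_entries monodromy_0_entries assms simp del: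
      monodromy.simps)
  from z[of n] show ?thesis using assms by (simp add: trace_monodromy monodromy_eq_jacobi_poly)
qed

text \<open>The trace of the monodromy matrix is a Laurent polynomial in the phase \<open>z\<close> of degree at
  most \<open>q div 2\<close>, while shifting the sites shows that it depends only on \<open>z ^ q\<close>.\<close>

lemma trace_monodromy_phase_independent:
  fixes w z :: complex
  assumes q: "q > 0" and w: "cmod w = 1" "w ^ q = 1" and prim: "\<And>k. 0 < k \<Longrightarrow> k < q \<Longrightarrow> w ^ k \<noteq> 1"
    and z: "cmod z = 1"
  shows "trace (monodromy E (\<lambda>k. of_real ((cmod (1 + w ^ k * z))\<^sup>2)) q)
       = poly (jacobi_poly (\<lambda>k. (cmod (1 - w ^ k))\<^sup>2) q) E"
proof -
  have w0: "w \<noteq> 0" using w by auto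
  \<comment> \<open>On the unit circle this equals the squared modulus of
    \<open>1 + w ^ k * z\<close>; in this form it extends to a Laurent polynomial in
    \<open>z\<close>.\<close>
  define b where "b z k = 2 + w ^ k * z + 1 / (w ^ k * z)" for z k
  have bc: "of_real ((cmod (1 + w ^ k * z))\<^sup>2) = b z k" if z: "cmod z = 1" for z k
  proof -
    have "cmod (w ^ k * z) = 1" using w z by (simp add: norm_mult norm_power)
    then have "cnj (w ^ k * z) = 1 / (w ^ k * z)"
      by (metis complex_norm_square mult_1 nonzero_eq_divide_eq mult.commute norm_zero of_real_1
        one_power2 zero_neq_one)
    then show ?thesis unfolding complex_norm_square b_def using w0 z
      by (cases "z = 0") (auto simp: field_simps)
  qed
  have lb: "laurent_bound 1 (\<lambda>z. b z k)" for k
    unfolding laurent_bound_def b_def using w0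
    by (intro exI[of _ "[:1 / w ^ k, 2, w ^ k:]"]) (auto simp: field_simps)
  have inv: "trace (monodromy E (b (w * z)) q) = trace (monodromy E (b z) q)" for z
  proof -
    have "b (w * z) = (\<lambda>k. b z (Suc k))" by (auto simp: b_def mult_ac)
    moreover have "b z q = b z 0" using w by (simp add: b_def)
    ultimately show ?thesis using trace_monodromy_shift[of "b z" q E] by simp
  qed
  \<comment> \<open>The phase -1 is the one at which the entry with index 0 vanishes.\<close>
  have "trace (monodromy E (b z) q) = trace (monodromy E (b (- 1)) q)"
    by (rule laurent_invariant_const[OF laurent_bound_trace_monodromy[of b, OF lb q], where q = q
      and w = w])
       (use q w0 prim inv z in auto)
  then show ?thesis
    using trace_monodromy_zero_phase[of "\<lambda>k. (cmod (1 - w ^ k))\<^sup>2" q E] q bc[of z] bc[of "-1"] z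
      by simp
qed

text \<open>A periodic solution is an eigenvector of the monodromy matrix with eigenvalue
  \<open>l\<close>, the conjugated product of the hopping terms over a period. The determinant is
  \<open>l * cnj l\<close>, hence the trace is \<open>l + cnj l\<close>, and |l| = |1 - (-z)^q|
  \<le> 2.\<close>

lemma periodic_eigenvalue_bound:
  fixes w z :: complex and f :: "int \<Rightarrow> complex" and E :: real
  assumes q: "q > 0" and w: "cmod w = 1" "w ^ q = 1" and prim: "\<And>k. 0 < k \<Longrightarrow> k < q \<Longrightarrow> w ^ k \<noteq> 1"
    and z: "cmod z = 1" and a: "\<And>k::nat. a (int k) = 1 + w ^ k * z"
    and a0: "\<And>s. a s \<noteq> 0"
    and fper: "\<And>s. f (s + int q) = f s" and f0: "f \<noteq> (\<lambda>s. 0)"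
    and eig: "\<And>s. chiral a f s = of_real E * f s"
  shows "cmod (poly (jacobi_poly (\<lambda>k. (cmod (1 - w ^ k))\<^sup>2) q) (of_real E)) \<le> 4"
proof -
  define M where "M = monodromy (of_real E) (\<lambda>k. of_real ((cmod (1 + w ^ k * z))\<^sup>2))"
  define x where "x s = cnj (a (int s)) * f (int s)" for s
  define y where "y s = f (int s - 1)" for s
  have sx: "x (Suc s) = of_real E * f (int s) - a (int s) * f (int s - 1)" for s
    using eig[of "int s"] unfolding x_def chiral_def by (simp add: algebra_simps)
  have step: "M n $ 1 $ 1 * x 0 + M n $ 1 $ 2 * y 0 = (\<Prod>k<n. cnj (a (int k))) * x n \<and>
      M n $ 2 $ 1 * x 0 + M n $ 2 $ 2 * y 0 = (\<Prod>k<n. cnj (a (int k))) * y n" for n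
  proof (induction n)
    case 0
    show ?case by (simp add: M_def monodromy_0_entries del: monodromy.simps)
  next
    case (Suc n)
    have b: "of_real ((cmod (1 + w ^ n * z))\<^sup>2) = a (int n) * cnj (a (int n))"
      by (simp only: a complex_norm_square)
    have "M (Suc n) $ 1 $ 1 * x 0 + M (Suc n) $ 1 $ 2 * y 0 =
        of_real E * (M n $ 1 $ 1 * x 0 + M n $ 1 $ 2 * y 0) - a (int n) * cnj (a (int n)) * (M n $ 2
          $ 1 * x 0 + M n $ 2 $ 2 * y 0)"
      unfolding M_def monodromy_Suc_entries b by (simp add: algebra_simps)
    also have "\<dots> = (\<Prod>k<n. cnj (a (int k))) * cnj (a (int n)) * (of_real E * f (int n) - a (int n) *
      f (int n - 1))"
      using Suc by (simp add: x_def y_def algebra_simps)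
    finally have 1: "M (Suc n) $ 1 $ 1 * x 0 + M (Suc n) $ 1 $ 2 * y 0
      = (\<Prod>k<Suc n. cnj (a (int k))) * x (Suc n)"
      by (simp add: sx)
    have "M (Suc n) $ 2 $ 1 * x 0 + M (Suc n) $ 2 $ 2 * y 0 = (\<Prod>k<n. cnj (a (int k))) * x n"
      using Suc unfolding M_def monodromy_Suc_entries by simp
    also have "\<dots> = (\<Prod>k<Suc n. cnj (a (int k))) * y (Suc n)"
      by (simp add: x_def y_def)
    finally show ?case using 1 by simp
  qed
  have perx: "x q = x 0" "y q = y 0"
    using fper[of 0] fper[of "-1"] a[of q] a[of 0] w by (simp_all add: x_def y_def)
  define l where "l = (\<Prod>k<q. cnj (a (int k)))"
  have ev: "M q $ 1 $ 1 * x 0 + M q $ 1 $ 2 * y 0 = l * x 0" "M q $ 2 $ 1 * x 0 + M q $ 2 $ 2 * y 0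
    = l * y 0"
    using step[of q] unfolding perx l_def by auto
  have nz: "x 0 \<noteq> 0 \<or> y 0 \<noteq> 0"
  proof (rule ccontr)
    assume "\<not> (x 0 \<noteq> 0 \<or> y 0 \<noteq> 0)"
    then have "(\<Prod>k<n. cnj (a (int k))) * y n = 0" for n using step[of n] by simp
    then have "y n = 0" for n using a0 by (metis (no_types, lifting) complex_cnj_zero_iff
      finite_lessThan mult_eq_0_iff prod_zero_iff)
    then have fn: "f (int n) = 0" for n using y_def[of "Suc n"] by simp
    have "f s = 0" for s
    proof -
      have "f (s mod int q) = 0" using fn[of "nat (s mod int q)"] q by simp
      then show ?thesis using periodic_mod[of f q s] fper by simp
    qed
    with f0 show False by auto
  qed
  have det: "M q $ 1 $ 1 * M q $ 2 $ 2 - M q $ 1 $ 2 * M q $ 2 $ 1 = l * cnj l"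
    unfolding M_def det_monodromy l_def cnj_prod prod.distrib[symmetric]
    by (intro prod.cong refl) (simp only: a complex_norm_square complex_cnj_cnj mult.commute)
  have "(l - M q $ 1 $ 1) * (l - M q $ 2 $ 2) = M q $ 1 $ 2 * M q $ 2 $ 1"
  proof -
    have e1: "(l - M q $ 1 $ 1) * x 0 = M q $ 1 $ 2 * y 0" and e2: "(l - M q $ 2 $ 2) * y 0
      = M q $ 2 $ 1 * x 0"
      using ev by (simp_all add: algebra_simps)
    show ?thesis
    proof (cases "x 0 = 0")
      case True
      then have "y 0 \<noteq> 0" using nz by simp
      then have "M q $ 1 $ 2 = 0" "l - M q $ 2 $ 2 = 0" using e1 e2 True by auto
      then show ?thesis by simp
    next
      case False
      have "(l - M q $ 1 $ 1) * (l - M q $ 2 $ 2) * x 0 = (l - M q $ 2 $ 2) * ((l - M q $ 1 $ 1) * x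
        0)"
        by simp
      also have "\<dots> = M q $ 1 $ 2 * ((l - M q $ 2 $ 2) * y 0)" unfolding e1 by simp
      also have "\<dots> = M q $ 1 $ 2 * M q $ 2 $ 1 * x 0" unfolding e2 by simp
      finally show ?thesis using False by simp
    qed
  qed
  moreover have "trace (M q) = M q $ 1 $ 1 + M q $ 2 $ 2" unfolding M_def by (rule trace_monodromy)
  ultimately have "l * (l + cnj l) = l * trace (M q)"
    using det by algebra
  \<comment> \<open>Cancelling \<open>l\<close> is possible because no hopping term vanishes; this
    is why the phase will be perturbed.\<close>
  moreover have "l \<noteq> 0" unfolding l_def using a0 by simp
  ultimately have tr: "trace (M q) = l + cnj l" by simp
  have "cmod l = cmod (\<Prod>k<q. 1 + w ^ k * z)"
    unfolding l_def prod_norm[symmetric] by (intro prod.cong refl) (simp only: a complex_mod_cnj)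
  also have "(\<Prod>k<q. 1 + w ^ k * z) = 1 - (- z) ^ q"
    using q w(2) prim by (rule prod_one_plus_roots)
  also have "cmod \<dots> \<le> 2"
    using norm_triangle_ineq4[of 1 "(- z) ^ q"] z unfolding norm_power norm_minus_cancel by simp
  finally have "cmod (trace (M q)) \<le> 4"
    unfolding tr using norm_triangle_ineq[of l "cnj l"] by simp
  moreover have "trace (M q) = poly (jacobi_poly (\<lambda>k. (cmod (1 - w ^ k))\<^sup>2) q) (of_real E)"
    unfolding M_def using q w(1) w(2) prim z by (rule trace_monodromy_phase_independent)
  ultimately show ?thesis by (simp only:)
qed

section \<open>Small hopping terms\<close>

lemma cmod_cis_minus_one_le: "cmod (cis t - 1) \<le> \<bar>t\<bar>"
proof -
  have "cmod (cis t - 1) = 2 * \<bar>sin (t / 2)\<bar>"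
    using dist_exp_i_1[of t] by (simp add: cis_conv_exp)
  then show ?thesis using abs_sin_x_le_abs_x[of "t / 2"] by simp
qed

definition hop :: "real \<Rightarrow> real \<Rightarrow> int \<Rightarrow> complex" where
  "hop \<alpha> y s = 1 + cis (- 2 * pi * (y + \<alpha> * of_int s))"

text \<open>Hopping terms vanish at phases 1/2 modulo 1, and they depend on the phase with Lipschitz
  constant 2 pi.\<close>

lemma cmod_hop_le: "cmod (hop \<alpha> y s) \<le> 2 * pi * \<bar>y + \<alpha> * of_int s - 1 / 2 - of_int j\<bar>"
proof -
  define x where "x = y + \<alpha> * of_int s"
  have "cis (- 2 * pi * x) = cis (- 2 * pi * (x - 1 / 2 - of_int j)) * cis (- pi) * cis (2 * pi *
    of_int (- j))"
    unfolding cis_mult by (simp add: algebra_simps)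
  also have "cis (2 * pi * of_int (- j)) = 1" by (rule cis_multiple_2pi) auto
  also have "cis (- pi) = - 1" by (simp add: complex_eq_iff)
  finally have "hop \<alpha> y s = - (cis (- 2 * pi * (x - 1 / 2 - of_int j)) - 1)"
    unfolding hop_def x_def by simp
  then have "cmod (hop \<alpha> y s) \<le> \<bar>- 2 * pi * (x - 1 / 2 - of_int j)\<bar>"
    using cmod_cis_minus_one_le by (metis norm_minus_cancel)
  then show ?thesis by (simp add: abs_mult x_def)
qed

lemma cmod_hop_diff_le: "cmod (hop \<alpha> y s - hop \<beta> x s) \<le> 2 * pi * \<bar>(y + \<alpha> * of_int s) - (x
  + \<beta> * of_int s)\<bar>"
proof -
  define A where "A = - 2 * pi * (y + \<alpha> * of_int s)"
  define B where "B = - 2 * pi * (x + \<beta> * of_int s)"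
  have "hop \<alpha> y s - hop \<beta> x s = cis B * (cis (A - B) - 1)"
    unfolding hop_def A_def[symmetric] B_def[symmetric] right_diff_distrib cis_mult by simp
  then have "cmod (hop \<alpha> y s - hop \<beta> x s) \<le> \<bar>A - B\<bar>"
    using cmod_cis_minus_one_le[of "A - B"] by (simp add: norm_mult)
  also have "A - B = - (2 * pi * ((y + \<alpha> * of_int s) - (x + \<beta> * of_int s)))"
    by (simp add: A_def B_def algebra_simps)
  finally show ?thesis by (simp add: abs_mult)
qed

text \<open>The phases over \<open>n\<close> consecutive sites are nearly equidistributed, so the hopping terms come
  as close to \<open>0\<close> as \<open>(i + 2) / n\<close> for \<open>i < n\<close>; this produces the logarithm.\<close>

lemma inverse_hop_sum_ge:
  fixes \<alpha> y :: real and p t :: int and n :: nat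
  assumes n: "n > 0" and cop: "coprime p (int n)" and app: "\<bar>\<alpha> - of_int p / of_nat n\<bar>
    \<le> 1 / (of_nat n)\<^sup>2"
  shows "(\<Sum>r\<in>{1..int n}. 1 / (cmod (hop \<alpha> y (t + r)) + 1 / of_nat n))
    \<ge> of_nat n / 9 * (\<Sum>i<n. 1 / (of_nat i + 2))"
proof -
  define Y where "Y = y + \<alpha> * of_int t"
  \<comment> \<open>Phases are measured from the zero 1/2 in units of 1/n. Modulo 1, site
    \<open>t + r\<close> lies about \<open>i r\<close> units beyond it, and coprimality makes
    \<open>i\<close> a bijection onto the residues modulo n.\<close>
  define m where "m = \<lfloor>of_nat n * (Y - 1 / 2)\<rfloor>"
  define i where "i r = (m + p * r) mod int n" for r
  have ir: "0 \<le> i r" "i r < int n" for r using n by (auto simp: i_def)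
  have inj: "inj_on i {1..int n}"
  proof (rule inj_onI)
    fix r r' assume r: "r \<in> {1..int n}" "r' \<in> {1..int n}" "i r = i r'"
    then have "int n dvd (m + p * r) - (m + p * r')" unfolding i_def by (simp add: mod_eq_dvd_iff)
    then have "int n dvd p * (r - r')" by (simp add: algebra_simps)
    then have "int n dvd r - r'" using cop by (simp add: coprime_commute coprime_dvd_mult_right_iff)
    moreover have "\<bar>r - r'\<bar> < int n" using r(1,2) by auto
    ultimately have "r - r' = 0" using dvd_imp_le_int[of "r - r'" "int n"] by fastforce
    then show "r = r'" by simp
  qed
  have img: "i ` {1..int n} = {0..<int n}"
  proof (rule card_seteq)
    show "card {0..<int n} \<le> card (i ` {1..int n})" using card_image[OF inj] by simp
  qed (use ir in auto)
  have summand: "of_nat n / 9 * (1 / (of_int (i r) + 2)) \<le> 1 / (cmod (hop \<alpha> y (t + r))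
    + 1 / of_nat n)" if r: "r \<in> {1..int n}" for r
  proof -
    define err where "err = (\<alpha> - of_int p / of_nat n) * of_int r"
    have err: "\<bar>err\<bar> \<le> 1 / of_nat n"
    proof -
      have "\<bar>err\<bar> \<le> 1 / (of_nat n)\<^sup>2 * of_nat n"
        unfolding err_def abs_mult using r app by (intro mult_mono) auto
      then show ?thesis using n by (simp add: power2_eq_square)
    qed
    define j where "j = (m + p * r) div int n"
    have mp: "m + p * r = int n * j + i r" unfolding j_def i_def by simp
    then have mp': "of_int m + of_int p * of_int r = of_nat n * of_int j + (of_int (i r) :: real)"
      by (metis of_int_add of_int_mult of_int_of_nat_eq)
    define fr where "fr = of_nat n * (Y - 1 / 2) - of_int m"
    have fr: "0 \<le> fr" "fr \<le> 1" unfolding fr_def m_def by linarith+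
    have "y + \<alpha> * of_int (t + r) - 1 / 2 - of_int j = (Y - 1 / 2) + of_int p * of_int r / of_nat n
      + err - of_int j"
      by (simp add: Y_def err_def algebra_simps)
    also have "\<dots> = (fr + of_int (i r)) / of_nat n + err"
      using n mp' by (simp add: fr_def field_simps)
    finally have "\<bar>y + \<alpha> * of_int (t + r) - 1 / 2 - of_int j\<bar> = \<bar>(fr + of_int (i r)) / of_nat n
      + err\<bar>" by simp
    also have "\<dots> \<le> (fr + of_int (i r)) / of_nat n + \<bar>err\<bar>" using fr ir[of r] by (simp add: abs_if)
    \<comment> \<open>One unit is lost by rounding in \<open>m\<close>, a second one by replacing
      \<alpha> with p/n over at most n sites.\<close>
    also have "\<dots> \<le> (1 + of_int (i r)) / of_nat n + 1 / of_nat n" using fr err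
      by (intro add_mono divide_right_mono) auto
    also have "\<dots> = (of_int (i r) + 2) / of_nat n" using n by (simp add: field_simps)
    finally have d: "\<bar>y + \<alpha> * of_int (t + r) - 1 / 2 - of_int j\<bar> \<le> (of_int (i r) + 2) / of_nat n" .
    have ge2: "of_int (i r) + 2 \<ge> (2::real)" using ir by simp
    have "cmod (hop \<alpha> y (t + r)) \<le> 2 * pi * \<bar>y + \<alpha> * of_int (t + r) - 1 / 2 - of_int j\<bar>"
      by (rule cmod_hop_le)
    \<comment> \<open>Here 8 bounds 2 pi; the summand 1/n below is at most (i r + 2)/n and raises
      the constant to 9.\<close>
    also have "\<dots> \<le> 8 * ((of_int (i r) + 2) / of_nat n)" using d pi_less_4 ge2
      by (intro mult_mono) auto
    finally have "cmod (hop \<alpha> y (t + r)) + 1 / of_nat n \<le> 9 * (of_int (i r) + 2) / of_nat n"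
    proof -
      assume "cmod (hop \<alpha> y (t + r)) \<le> 8 * ((of_int (i r) + 2) / of_nat n)"
      moreover have "1 / of_nat n \<le> (of_int (i r) + 2) / real n" using ge2
        by (intro divide_right_mono) auto
      ultimately show ?thesis by (simp add: add_divide_distrib)
    qed
    moreover have "cmod (hop \<alpha> y (t + r)) + 1 / of_nat n > 0" using n by (simp add: add_nonneg_pos)
    ultimately have "1 / (9 * (of_int (i r) + 2) / of_nat n) \<le> 1 / (cmod (hop \<alpha> y (t + r))
      + 1 / of_nat n)"
      by (intro divide_left_mono mult_pos_pos) (use ge2 n in auto)
    then show ?thesis using n ge2 by (simp add: field_simps)
  qed
  have "(\<Sum>r\<in>{1..int n}. 1 / (of_int (i r) + 2)) = (\<Sum>k\<in>{0..<int n}. 1 / (of_int k + 2) :: real)"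
    unfolding img[symmetric] using inj by (simp add: sum.reindex)
  also have "\<dots> = (\<Sum>k<n. 1 / (of_nat k + 2))"
    by (rule sum.reindex_bij_witness[of _ int nat]) auto
  finally have "of_nat n / 9 * (\<Sum>k<n. 1 / (of_nat k + 2))
    = (\<Sum>r\<in>{1..int n}. of_nat n / 9 * (1 / (of_int (i r) + 2) :: real))"
    unfolding sum_distrib_left[symmetric] by simp
  also have "\<dots> \<le> (\<Sum>r\<in>{1..int n}. 1 / (cmod (hop \<alpha> y (t + r)) + 1 / of_nat n))"
    by (intro sum_mono summand)
  finally show ?thesis .
qed

section \<open>Localization of approximate eigenvectors\<close>

definition hat :: "real \<Rightarrow> real" where
  "hat x = max 0 (1 - \<bar>x\<bar>)"

lemma hat_bounds: "0 \<le> hat x" "hat x \<le> 1"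
  by (auto simp: hat_def)

lemma hat_lipschitz: "\<bar>hat x - hat y\<bar> \<le> \<bar>x - y\<bar>"
  by (auto simp: hat_def)

lemma hat_int_translate_nonzero: "hat (x - of_int j) \<noteq> 0 \<Longrightarrow> j = \<lfloor>x\<rfloor> \<or> j = \<lfloor>x\<rfloor> + 1"
proof -
  assume "hat (x - of_int j) \<noteq> 0"
  then have "\<bar>x - of_int j\<bar> < 1" by (auto simp: hat_def)
  then show ?thesis by linarith
qed

lemma sum_hat_squared_le: "finite J \<Longrightarrow> (\<Sum>j\<in>J. (hat (x - of_int j))\<^sup>2) \<le> 2"
proof -
  assume J: "finite J"
  have "(\<Sum>j\<in>J. (hat (x - of_int j))\<^sup>2) = (\<Sum>j\<in>J \<inter> {\<lfloor>x\<rfloor>, \<lfloor>x\<rfloor> + 1}. (hat (x - of_int j))\<^sup>2)"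
    using J hat_int_translate_nonzero by (intro sum.mono_neutral_right) fastforce+
  also have "\<dots> \<le> (\<Sum>j\<in>J \<inter> {\<lfloor>x\<rfloor>, \<lfloor>x\<rfloor> + 1}. 1)"
    by (intro sum_mono) (simp add: hat_bounds power_le_one)
  also have "\<dots> \<le> (\<Sum>j\<in>{\<lfloor>x\<rfloor>, \<lfloor>x\<rfloor> + 1}. 1)"
    by (intro sum_mono2) auto
  also have "\<dots> = 2" by simp
  finally show ?thesis .
qed

lemma sum_hat_squared_ge:
  assumes J: "finite J" "{\<lfloor>x\<rfloor>, \<lfloor>x\<rfloor> + 1} \<subseteq> J"
  shows "1 / 2 \<le> (\<Sum>j\<in>J. (hat (x - of_int j))\<^sup>2)"
proof -
  define t where "t = x - of_int \<lfloor>x\<rfloor>"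
  have t: "0 \<le> t" "t \<le> 1" unfolding t_def by linarith+
  have "1 / 2 \<le> (1 - t)\<^sup>2 + t\<^sup>2"
    using zero_le_power2[of "2 * t - 1"] by (simp add: power2_eq_square algebra_simps)
  also have "\<dots> = (\<Sum>j\<in>{\<lfloor>x\<rfloor>, \<lfloor>x\<rfloor> + 1}. (hat (x - of_int j))\<^sup>2)"
    using t by (simp add: hat_def t_def[symmetric] diff_diff_eq[symmetric])
  also have "\<dots> \<le> (\<Sum>j\<in>J. (hat (x - of_int j))\<^sup>2)" using J by (intro sum_mono2) auto
  finally show ?thesis .
qed

text \<open>At most two translates are nonzero at each of the two points, so at most four
  differences contribute.\<close>

lemma sum_hat_diff_squared_le:
  assumes J: "finite J"
  shows "(\<Sum>j\<in>J. (hat (x - of_int j) - hat (y - of_int j))\<^sup>2) \<le> 4 * (x - y)\<^sup>2"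
proof -
  let ?S = "{\<lfloor>x\<rfloor>, \<lfloor>x\<rfloor> + 1, \<lfloor>y\<rfloor>, \<lfloor>y\<rfloor> + 1}"
  have "(\<Sum>j\<in>J. (hat (x - of_int j) - hat (y - of_int j))\<^sup>2) =
      (\<Sum>j\<in>J \<inter> ?S. (hat (x - of_int j) - hat (y - of_int j))\<^sup>2)"
    using J hat_int_translate_nonzero[of x] hat_int_translate_nonzero[of y]
    by (intro sum.mono_neutral_right) (auto, metis diff_self)
  also have "\<dots> \<le> (\<Sum>j\<in>J \<inter> ?S. (x - y)\<^sup>2)"
  proof (intro sum_mono)
    fix j
    have "\<bar>hat (x - of_int j) - hat (y - of_int j)\<bar> \<le> \<bar>x - y\<bar>"
      using hat_lipschitz[of "x - of_int j" "y - of_int j"] by simp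
    then show "(hat (x - of_int j) - hat (y - of_int j))\<^sup>2 \<le> (x - y)\<^sup>2"
      by (simp only: abs_le_square_iff)
  qed
  also have "\<dots> \<le> 4 * (x - y)\<^sup>2"
  proof -
    have "card (J \<inter> ?S) \<le> card ?S" by (intro card_mono) auto
    also have "\<dots> \<le> 4"
      using card_length[of "[\<lfloor>x\<rfloor>, \<lfloor>x\<rfloor> + 1, \<lfloor>y\<rfloor>, \<lfloor>y\<rfloor> + 1]"] by simp
    finally have "real (card (J \<inter> ?S)) \<le> 4" by simp
    then show ?thesis by (simp add: mult_right_mono)
  qed
  finally show ?thesis .
qed

lemma cmod_add3_squared_le: "(cmod (x + y + z))\<^sup>2 \<le> 2 * (cmod x)\<^sup>2 + 4 * (cmod y)\<^sup>2
  + 4 * (cmod z)\<^sup>2"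
proof -
  have "cmod (x + y + z) \<le> cmod x + cmod y + cmod z"
    by (meson norm_triangle_ineq norm_triangle_mono order_refl)
  then have "(cmod (x + y + z))\<^sup>2 \<le> (cmod x + cmod y + cmod z)\<^sup>2" by (intro power_mono) auto
  also have "\<dots> \<le> 2 * (cmod x)\<^sup>2 + 4 * (cmod y)\<^sup>2 + 4 * (cmod z)\<^sup>2"
    using zero_le_power2[of "cmod x - cmod y - cmod z"] zero_le_power2[of "cmod y - cmod z"]
    by (simp add: power2_eq_square algebra_simps)
  finally show ?thesis .
qed

text \<open>The cutoffs vary in the variable \<open>W\<close>, whose increments are large exactly where the hopping
  terms are small; this is where the commutator error gains a logarithm over ordinary cutoffs.\<close>

lemma localize_approximate_eigenvector:
  fixes a f :: "int \<Rightarrow> complex" and W :: "int \<Rightarrow> real" and E \<epsilon> h :: real and M :: int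
  assumes supp: "\<And>s. \<bar>s\<bar> \<ge> M \<Longrightarrow> f s = 0" and f0: "f \<noteq> (\<lambda>s. 0)" and \<epsilon>: "\<epsilon> > 0" and h: "h > 0"
    and W: "\<And>s. cmod (a s) * \<bar>W s - W (s - 1)\<bar> \<le> 1"
    and le: "(\<Sum>s\<in>{-M..M}. (cmod (chiral a f s - of_real E * f s))\<^sup>2)
      \<le> \<epsilon> * (\<Sum>s\<in>{-M..M}. (cmod (f s))\<^sup>2)"
  obtains j :: int where
    "(\<Sum>s\<in>{-M..M}. (cmod (chiral a (\<lambda>s. of_real (hat (W s / h - of_int j)) * f s) s
        - of_real E * (of_real (hat (W s / h - of_int j)) * f s)))\<^sup>2)
      < (16 * \<epsilon> + 64 / h\<^sup>2) * (\<Sum>s\<in>{-M..M}. (cmod (of_real (hat (W s / h - of_int j)) * f s))\<^sup>2)"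
proof -
  define B where "B = {-M..M}"
  \<comment> \<open>Contains every index whose hat is nonzero somewhere on the window.\<close>
  define J where "J = (\<Union>s\<in>B. {\<lfloor>W s / h\<rfloor>, \<lfloor>W s / h\<rfloor> + 1})"
  define \<eta> where "\<eta> j s = hat (W s / h - of_int j)" for j :: int and s
  define g where "g j s = of_real (\<eta> j s) * f s" for j s
  define F where "F = (\<Sum>s\<in>B. (cmod (f s))\<^sup>2)"
  have finJ: "finite J" and finB: "finite B" by (auto simp: J_def B_def)
  obtain s0 where s0: "f s0 \<noteq> 0" using f0 by auto
  then have "s0 \<in> B" using supp[of s0] by (fastforce simp: B_def)
  then have "(cmod (f s0))\<^sup>2 \<le> F" unfolding F_def using finB by (intro member_le_sum) auto
  moreover have "(cmod (f s0))\<^sup>2 > 0" using s0 by simp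
  ultimately have Fpos: "F > 0" by linarith
  \<comment> \<open>The factor |a s| of the bond is absorbed by the increment of \<open>W\<close>,
    which leaves a commutator bound uniform in s.\<close>
  have edge: "(\<Sum>j\<in>J. (cmod (a s))\<^sup>2 * (\<eta> j (s - 1) - \<eta> j s)\<^sup>2) \<le> 4 / h\<^sup>2" for s
  proof -
    have "(\<Sum>j\<in>J. (cmod (a s))\<^sup>2 * (\<eta> j (s - 1) - \<eta> j s)\<^sup>2) \<le> (cmod (a s))\<^sup>2 * (4 * (W (s - 1) / h -
      W s / h)\<^sup>2)"
      unfolding sum_distrib_left[symmetric] \<eta>_def
      by (intro mult_left_mono sum_hat_diff_squared_le finJ) auto
    also have "\<dots> = 4 / h\<^sup>2 * (cmod (a s) * \<bar>W s - W (s - 1)\<bar>)\<^sup>2"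
      by (simp add: power_mult_distrib power2_commute[of "W s"] diff_divide_distrib[symmetric]
        power_divide)
    also have "\<dots> \<le> 4 / h\<^sup>2 * 1"
      using W[of s] by (intro mult_left_mono power_le_one) auto
    finally show ?thesis by simp
  qed
  have pt: "(\<Sum>j\<in>J. (cmod (chiral a (g j) s - of_real E * g j s))\<^sup>2) \<le>
      4 * (cmod (chiral a f s - of_real E * f s))\<^sup>2 + 16 / h\<^sup>2 * (cmod (f (s - 1)))\<^sup>2 + 16 / h\<^sup>2 *
        (cmod (f (s + 1)))\<^sup>2" for s
  proof -
    have "(cmod (chiral a (g j) s - of_real E * g j s))\<^sup>2 \<le>
        (\<eta> j s)\<^sup>2 * (2 * (cmod (chiral a f s - of_real E * f s))\<^sup>2)
        + (cmod (a s))\<^sup>2 * (\<eta> j (s - 1) - \<eta> j s)\<^sup>2 * (4 * (cmod (f (s - 1)))\<^sup>2)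
        + (cmod (a (s + 1)))\<^sup>2 * (\<eta> j (s + 1 - 1) - \<eta> j (s + 1))\<^sup>2 * (4 * (cmod (f (s +
        1)))\<^sup>2)" for j
    proof -
      have "chiral a (g j) s - of_real E * g j s = of_real (\<eta> j s) * (chiral a f s - of_real E * f
        s)
          + a s * of_real (\<eta> j (s - 1) - \<eta> j s) * f (s - 1)
          + cnj (a (s + 1)) * of_real (\<eta> j (s + 1) - \<eta> j s) * f (s + 1)"
        by (simp add: chiral_def g_def algebra_simps)
      then show ?thesis
        using cmod_add3_squared_le[of "of_real (\<eta> j s) * (chiral a f s - of_real E * f s)"
          "a s * of_real (\<eta> j (s - 1) - \<eta> j s) * f (s - 1)"
          "cnj (a (s + 1)) * of_real (\<eta> j (s + 1) - \<eta> j s) * f (s + 1)"]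
        by (simp only: norm_mult norm_of_real complex_mod_cnj power_mult_distrib power2_abs)
           (simp add: power2_commute[of "\<eta> j s"] mult_ac)
    qed
    then have "(\<Sum>j\<in>J. (cmod (chiral a (g j) s - of_real E * g j s))\<^sup>2) \<le>
        (\<Sum>j\<in>J. (\<eta> j s)\<^sup>2) * (2 * (cmod (chiral a f s - of_real E * f s))\<^sup>2)
        + (\<Sum>j\<in>J. (cmod (a s))\<^sup>2 * (\<eta> j (s - 1) - \<eta> j s)\<^sup>2) * (4 * (cmod (f (s - 1)))\<^sup>2)
        + (\<Sum>j\<in>J. (cmod (a (s + 1)))\<^sup>2 * (\<eta> j (s + 1 - 1) - \<eta> j (s + 1))\<^sup>2) * (4 * (cmod (f (s +
        1)))\<^sup>2)"
      unfolding sum_distrib_right sum.distrib[symmetric] by (intro sum_mono)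
    also have "\<dots> \<le> 2 * (2 * (cmod (chiral a f s - of_real E * f s))\<^sup>2)
        + 4 / h\<^sup>2 * (4 * (cmod (f (s - 1)))\<^sup>2) + 4 / h\<^sup>2 * (4 * (cmod (f (s + 1)))\<^sup>2)"
    proof (intro add_mono mult_right_mono edge)
      show "(\<Sum>j\<in>J. (\<eta> j s)\<^sup>2) \<le> 2" unfolding \<eta>_def using finJ by (rule sum_hat_squared_le)
    qed auto
    finally show ?thesis by simp
  qed
  have sh1: "(\<Sum>s\<in>B. (cmod (f (s - 1)))\<^sup>2) \<le> F"
  proof -
    have "(\<Sum>s\<in>B. (cmod (f (s - 1)))\<^sup>2) = (\<Sum>s\<in>{-M-1..M-1}. (cmod (f s))\<^sup>2)"
      unfolding B_def by (rule sum.reindex_bij_witness[of _ "\<lambda>s. s + 1" "\<lambda>s. s - 1"]) auto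
    also have "\<dots> \<le> (\<Sum>s\<in>insert (-M-1) B. (cmod (f s))\<^sup>2)"
      by (intro sum_mono2) (auto simp: B_def)
    also have "\<dots> = F" unfolding F_def using supp[of "-M-1"] finB
      by (subst sum.insert) (auto simp: B_def)
    finally show ?thesis .
  qed
  have sh2: "(\<Sum>s\<in>B. (cmod (f (s + 1)))\<^sup>2) \<le> F"
  proof -
    have "(\<Sum>s\<in>B. (cmod (f (s + 1)))\<^sup>2) = (\<Sum>s\<in>{-M+1..M+1}. (cmod (f s))\<^sup>2)"
      unfolding B_def by (rule sum.reindex_bij_witness[of _ "\<lambda>s. s - 1" "\<lambda>s. s + 1"]) auto
    also have "\<dots> \<le> (\<Sum>s\<in>insert (M+1) B. (cmod (f s))\<^sup>2)"
      by (intro sum_mono2) (auto simp: B_def)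
    also have "\<dots> = F" unfolding F_def using supp[of "M+1"] finB
      by (subst sum.insert) (auto simp: B_def)
    finally show ?thesis .
  qed
  have "(\<Sum>j\<in>J. \<Sum>s\<in>B. (cmod (chiral a (g j) s - of_real E * g j s))\<^sup>2) =
      (\<Sum>s\<in>B. \<Sum>j\<in>J. (cmod (chiral a (g j) s - of_real E * g j s))\<^sup>2)" by (rule sum.swap)
  also have "\<dots> \<le> (\<Sum>s\<in>B. 4 * (cmod (chiral a f s - of_real E * f s))\<^sup>2 + 16 / h\<^sup>2 * (cmod (f (s -
    1)))\<^sup>2 + 16 / h\<^sup>2 * (cmod (f (s + 1)))\<^sup>2)"
    by (intro sum_mono pt)
  also have "\<dots> \<le> 4 * (\<epsilon> * F) + 16 / h\<^sup>2 * F + 16 / h\<^sup>2 * F"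
    unfolding sum.distrib sum_distrib_left[symmetric]
    by (intro add_mono mult_left_mono sh1 sh2) (use le in \<open>auto simp: B_def F_def\<close>)
  \<comment> \<open>The left side is (4 \<epsilon> + 32 / h^2) F; doubling its \<epsilon>-term makes
    the inequality strict. Strictness survives the choice of \<open>j\<close> and later shows that
    the localized vector is not zero.\<close>
  also have "\<dots> < (16 * \<epsilon> + 64 / h\<^sup>2) * (F / 2)"
    using \<epsilon> Fpos by (simp add: algebra_simps)
  also have "F / 2 \<le> (\<Sum>j\<in>J. \<Sum>s\<in>B. (cmod (g j s))\<^sup>2)"
  proof -
    have "F / 2 \<le> (\<Sum>s\<in>B. (\<Sum>j\<in>J. (\<eta> j s)\<^sup>2) * (cmod (f s))\<^sup>2)"
      unfolding F_def sum_divide_distrib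
    proof (intro sum_mono)
      fix s assume "s \<in> B"
      then have "1 / 2 \<le> (\<Sum>j\<in>J. (\<eta> j s)\<^sup>2)"
        unfolding \<eta>_def using finJ by (intro sum_hat_squared_ge) (auto simp: J_def)
      then have "1 / 2 * (cmod (f s))\<^sup>2 \<le> (\<Sum>j\<in>J. (\<eta> j s)\<^sup>2) * (cmod (f s))\<^sup>2"
        by (intro mult_right_mono) auto
      then show "(cmod (f s))\<^sup>2 / 2 \<le> (\<Sum>j\<in>J. (\<eta> j s)\<^sup>2) * (cmod (f s))\<^sup>2" by simp
    qed
    also have "\<dots> = (\<Sum>j\<in>J. \<Sum>s\<in>B. (cmod (g j s))\<^sup>2)"
      unfolding sum_distrib_right by (subst sum.swap) (simp add: g_def norm_mult power_mult_distrib)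
    finally show ?thesis .
  qed
  finally have "(\<Sum>j\<in>J. \<Sum>s\<in>B. (cmod (chiral a (g j) s - of_real E * g j s))\<^sup>2)
      < (\<Sum>j\<in>J. (16 * \<epsilon> + 64 / h\<^sup>2) * (\<Sum>s\<in>B. (cmod (g j s))\<^sup>2))"
    using \<epsilon> by (simp add: sum_distrib_left mult_left_mono)
  then obtain j where "(\<Sum>s\<in>B. (cmod (chiral a (g j) s - of_real E * g j s))\<^sup>2)
    < (16 * \<epsilon> + 64 / h\<^sup>2) * (\<Sum>s\<in>B. (cmod (g j s))\<^sup>2)"
    by (meson not_le sum_mono)
  then show thesis by (intro that[of j]) (simp add: g_def[abs_def] \<eta>_def B_def)
qed

section \<open>Change of gauge\<close>

lemma sum_roots_of_unity_char:
  fixes k :: int and R :: nat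
  assumes "R > 0" "\<bar>k\<bar> < int R"
  shows "(\<Sum>j<R. cis (2 * pi * of_int k * (of_nat j / of_nat R))) = (if k = 0 then of_nat R else 0)"
proof (cases "k = 0")
  case False
  define r where "r = cis (2 * pi * of_int k / of_nat R)"
  have pw: "cis (2 * pi * of_int k * (of_nat j / of_nat R)) = r ^ j" for j
  proof -
    have "2 * pi * of_int k * (of_nat j / of_nat R) = of_nat j * (2 * pi * of_int k / real R)"
      by simp
    then show ?thesis unfolding r_def Complex.DeMoivre by (simp only:)
  qed
  have "r ^ R = cis (2 * pi * of_int k)" unfolding r_def Complex.DeMoivre using assms by simp
  then have rR: "r ^ R = 1" by (simp add: cis_multiple_2pi)
  have "r \<noteq> 1"
  proof
    assume "r = 1"
    then have "cos (2 * pi * of_int k / of_nat R) = 1" unfolding r_def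
      by (metis cis.sel(1) one_complex.sel(1))
    then obtain m :: int where "2 * pi * of_int k / of_nat R = of_int m * 2 * pi"
      by (auto simp: cos_one_2pi_int)
    then have "of_int k = of_int m * real R" using assms by (simp add: field_simps)
    then have "k = m * int R" by (metis of_int_eq_iff of_int_mult of_int_of_nat_eq)
    then have "m \<noteq> 0" "\<bar>k\<bar> = \<bar>m\<bar> * int R" using False by (auto simp: abs_mult)
    moreover have "1 * int R \<le> \<bar>m\<bar> * int R" using \<open>m \<noteq> 0\<close> by (intro mult_right_mono) auto
    ultimately show False using assms by simp
  qed
  then show ?thesis using False unfolding pw by (simp add: sum_gp_strict rR)
qed simp

text \<open>Parseval's identity for the discrete Fourier transform of order R = 2A + 1: differences
  of frequencies in [-A, A] stay below R in modulus, so distinct frequencies give distinct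
  characters.\<close>

lemma discrete_parseval:
  fixes u :: "int \<Rightarrow> complex" and A :: int
  assumes A: "A \<ge> 0" and R: "int R = 2 * A + 1"
  shows "(\<Sum>j<R. (cmod (\<Sum>n\<in>{-A..A}. cis (- (2 * pi * of_int n * (of_nat j / of_nat R))) * u n))\<^sup>2)
    = of_nat R * (\<Sum>n\<in>{-A..A}. (cmod (u n))\<^sup>2)"
proof -
  have R0: "R > 0" using A R by linarith
  define c where "c n j = cis (- (2 * pi * of_int n * (of_nat j / of_nat R)))" for n :: int
    and j :: nat
  have cc: "c n j * cnj (c m j) = cis (2 * pi * of_int (m - n) * (of_nat j / of_nat R))" for n m j
    unfolding c_def cis_cnj cis_mult by (simp add: algebra_simps)
  have "of_real (\<Sum>j<R. (cmod (\<Sum>n\<in>{-A..A}. c n j * u n))\<^sup>2)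
      = (\<Sum>j<R. \<Sum>n\<in>{-A..A}. \<Sum>m\<in>{-A..A}. (c n j * u n) * cnj (c m j * u m))"
    unfolding of_real_sum complex_norm_square cnj_sum sum_product ..
  also have "\<dots> = (\<Sum>n\<in>{-A..A}. \<Sum>m\<in>{-A..A}. \<Sum>j<R. (c n j * u n) * cnj (c m j * u m))"
    by (subst sum.swap, intro sum.cong refl, rule sum.swap)
  also have "\<dots> = (\<Sum>n\<in>{-A..A}. \<Sum>m\<in>{-A..A}. (u n * cnj (u m)) * (\<Sum>j<R. cis (2 * pi * of_int (m - n) *
    (of_nat j / of_nat R))))"
    unfolding sum_distrib_left cc[symmetric] by (simp add: mult_ac)
  also have "\<dots> = (\<Sum>n\<in>{-A..A}. \<Sum>m\<in>{-A..A}. if m = n then (u n * cnj (u m)) * of_nat R else 0)"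
  proof (intro sum.cong refl)
    fix n m assume "n \<in> {-A..A}" "m \<in> {-A..A}"
    then have "\<bar>m - n\<bar> < int R" using R by auto
    then show "(u n * cnj (u m)) * (\<Sum>j<R. cis (2 * pi * of_int (m - n) * (of_nat j / of_nat R)))
        = (if m = n then (u n * cnj (u m)) * of_nat R else 0)"
      unfolding sum_roots_of_unity_char[OF R0 \<open>\<bar>m - n\<bar> < int R\<close>] by simp
  qed
  also have "\<dots> = (\<Sum>n\<in>{-A..A}. (u n * cnj (u n)) * of_nat R)" by (simp add: sum.delta)
  also have "\<dots> = of_real (of_nat R * (\<Sum>n\<in>{-A..A}. (cmod (u n))\<^sup>2))"
    unfolding of_real_mult of_real_sum complex_norm_square sum_distrib_left by (simp add: mult_ac)
  finally show ?thesis unfolding c_def of_real_eq_iff .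
qed

text \<open>The kernel of the change of gauge: summing \<open>\<Psi> n (s - n)\<close> against it over \<open>n\<close> turns the
  magnetic
  Laplacian on the square lattice in the Landau gauge into the chiral operator.\<close>

definition gauge :: "real \<Rightarrow> real \<Rightarrow> real \<Rightarrow> int \<Rightarrow> int \<Rightarrow> complex" where
  "gauge \<alpha> \<theta> x n s = cis (2 * pi * (\<alpha> * (of_int n * (of_int n - 1) / 2) - of_int n * (x
    + \<alpha> * of_int s) - of_int s * \<theta>))"

definition gauge_transform :: "real \<Rightarrow> real \<Rightarrow> real \<Rightarrow> int \<Rightarrow> (int \<Rightarrow> int \<Rightarrow> complex) \<Rightarrow> int \<Rightarrow> complex"
  where
  "gauge_transform \<alpha> \<theta> x A \<Psi> s = (\<Sum>n\<in>{-A..A}. gauge \<alpha> \<theta> x n s * \<Psi> n (s - n))"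

definition magnetic :: "real \<Rightarrow> real \<Rightarrow> (int \<Rightarrow> int \<Rightarrow> complex) \<Rightarrow> int \<Rightarrow> int \<Rightarrow> complex" where
  "magnetic \<alpha> \<theta> \<Psi> n m = \<Psi> (n - 1) m + \<Psi> (n + 1) m
     + cis (2 * pi * (\<alpha> * of_int n + \<theta>)) * \<Psi> n (m - 1) + cis (- (2 * pi * (\<alpha> * of_int n + \<theta>))) * \<Psi> n
     (m + 1)"

text \<open>On the antidiagonal n + m = s, a step in n and a step in m both become a step in s. By
  \<open>b1\<close> to \<open>b4\<close> the kernel absorbs the magnetic phase of the m-step
  completely and turns that of the n-step into a factor depending on s alone, so the two add up to
  one hopping term 1 + cis. Vanishing of \<Psi> for |n| \<ge> A removes the boundary terms of the
  window.\<close>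

lemma gauge_intertwines:
  assumes supp: "\<And>n m. \<bar>n\<bar> \<ge> A \<Longrightarrow> \<Psi> n m = 0"
  shows "gauge_transform \<alpha> \<theta> x A (magnetic \<alpha> \<theta> \<Psi>) s = chiral (hop \<alpha> (x + \<theta>)) (gauge_transform \<alpha> \<theta> x
    A \<Psi>) s"
proof -
  define b where "b = gauge \<alpha> \<theta> x"
  define e1 where "e1 n = cis (2 * pi * (\<alpha> * of_int n + \<theta>))" for n :: int
  define e2 where "e2 n = cis (- (2 * pi * (\<alpha> * of_int n + \<theta>)))" for n :: int
  define v where "v s = cis (- 2 * pi * (x + \<theta> + \<alpha> * of_int s))" for s :: int
  have b1: "b n s * e1 n = b n (s - 1)" for n
    unfolding b_def e1_def gauge_def cis_mult by (rule arg_cong[of _ _ cis]) (simp add: field_simps)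
  have b2: "b n s * e2 n = b n (s + 1)" for n
    unfolding b_def e2_def gauge_def cis_mult by (rule arg_cong[of _ _ cis]) (simp add: field_simps)
  have b3: "b (n + 1) s = v s * b n (s - 1)" for n
    unfolding b_def v_def gauge_def cis_mult by (rule arg_cong[of _ _ cis]) (simp add: field_simps)
  have b4: "b (n - 1) s = cnj (v (s + 1)) * b n (s + 1)" for n
    unfolding b_def v_def gauge_def cis_cnj cis_mult by (rule arg_cong[of _ _ cis]) (simp add:
      field_simps)
  have s1: "(\<Sum>n\<in>{-A..A}. b n s * \<Psi> (n - 1) (s - n)) = (\<Sum>n\<in>{-A..A}. b (n + 1) s * \<Psi> n (s - 1 - n))"
  proof -
    have "(\<Sum>n\<in>{-A..A}. b n s * \<Psi> (n - 1) (s - n)) = (\<Sum>n\<in>{-A+1..A}. b n s * \<Psi> (n - 1) (s - n))"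
      using supp by (intro sum.mono_neutral_right) auto
    also have "\<dots> = (\<Sum>n\<in>{-A..A-1}. b (n + 1) s * \<Psi> n (s - 1 - n))"
      by (rule sum.reindex_bij_witness[of _ "\<lambda>n. n + 1" "\<lambda>n. n - 1"]) (auto simp: algebra_simps)
    also have "\<dots> = (\<Sum>n\<in>{-A..A}. b (n + 1) s * \<Psi> n (s - 1 - n))"
      using supp by (intro sum.mono_neutral_left) auto
    finally show ?thesis .
  qed
  have s2: "(\<Sum>n\<in>{-A..A}. b n s * \<Psi> (n + 1) (s - n)) = (\<Sum>n\<in>{-A..A}. b (n - 1) s * \<Psi> n (s + 1 - n))"
  proof -
    have "(\<Sum>n\<in>{-A..A}. b n s * \<Psi> (n + 1) (s - n)) = (\<Sum>n\<in>{-A..A-1}. b n s * \<Psi> (n + 1) (s - n))"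
      using supp by (intro sum.mono_neutral_right) auto
    also have "\<dots> = (\<Sum>n\<in>{-A+1..A}. b (n - 1) s * \<Psi> n (s + 1 - n))"
      by (rule sum.reindex_bij_witness[of _ "\<lambda>n. n - 1" "\<lambda>n. n + 1"]) (auto simp: algebra_simps)
    also have "\<dots> = (\<Sum>n\<in>{-A..A}. b (n - 1) s * \<Psi> n (s + 1 - n))"
      using supp by (intro sum.mono_neutral_left) auto
    finally show ?thesis .
  qed
  have "gauge_transform \<alpha> \<theta> x A (magnetic \<alpha> \<theta> \<Psi>) s =
      (\<Sum>n\<in>{-A..A}. b n s * \<Psi> (n - 1) (s - n)) + (\<Sum>n\<in>{-A..A}. b n s * \<Psi> (n + 1) (s - n))
      + (\<Sum>n\<in>{-A..A}. b n s * e1 n * \<Psi> n (s - n - 1)) + (\<Sum>n\<in>{-A..A}. b n s * e2 n * \<Psi> n (s - n + 1))"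
    unfolding gauge_transform_def magnetic_def b_def[symmetric] e1_def[symmetric] e2_def[symmetric]
      sum.distrib[symmetric]
    by (intro sum.cong refl) (simp add: algebra_simps)
  also have "\<dots> = (\<Sum>n\<in>{-A..A}. v s * b n (s - 1) * \<Psi> n (s - 1 - n)) + (\<Sum>n\<in>{-A..A}. cnj (v (s
    + 1)) * b n (s + 1) * \<Psi> n (s + 1 - n))
      + (\<Sum>n\<in>{-A..A}. b n (s - 1) * \<Psi> n (s - 1 - n)) + (\<Sum>n\<in>{-A..A}. b n (s + 1) * \<Psi> n (s + 1 - n))"
    unfolding s1 s2 b1 b2 b3 b4 by (simp add: algebra_simps)
  also have "\<dots> = chiral (hop \<alpha> (x + \<theta>)) (gauge_transform \<alpha> \<theta> x A \<Psi>) s"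
    unfolding chiral_def gauge_transform_def hop_def b_def[symmetric] v_def[symmetric]
    by (simp add: algebra_simps sum_distrib_left sum.distrib)
  finally show ?thesis .
qed

text \<open>A single gauge transform need not preserve norms, but the average over \<open>R\<close>
  equally spaced phases does, because \<open>x\<close> enters the kernel only through a character in
  \<open>n\<close>.\<close>

lemma gauge_parseval:
  assumes A: "A \<ge> 0" and R: "int R = 2 * A + 1"
  shows "(\<Sum>j<R. (cmod (gauge_transform \<alpha> \<theta> (of_nat j / of_nat R) A \<Psi> s))\<^sup>2)
    = of_nat R * (\<Sum>n\<in>{-A..A}. (cmod (\<Psi> n (s - n)))\<^sup>2)"
proof -
  define u where "u n = gauge \<alpha> \<theta> 0 n s * \<Psi> n (s - n)" for n
  have gx: "gauge \<alpha> \<theta> x n s = cis (- (2 * pi * of_int n * x)) * gauge \<alpha> \<theta> 0 n s" for x n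
    unfolding gauge_def cis_mult by (rule arg_cong[of _ _ cis]) (simp add: field_simps)
  have gt: "gauge_transform \<alpha> \<theta> x A \<Psi> s = (\<Sum>n\<in>{-A..A}. cis (- (2 * pi * of_int n * x)) * u n)" for x
    unfolding gauge_transform_def u_def gx[of x] mult.assoc ..
  have "cmod (u n) = cmod (\<Psi> n (s - n))" for n by (simp add: u_def norm_mult gauge_def)
  then show ?thesis using discrete_parseval[OF A R, of u] unfolding gt by (simp only:)
qed

text \<open>Multiplying \<phi> by the indicator \<xi> of a long interval in the second direction
  gives an approximate eigenvector of the magnetic Laplacian, which acts like the almost Mathieu
  operator on functions constant in m. The gauge transform carries it over for a whole family of
  phases, and averaging over the phases finds one that works.\<close>

lemma chiral_approximate_eigenvector:
  fixes \<phi> :: "int \<Rightarrow> complex" and \<epsilon> E :: real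
  assumes supp: "\<And>n. \<bar>n\<bar> \<ge> A \<Longrightarrow> \<phi> n = 0" and \<phi>0: "\<phi> \<noteq> (\<lambda>n. 0)" and \<epsilon>: "\<epsilon> > 0"
    and le: "(\<Sum>n\<in>{-A..A}. (cmod (critical_almost_mathieu \<alpha> \<theta> \<phi> n - of_real E * \<phi> n))\<^sup>2)
      \<le> \<epsilon> * (\<Sum>n\<in>{-A..A}. (cmod (\<phi> n))\<^sup>2)"
  obtains y f M where "\<And>s. \<bar>s\<bar> \<ge> M \<Longrightarrow> f s = 0"
    "(\<Sum>s\<in>{-M..M}. (cmod (chiral (hop \<alpha> y) f s - of_real E * f s))\<^sup>2)
      < 4 * \<epsilon> * (\<Sum>s\<in>{-M..M}. (cmod (f s))\<^sup>2)"
proof -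
  have "A > 0" using supp \<phi>0 by (metis abs_ge_zero ext not_less order_trans)
  define R where "R = nat (2 * A + 1)"
  have R: "int R = 2 * A + 1" "R > 0" using \<open>A > 0\<close> by (auto simp: R_def)
  \<comment> \<open>Each value of n pays at most 32 |\<phi> n|^2 for the two ends of the interval,
    against a total mass N |\<phi> n|^2.\<close>
  define N where "N = nat \<lceil>32 / \<epsilon>\<rceil> + 1"
  have N: "32 \<le> real N * \<epsilon>"
  proof -
    have "32 / \<epsilon> \<le> real N" unfolding N_def by linarith
    then show ?thesis using \<epsilon> by (simp add: field_simps)
  qed
  have N1: "int N \<ge> 1" by (simp add: N_def)
  define \<xi> where "\<xi> m = (if 0 \<le> m \<and> m < int N then 1 else 0 :: complex)" for m
  define \<Psi> where "\<Psi> n m = \<phi> n * \<xi> m" for n m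
  define \<Phi> where "\<Phi> n m = magnetic \<alpha> \<theta> \<Psi> n m - of_real E * \<Psi> n m" for n m
  define M where "M = A + int N + 2"
  define F where "F = (\<Sum>n\<in>{-A..A}. (cmod (\<phi> n))\<^sup>2)"
  have Fpos: "F > 0"
  proof -
    obtain n where n: "\<phi> n \<noteq> 0" using \<phi>0 by auto
    then have "n \<in> {-A..A}" using supp[of n] by fastforce
    then have "(cmod (\<phi> n))\<^sup>2 \<le> F" unfolding F_def by (intro member_le_sum) auto
    moreover have "(cmod (\<phi> n))\<^sup>2 > 0" using n by simp
    ultimately show ?thesis by linarith
  qed
  define f where "f j = gauge_transform \<alpha> \<theta> (of_nat j / of_nat R) A \<Psi>" for j
  have fsupp: "f j s = 0" if "\<bar>s\<bar> \<ge> M" for j s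
    unfolding f_def gauge_transform_def
  proof (rule sum.neutral, rule ballI)
    fix n assume "n \<in> {-A..A}"
    then have "\<not> (0 \<le> s - n \<and> s - n < int N)" using that unfolding M_def by auto
    then show "gauge \<alpha> \<theta> (of_nat j / of_nat R) n s * \<Psi> n (s - n) = 0"
      by (simp only: \<Psi>_def \<xi>_def if_False) simp
  qed
  have line: "(\<Sum>s\<in>{-M..M}. G (s - n)) = (\<Sum>m\<in>{-1..int N}. G m)"
    if "n \<in> {-A..A}" "\<And>m. m \<notin> {-1..int N} \<Longrightarrow> G m = 0" for n and G :: "int \<Rightarrow> real"
  proof -
    have "(\<Sum>s\<in>{-M..M}. G (s - n)) = (\<Sum>m\<in>{-M-n..M-n}. G m)"
      by (rule sum.reindex_bij_witness[of _ "\<lambda>m. m + n" "\<lambda>s. s - n"]) auto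
    also have "\<dots> = (\<Sum>m\<in>{-1..int N}. G m)"
      using that by (intro sum.mono_neutral_right) (auto simp: M_def)
    finally show ?thesis .
  qed
  have norm_f: "(\<Sum>j<R. \<Sum>s\<in>{-M..M}. (cmod (f j s))\<^sup>2) = of_nat R * (of_nat N * F)"
  proof -
    have "(\<Sum>j<R. \<Sum>s\<in>{-M..M}. (cmod (f j s))\<^sup>2) = (\<Sum>s\<in>{-M..M}. of_nat R * (\<Sum>n\<in>{-A..A}. (cmod (\<Psi> n (s
      - n)))\<^sup>2))"
      unfolding f_def using \<open>A > 0\<close> R by (subst sum.swap) (simp add: gauge_parseval)
    also have "\<dots> = of_nat R * (\<Sum>n\<in>{-A..A}. \<Sum>s\<in>{-M..M}. (cmod (\<Psi> n (s - n)))\<^sup>2)"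
      unfolding sum_distrib_left[symmetric] by (subst sum.swap) simp
    also have "\<dots> = of_nat R * (\<Sum>n\<in>{-A..A}. \<Sum>m\<in>{-1..int N}. (cmod (\<Psi> n m))\<^sup>2)"
      by (intro arg_cong[of _ _ "\<lambda>t. of_nat R * t"] sum.cong refl line) (auto simp: \<Psi>_def \<xi>_def)
    also have "(\<Sum>n\<in>{-A..A}. \<Sum>m\<in>{-1..int N}. (cmod (\<Psi> n m))\<^sup>2)
      = (\<Sum>n\<in>{-A..A}. of_nat N * (cmod (\<phi> n))\<^sup>2)"
    proof (intro sum.cong refl)
      fix n
      have "(\<Sum>m\<in>{-1..int N}. (cmod (\<Psi> n m))\<^sup>2) = (\<Sum>m\<in>{0..<int N}. (cmod (\<phi> n))\<^sup>2)"
        by (intro sum.mono_neutral_cong_right) (auto simp: \<Psi>_def \<xi>_def)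
      then show "(\<Sum>m\<in>{-1..int N}. (cmod (\<Psi> n m))\<^sup>2) = of_nat N * (cmod (\<phi> n))\<^sup>2" by simp
    qed
    finally show ?thesis by (simp add: F_def sum_distrib_left)
  qed
  \<comment> \<open>Away from the ends of the interval \<xi> is locally constant and only the
    residual of \<phi> remains.\<close>
  have \<Phi>_eq: "\<Phi> n m = \<xi> m * (critical_almost_mathieu \<alpha> \<theta> \<phi> n - of_real E * \<phi> n)
      + \<phi> n * (cis (2 * pi * (\<alpha> * of_int n + \<theta>)) * (\<xi> (m - 1) - \<xi> m)
             + cis (- (2 * pi * (\<alpha> * of_int n + \<theta>))) * (\<xi> (m + 1) - \<xi> m))" for n m
  proof -
    have "complex_of_real (2 * cos t) = cis t + cis (- t)" for t
      by (simp add: complex_eq_iff)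
    then show ?thesis unfolding \<Phi>_def magnetic_def \<Psi>_def critical_almost_mathieu_def
      by (simp add: algebra_simps)
  qed
  have \<Phi>0: "\<Phi> n m = 0" if "m \<notin> {-1..int N}" for n m
  proof -
    have "\<xi> m = 0" "\<xi> (m - 1) = 0" "\<xi> (m + 1) = 0" using that by (auto simp: \<xi>_def)
    then show ?thesis unfolding \<Phi>_eq by simp
  qed
  define d where "d m = cmod (\<xi> (m - 1) - \<xi> m) + cmod (\<xi> (m + 1) - \<xi> m)" for m
  have d: "(\<Sum>m\<in>{-1..int N}. (d m)\<^sup>2) \<le> 16"
  proof -
    have d2: "(d m)\<^sup>2 \<le> 4" for m
    proof -
      have "0 \<le> d m" "d m \<le> 2" by (auto simp: d_def \<xi>_def)
      then show ?thesis using power_mono[of "d m" 2 2] by simp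
    qed
    \<comment> \<open>Only the sites next to a jump of \<xi> contribute, at most four of them with
      at most 4 each.\<close>
    have "(\<Sum>m\<in>{-1..int N}. (d m)\<^sup>2) = (\<Sum>m\<in>{-1, 0, int N - 1, int N}. (d m)\<^sup>2)"
      by (intro sum.mono_neutral_right) (use N1 in \<open>auto simp: d_def \<xi>_def\<close>)
    also have "\<dots> \<le> (\<Sum>m\<in>{-1, 0, int N - 1, int N}. 4)" by (intro sum_mono d2)
    also have "\<dots> \<le> 16" using card_length[of "[-1, 0, int N - 1, int N]"] by simp
    finally show ?thesis .
  qed
  have \<Phi>_le: "(\<Sum>m\<in>{-1..int N}. (cmod (\<Phi> n m))\<^sup>2) \<le>
      2 * of_nat N * (cmod (critical_almost_mathieu \<alpha> \<theta> \<phi> n - of_real E * \<phi> n))\<^sup>2 + 32 * (cmod (\<phi>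
        n))\<^sup>2" for n
  proof -
    define D where "D = critical_almost_mathieu \<alpha> \<theta> \<phi> n - of_real E * \<phi> n"
    have "(cmod (\<Phi> n m))\<^sup>2 \<le> (cmod (\<xi> m))\<^sup>2 * (2 * (cmod D)\<^sup>2) + (d m)\<^sup>2 * (2 * (cmod (\<phi> n))\<^sup>2)"
      for m
    proof -
      have "cmod (\<Phi> n m) \<le> cmod (\<xi> m) * cmod D + cmod (\<phi> n) * d m"
        unfolding \<Phi>_eq D_def[symmetric] d_def
        by (rule norm_triangle_le, unfold norm_mult, intro add_mono mult_left_mono order_refl,
            rule norm_triangle_le) (simp_all add: norm_mult)
      then have "(cmod (\<Phi> n m))\<^sup>2 \<le> (cmod (\<xi> m) * cmod D + cmod (\<phi> n) * d m)\<^sup>2"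
        by (intro power_mono) auto
      also have "\<dots> \<le> 2 * (cmod (\<xi> m) * cmod D)\<^sup>2 + 2 * (cmod (\<phi> n) * d m)\<^sup>2"
        using zero_le_power2[of "cmod (\<xi> m) * cmod D - cmod (\<phi> n) * d m"]
          by (simp add: power2_eq_square algebra_simps)
      finally show ?thesis by (simp add: power_mult_distrib mult_ac)
    qed
    then have "(\<Sum>m\<in>{-1..int N}. (cmod (\<Phi> n m))\<^sup>2) \<le>
        (\<Sum>m\<in>{-1..int N}. (cmod (\<xi> m))\<^sup>2) * (2 * (cmod D)\<^sup>2) + (\<Sum>m\<in>{-1..int N}. (d m)\<^sup>2) * (2 * (cmod
          (\<phi> n))\<^sup>2)"
      unfolding sum_distrib_right sum.distrib[symmetric] by (intro sum_mono)
    also have "(\<Sum>m\<in>{-1..int N}. (cmod (\<xi> m))\<^sup>2) = (\<Sum>m\<in>{0..<int N}. 1)"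
      by (intro sum.mono_neutral_cong_right) (auto simp: \<xi>_def)
    also have "(\<Sum>m\<in>{0..<int N}. 1) * (2 * (cmod D)\<^sup>2) + (\<Sum>m\<in>{-1..int N}. (d m)\<^sup>2) * (2 * (cmod (\<phi>
      n))\<^sup>2)
        \<le> of_nat N * (2 * (cmod D)\<^sup>2) + 16 * (2 * (cmod (\<phi> n))\<^sup>2)"
      using d by (intro add_mono mult_right_mono) auto
    finally show ?thesis by (simp add: D_def)
  qed
  have res: "chiral (hop \<alpha> (of_nat j / of_nat R + \<theta>)) (f j) s - of_real E * f j s
    = gauge_transform \<alpha> \<theta> (of_nat j / of_nat R) A \<Phi> s" for j s
  proof -
    have "gauge_transform \<alpha> \<theta> (of_nat j / of_nat R) A (magnetic \<alpha> \<theta> \<Psi>) s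
      = chiral (hop \<alpha> (of_nat j / of_nat R + \<theta>)) (f j) s"
      unfolding f_def by (rule gauge_intertwines) (simp add: \<Psi>_def supp)
    then show ?thesis
      unfolding f_def gauge_transform_def \<Phi>_def by (simp add: algebra_simps sum_subtractf
        sum_distrib_left)
  qed
  have "(\<Sum>j<R. \<Sum>s\<in>{-M..M}. (cmod (chiral (hop \<alpha> (of_nat j / of_nat R + \<theta>)) (f j) s - of_real E * f j
    s))\<^sup>2)
      = (\<Sum>s\<in>{-M..M}. of_nat R * (\<Sum>n\<in>{-A..A}. (cmod (\<Phi> n (s - n)))\<^sup>2))"
    unfolding res using \<open>A > 0\<close> R by (subst sum.swap) (simp add: gauge_parseval)
  also have "\<dots> = of_nat R * (\<Sum>n\<in>{-A..A}. \<Sum>s\<in>{-M..M}. (cmod (\<Phi> n (s - n)))\<^sup>2)"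
    unfolding sum_distrib_left[symmetric] by (subst sum.swap) simp
  also have "\<dots> = of_nat R * (\<Sum>n\<in>{-A..A}. \<Sum>m\<in>{-1..int N}. (cmod (\<Phi> n m))\<^sup>2)"
    by (intro arg_cong[of _ _ "\<lambda>t. of_nat R * t"] sum.cong refl line) (simp_all add: \<Phi>0)
  also have "\<dots> \<le> of_nat R * (\<Sum>n\<in>{-A..A}. 2 * of_nat N * (cmod (critical_almost_mathieu \<alpha> \<theta> \<phi> n -
    of_real E * \<phi> n))\<^sup>2 + 32 * (cmod (\<phi> n))\<^sup>2)"
    by (intro mult_left_mono sum_mono \<Phi>_le) auto
  also have "\<dots> \<le> of_nat R * (2 * of_nat N * (\<epsilon> * F) + 32 * F)"
    unfolding sum.distrib sum_distrib_left[symmetric] using le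
      by (intro mult_left_mono add_mono) (auto simp: F_def)
  also have "\<dots> < of_nat R * (4 * \<epsilon> * (of_nat N * F))"
  proof (intro mult_strict_left_mono)
    have "32 * F \<le> of_nat N * \<epsilon> * F" using N Fpos by (intro mult_right_mono) auto
    moreover have "of_nat N * \<epsilon> * F > 0" using Fpos \<epsilon> N1 by simp
    ultimately show "2 * of_nat N * (\<epsilon> * F) + 32 * F < 4 * \<epsilon> * (of_nat N * F)"
      by (simp add: algebra_simps)
  qed (use R in auto)
  also have "\<dots> = (\<Sum>j<R. 4 * \<epsilon> * (\<Sum>s\<in>{-M..M}. (cmod (f j s))\<^sup>2))"
    using norm_f by (simp only: sum_distrib_left[symmetric]) (simp add: mult_ac)
  \<comment> \<open>Since the sums over the phases satisfy the strict inequality, at least one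
    summand does.\<close>
  finally have "\<exists>j\<in>{..<R}. (\<Sum>s\<in>{-M..M}. (cmod (chiral (hop \<alpha> (of_nat j / of_nat R
    + \<theta>)) (f j) s - of_real E * f j s))\<^sup>2)
      < 4 * \<epsilon> * (\<Sum>s\<in>{-M..M}. (cmod (f j s))\<^sup>2)"
    by (rule contrapos_pp) (auto simp: not_less intro!: sum_mono)
  then obtain j where j: "(\<Sum>s\<in>{-M..M}. (cmod (chiral (hop \<alpha> (of_nat j / of_nat R
    + \<theta>)) (f j) s - of_real E * f j s))\<^sup>2)
      < 4 * \<epsilon> * (\<Sum>s\<in>{-M..M}. (cmod (f j s))\<^sup>2)"
    by blast
  show thesis by (rule that[OF fsupp j])
qed

section \<open>Approximate eigenvectors from the spectrum\<close>

lemma ell2_finite_le: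
  assumes "f \<in> ell2" "finite A"
  shows "L2_set (\<lambda>n. cmod (f n)) A \<le> ell2_norm f"
  unfolding L2_set_def ell2_norm_def
  using assms by (intro real_sqrt_le_mono finite_sum_le_infsum) (auto simp: ell2_def)

text \<open>Reduces estimates in \<open>ell2\<close> to finite sections, where the triangle
  inequality for \<open>L2_set\<close> is at hand.\<close>

lemma ell2I:
  assumes "\<And>A. finite A \<Longrightarrow> L2_set (\<lambda>n. cmod (f n)) A \<le> B"
  shows "f \<in> ell2" "ell2_norm f \<le> B"
proof -
  have B: "B \<ge> 0" using assms[of "{}"] by simp
  have le: "(\<Sum>n\<in>A. (cmod (f n))\<^sup>2) \<le> B\<^sup>2" if "finite A" for A
    using assms[OF that] unfolding L2_set_def by (metis B real_sqrt_le_iff real_sqrt_pow2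
      real_sqrt_power real_sqrt_unique)
  have sm: "(\<lambda>n. (cmod (f n))\<^sup>2) summable_on UNIV"
    by (rule nonneg_bounded_partial_sums_imp_summable_on[of _ _ "B\<^sup>2"])
       (use le in \<open>auto intro!: eventually_finite_subsets_at_top_weakI\<close>)
  then show "f \<in> ell2" by (simp add: ell2_def)
  have "(\<Sum>\<^sub>\<infinity>n. (cmod (f n))\<^sup>2) \<le> B\<^sup>2"
    using sm le by (intro infsum_le_finite_sums) auto
  then show "ell2_norm f \<le> B" unfolding ell2_norm_def using B by (rule_tac real_le_lsqrt) auto
qed

lemma ell2_norm_nonneg: "ell2_norm f \<ge> 0"
  unfolding ell2_norm_def by (intro real_sqrt_ge_zero infsum_nonneg) auto

lemma ell2_add:
  assumes "f \<in> ell2" "g \<in> ell2"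
  shows "(\<lambda>n. f n + g n) \<in> ell2" "ell2_norm (\<lambda>n. f n + g n) \<le> ell2_norm f + ell2_norm g"
proof -
  have "L2_set (\<lambda>n. cmod (f n + g n)) A \<le> ell2_norm f + ell2_norm g" if "finite A" for A
  proof -
    have "L2_set (\<lambda>n. cmod (f n + g n)) A \<le> L2_set (\<lambda>n. cmod (f n) + cmod (g n)) A"
      by (intro L2_set_mono norm_triangle_ineq) auto
    also have "\<dots> \<le> L2_set (\<lambda>n. cmod (f n)) A + L2_set (\<lambda>n. cmod (g n)) A"
      by (rule L2_set_triangle_ineq)
    finally show ?thesis using ell2_finite_le[OF assms(1) that] ell2_finite_le[OF assms(2) that]
      by linarith
  qed
  then show "(\<lambda>n. f n + g n) \<in> ell2" "ell2_norm (\<lambda>n. f n + g n) \<le> ell2_norm f + ell2_norm g"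
    using ell2I[of "\<lambda>n. f n + g n" "ell2_norm f + ell2_norm g"] by blast+
qed

lemma ell2_scale:
  assumes "f \<in> ell2"
  shows "(\<lambda>n. c * f n) \<in> ell2" "ell2_norm (\<lambda>n. c * f n) = cmod c * ell2_norm f"
proof -
  show "(\<lambda>n. c * f n) \<in> ell2" using assms unfolding ell2_def
    by (auto simp: norm_mult power_mult_distrib intro!: summable_on_cmult_right)
  have "(\<Sum>\<^sub>\<infinity>n. (cmod (c * f n))\<^sup>2) = (cmod c)\<^sup>2 * (\<Sum>\<^sub>\<infinity>n. (cmod (f n))\<^sup>2)"
    unfolding norm_mult power_mult_distrib using assms by (intro infsum_cmult_right) (auto simp:
      ell2_def)
  then show "ell2_norm (\<lambda>n. c * f n) = cmod c * ell2_norm f"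
    unfolding ell2_norm_def by (simp add: real_sqrt_mult)
qed

lemma cmod_le_ell2_norm: "f \<in> ell2 \<Longrightarrow> cmod (f n) \<le> ell2_norm f"
  using ell2_finite_le[of f "{n}"] by simp

lemma ell2_norm_squared: "(ell2_norm f)\<^sup>2 = (\<Sum>\<^sub>\<infinity>n. (cmod (f n))\<^sup>2)"
  unfolding ell2_norm_def by (intro real_sqrt_pow2 infsum_nonneg) auto

lemma ell2_inner_self:
  assumes "f \<in> ell2"
  shows "(\<Sum>\<^sub>\<infinity>n. cnj (f n) * f n) = of_real ((ell2_norm f)\<^sup>2)"
proof -
  have "((\<lambda>n. of_real ((cmod (f n))\<^sup>2) :: complex) has_sum of_real ((ell2_norm f)\<^sup>2)) UNIV"
    unfolding ell2_norm_squared using assms by (intro has_sum_of_real_iff[THEN iffD2]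
      has_sum_infsum) (simp add: ell2_def)
  then have "((\<lambda>n. cnj (f n) * f n) has_sum of_real ((ell2_norm f)\<^sup>2)) UNIV"
    unfolding complex_norm_square by (simp only: mult.commute)
  then show ?thesis by (rule infsumI)
qed

lemma ell2_norm_diff_squared:
  assumes "f \<in> ell2" "g \<in> ell2"
  shows "(ell2_norm (\<lambda>n. f n - of_real t * g n))\<^sup>2 =
    (ell2_norm f)\<^sup>2 - 2 * t * Re (\<Sum>\<^sub>\<infinity>n. cnj (f n) * g n) + t\<^sup>2 * (ell2_norm g)\<^sup>2"
proof -
  have s: "((\<lambda>n. (cmod (f n))\<^sup>2) has_sum (ell2_norm f)\<^sup>2) UNIV" "((\<lambda>n. (cmod (g n))\<^sup>2) has_sum
    (ell2_norm g)\<^sup>2) UNIV"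
    using assms unfolding ell2_norm_squared ell2_def by (auto intro!: has_sum_infsum)
  have i: "((\<lambda>n. Re (cnj (f n) * g n)) has_sum Re (\<Sum>\<^sub>\<infinity>n. cnj (f n) * g n)) UNIV"
    by (intro has_sum_Re has_sum_infsum ell2_mult_summable assms)
  have "((\<lambda>n. (cmod (f n))\<^sup>2 + (- (2 * t)) * Re (cnj (f n) * g n) + t\<^sup>2 * (cmod (g n))\<^sup>2) has_sum
      ((ell2_norm f)\<^sup>2 + (- (2 * t)) * Re (\<Sum>\<^sub>\<infinity>n. cnj (f n) * g n) + t\<^sup>2 * (ell2_norm g)\<^sup>2)) UNIV"
    by (intro has_sum_add has_sum_cmult_right s i)
  moreover have "(cmod (f n))\<^sup>2 + (- (2 * t)) * Re (cnj (f n) * g n) + t\<^sup>2 * (cmod (g n))\<^sup>2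
    = (cmod (f n - of_real t * g n))\<^sup>2" for n
    unfolding cmod_power2 by (simp add: power2_eq_square algebra_simps)
  ultimately show ?thesis unfolding ell2_norm_squared[of "\<lambda>n. f n - of_real t * g n"]
    by (simp add: infsumI)
qed

text \<open>The series is summed pointwise, and the norm bound passes from the partial sums to the
  limit on each finite set of sites. Pointwise sums suffice later, because the operator applied to
  them has finite range.\<close>

lemma ell2_geometric_series:
  assumes f: "\<And>k. f k \<in> ell2" "\<And>k. ell2_norm (f k) \<le> C * r ^ k" and r: "0 \<le> r" "r < 1"
    and C: "C \<ge> 0"
  shows "summable (\<lambda>k. f k n)" "(\<lambda>n. \<Sum>k. f k n) \<in> ell2" "ell2_norm (\<lambda>n. \<Sum>k. f k n) \<le> C / (1 - r)"
proof -
  have geo: "summable (\<lambda>k. C * r ^ k)" using r by (intro summable_mult summable_geometric) auto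
  show sm: "summable (\<lambda>k. f k n)" for n
    by (rule summable_comparison_test'[OF geo]) (use f cmod_le_ell2_norm order_trans in blast)
  have fin: "L2_set (\<lambda>n. cmod (\<Sum>k<K. f k n)) A \<le> C / (1 - r)" if A: "finite A" for K A
  proof -
    have "L2_set (\<lambda>n. cmod (\<Sum>k<K. f k n)) A \<le> (\<Sum>k<K. C * r ^ k)"
    proof (induction K)
      case (Suc K)
      have "L2_set (\<lambda>n. cmod (\<Sum>k<Suc K. f k n)) A \<le> L2_set (\<lambda>n. cmod (\<Sum>k<K. f k n)
        + cmod (f K n)) A"
        by (intro L2_set_mono) (auto intro: norm_triangle_ineq)
      also have "\<dots> \<le> L2_set (\<lambda>n. cmod (\<Sum>k<K. f k n)) A + L2_set (\<lambda>n. cmod (f K n)) A"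
        by (rule L2_set_triangle_ineq)
      also have "\<dots> \<le> (\<Sum>k<K. C * r ^ k) + C * r ^ K"
        using Suc ell2_finite_le[OF f(1) A, of K] f(2)[of K] by linarith
      finally show ?case by simp
    qed (simp add: L2_set_def)
    also have "\<dots> \<le> (\<Sum>k. C * r ^ k)" using geo C r by (intro sum_le_suminf) auto
    also have "\<dots> = C / (1 - r)" using r by (simp add: suminf_mult summable_geometric
      suminf_geometric)
    finally show ?thesis .
  qed
  have "L2_set (\<lambda>n. cmod (\<Sum>k. f k n)) A \<le> C / (1 - r)" if A: "finite A" for A
  proof (rule LIMSEQ_le_const2)
    show "(\<lambda>K. L2_set (\<lambda>n. cmod (\<Sum>k<K. f k n)) A) \<longlonglongrightarrow> L2_set (\<lambda>n. cmod (\<Sum>k. f k n)) A"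
      unfolding L2_set_def by (intro tendsto_intros summable_LIMSEQ sm)
  qed (use fin[OF A] in auto)
  then show "(\<lambda>n. \<Sum>k. f k n) \<in> ell2" "ell2_norm (\<lambda>n. \<Sum>k. f k n) \<le> C / (1 - r)"
    using ell2I[of "\<lambda>n. \<Sum>k. f k n" "C / (1 - r)"] by blast+
qed

text \<open>A self-adjoint operator \<open>D\<close> that is bounded below is inverted by
  \<open>t D (\<Sum>k. (1 - t D\<^sup>2) ^ k)\<close> for small \<open>t > 0\<close>.\<close>

lemma spectrum_approximate_eigenvector:
  fixes \<alpha> \<theta> E c :: real
  assumes spec: "complex_of_real E \<in> spectrum (critical_almost_mathieu \<alpha> \<theta>)" and c: "c > 0"
  shows "\<exists>\<phi>\<in>ell2. ell2_norm (\<lambda>n. critical_almost_mathieu \<alpha> \<theta> \<phi> n - of_real E * \<phi> n)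
    < c * ell2_norm \<phi>"
proof (rule ccontr)
  assume neg: "\<not> ?thesis"
  define H where "H = critical_almost_mathieu \<alpha> \<theta>"
  define D where "D \<phi> n = H \<phi> n - of_real E * \<phi> n" for \<phi> n
  have Hb: "bounded_operator H" unfolding H_def by (rule bounded_operator_critical_almost_mathieu)
  then obtain C where HC: "\<And>\<phi>. \<phi> \<in> ell2 \<Longrightarrow> ell2_norm (H \<phi>) \<le> C * ell2_norm \<phi>" and Hell: "\<And>\<phi>. \<phi> \<in> ell2
    \<Longrightarrow> H \<phi> \<in> ell2"
    unfolding bounded_operator_def by blast
  have Dell: "D \<phi> \<in> ell2" if "\<phi> \<in> ell2" for \<phi>
    using ell2_add(1)[OF Hell[OF that] ell2_scale(1)[OF that, of "- of_real E"]]
      by (simp add: D_def[abs_def])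
  \<comment> \<open>The maximum with \<open>c\<close> ensures \<open>t * c\<^sup>2 \<le> 1\<close>
    below, so that the contraction ratio \<open>r\<close> is the root of a nonnegative
    number.\<close>
  define B where "B = max (\<bar>C\<bar> + \<bar>E\<bar>) c"
  have B: "B > 0" "c \<le> B" using c by (auto simp: B_def)
  have DB: "ell2_norm (D \<phi>) \<le> B * ell2_norm \<phi>" if \<phi>: "\<phi> \<in> ell2" for \<phi>
  proof -
    have "ell2_norm (D \<phi>) \<le> ell2_norm (H \<phi>) + \<bar>E\<bar> * ell2_norm \<phi>"
      using ell2_add(2)[OF Hell[OF \<phi>] ell2_scale(1)[OF \<phi>, of "- of_real E"]] ell2_scale(2)[OF \<phi>, of
        "- of_real E"]
      by (simp add: D_def[abs_def])
    also have "\<dots> \<le> (\<bar>C\<bar> + \<bar>E\<bar>) * ell2_norm \<phi>"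
      using HC[OF \<phi>] mult_right_mono[of C "\<bar>C\<bar>", OF abs_ge_self ell2_norm_nonneg[of \<phi>]]
        by (simp add: algebra_simps)
    also have "\<dots> \<le> B * ell2_norm \<phi>" using ell2_norm_nonneg
      by (intro mult_right_mono) (auto simp: B_def)
    finally show ?thesis .
  qed
  have Dc: "c * ell2_norm \<phi> \<le> ell2_norm (D \<phi>)" if "\<phi> \<in> ell2" for \<phi>
    using neg that unfolding D_def[abs_def] H_def by (meson not_le)
  have Dadd: "D (\<lambda>n. f n + g n) = (\<lambda>n. D f n + D g n)" for f g
    by (auto simp: D_def H_def critical_almost_mathieu_def algebra_simps)
  have Dsc: "D (\<lambda>n. a * f n) = (\<lambda>n. a * D f n)" for f a
    by (auto simp: D_def H_def critical_almost_mathieu_def algebra_simps)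
  have Dsub: "D (\<lambda>n. f n - a * g n) = (\<lambda>n. D f n - a * D g n)" for f g a
    by (auto simp: D_def H_def critical_almost_mathieu_def algebra_simps)
  have Dsym: "(\<Sum>\<^sub>\<infinity>n. cnj (\<phi> n) * D (D \<phi>) n) = of_real ((ell2_norm (D \<phi>))\<^sup>2)" if \<phi>: "\<phi> \<in> ell2" for \<phi>
  proof -
    have sym: "(\<Sum>\<^sub>\<infinity>n. cnj (\<phi> n) * D \<psi> n) = (\<Sum>\<^sub>\<infinity>n. cnj (D \<phi> n) * \<psi> n)" if \<psi>: "\<psi> \<in> ell2" for \<psi>
    proof -
      have a: "((\<lambda>n. cnj (\<phi> n) * H \<psi> n) has_sum (\<Sum>\<^sub>\<infinity>n. cnj (\<phi> n) * H \<psi> n)) UNIV"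
        "((\<lambda>n. cnj (H \<phi> n) * \<psi> n) has_sum (\<Sum>\<^sub>\<infinity>n. cnj (\<phi> n) * H \<psi> n)) UNIV"
        "((\<lambda>n. cnj (\<phi> n) * \<psi> n) has_sum (\<Sum>\<^sub>\<infinity>n. cnj (\<phi> n) * \<psi> n)) UNIV"
        using critical_almost_mathieu_symmetric[OF \<phi> \<psi>, of \<alpha> \<theta>, folded H_def]
          has_sum_infsum[OF ell2_mult_summable[OF \<phi> Hell[OF \<psi>]]]
          has_sum_infsum[OF ell2_mult_summable[OF Hell[OF \<phi>] \<psi>]]
          has_sum_infsum[OF ell2_mult_summable[OF \<phi> \<psi>]] by auto
      have "((\<lambda>n. cnj (\<phi> n) * H \<psi> n + (- of_real E) * (cnj (\<phi> n) * \<psi> n)) has_sum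
          ((\<Sum>\<^sub>\<infinity>n. cnj (\<phi> n) * H \<psi> n) + (- of_real E) * (\<Sum>\<^sub>\<infinity>n. cnj (\<phi> n) * \<psi> n))) UNIV"
        by (intro has_sum_add has_sum_cmult_right a)
      moreover have "((\<lambda>n. cnj (H \<phi> n) * \<psi> n + (- of_real E) * (cnj (\<phi> n) * \<psi> n)) has_sum
          ((\<Sum>\<^sub>\<infinity>n. cnj (\<phi> n) * H \<psi> n) + (- of_real E) * (\<Sum>\<^sub>\<infinity>n. cnj (\<phi> n) * \<psi> n))) UNIV"
        by (intro has_sum_add has_sum_cmult_right a)
      ultimately have "(\<Sum>\<^sub>\<infinity>n. cnj (\<phi> n) * H \<psi> n + (- of_real E) * (cnj (\<phi> n) * \<psi> n)) =
          (\<Sum>\<^sub>\<infinity>n. cnj (H \<phi> n) * \<psi> n + (- of_real E) * (cnj (\<phi> n) * \<psi> n))"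
        by (simp only: infsumI)
      moreover have "cnj (\<phi> n) * H \<psi> n + (- of_real E) * (cnj (\<phi> n) * \<psi> n) = cnj (\<phi> n) * D \<psi> n"
        for n
        by (simp add: D_def algebra_simps)
      moreover have "cnj (H \<phi> n) * \<psi> n + (- of_real E) * (cnj (\<phi> n) * \<psi> n) = cnj (D \<phi> n) * \<psi> n"
        for n
        by (simp add: D_def algebra_simps)
      ultimately show ?thesis by (simp only:)
    qed
    show ?thesis unfolding sym[OF Dell[OF \<phi>]] by (rule ell2_inner_self[OF Dell[OF \<phi>]])
  qed
  \<comment> \<open>With this \<open>t\<close> the quadratic term in the expansion of the squared
    norm of K \<phi> is at most half of the cross term, so K = 1 - t D^2 contracts by the ratio
    \<open>r\<close>.\<close>
  define t where "t = 1 / B\<^sup>2"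
  have t: "t > 0" "t * B\<^sup>2 = 1" using B by (auto simp: t_def)
  define K where "K \<phi> n = \<phi> n - of_real t * D (D \<phi>) n" for \<phi> n
  define r where "r = sqrt (1 - t * c\<^sup>2)"
  have tc: "0 < t * c\<^sup>2" "t * c\<^sup>2 \<le> 1"
    using t c B power_mono[of c B 2] mult_left_mono[of "c\<^sup>2" "B\<^sup>2" t] by auto
  have r: "0 \<le> r" "r < 1" using tc by (auto simp: r_def real_sqrt_lt_1_iff)
  have Kell: "K \<phi> \<in> ell2" if "\<phi> \<in> ell2" for \<phi>
    using ell2_add(1)[OF that ell2_scale(1)[OF Dell[OF Dell[OF that]], of "- of_real t"]]
      by (simp add: K_def[abs_def])
  have Kr: "ell2_norm (K \<phi>) \<le> r * ell2_norm \<phi>" if \<phi>: "\<phi> \<in> ell2" for \<phi>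
  proof -
    have "(ell2_norm (K \<phi>))\<^sup>2 = (ell2_norm \<phi>)\<^sup>2 - 2 * t * (ell2_norm (D \<phi>))\<^sup>2
      + t\<^sup>2 * (ell2_norm (D (D \<phi>)))\<^sup>2"
      unfolding K_def[abs_def] using ell2_norm_diff_squared[OF \<phi> Dell[OF Dell[OF \<phi>]], of t] Dsym[OF
        \<phi>] by simp
    also have "t\<^sup>2 * (ell2_norm (D (D \<phi>)))\<^sup>2 \<le> t\<^sup>2 * (B * ell2_norm (D \<phi>))\<^sup>2"
      by (intro mult_left_mono power_mono DB Dell \<phi> ell2_norm_nonneg) auto
    also have "t\<^sup>2 * (B * ell2_norm (D \<phi>))\<^sup>2 = t * (t * B\<^sup>2) * (ell2_norm (D \<phi>))\<^sup>2"
      by (simp add: power_mult_distrib power2_eq_square mult_ac)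
    also have "t * (t * B\<^sup>2) * (ell2_norm (D \<phi>))\<^sup>2 = t * (ell2_norm (D \<phi>))\<^sup>2" unfolding t(2) by simp
    finally have "(ell2_norm (K \<phi>))\<^sup>2 \<le> (ell2_norm \<phi>)\<^sup>2 - t * (ell2_norm (D \<phi>))\<^sup>2" by simp
    moreover have "t * (c * ell2_norm \<phi>)\<^sup>2 \<le> t * (ell2_norm (D \<phi>))\<^sup>2"
      using t c by (intro mult_left_mono power_mono Dc \<phi> mult_nonneg_nonneg ell2_norm_nonneg) auto
    ultimately have "(ell2_norm (K \<phi>))\<^sup>2 \<le> (1 - t * c\<^sup>2) * (ell2_norm \<phi>)\<^sup>2"
      by (simp add: power_mult_distrib algebra_simps)
    also have "\<dots> = (r * ell2_norm \<phi>)\<^sup>2" using tc by (simp add: r_def power_mult_distrib)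
    finally show ?thesis using r ell2_norm_nonneg[of \<phi>] by (rule_tac power2_le_imp_le) auto
  qed
  define P where "P k \<phi> = (K ^^ k) \<phi>" for k \<phi>
  have P0: "P 0 \<phi> = \<phi>" and PS: "P (Suc k) \<phi> = K (P k \<phi>)" for k \<phi> by (simp_all add: P_def)
  have Pell: "P k \<phi> \<in> ell2" if "\<phi> \<in> ell2" for k \<phi>
    by (induction k) (simp_all add: P0 PS that Kell)
  have Pr: "ell2_norm (P k \<phi>) \<le> ell2_norm \<phi> * r ^ k" if \<phi>: "\<phi> \<in> ell2" for k \<phi>
  proof (induction k)
    case (Suc k)
    have "ell2_norm (P (Suc k) \<phi>) \<le> r * ell2_norm (P k \<phi>)" unfolding PS by (rule Kr[OF Pell[OF \<phi>]])
    also have "\<dots> \<le> r * (ell2_norm \<phi> * r ^ k)" using Suc r by (intro mult_left_mono)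
    finally show ?case by (simp add: mult_ac)
  qed (simp add: P0)
  define S where "S \<phi> n = (\<Sum>k. P k \<phi> n)" for \<phi> n
  note geo = ell2_geometric_series[OF Pell Pr r ell2_norm_nonneg]
  have sm: "summable (\<lambda>k. P k \<phi> n)" if "\<phi> \<in> ell2" for \<phi> n using geo(1)[OF that that] .
  have Sell: "S \<phi> \<in> ell2" and Sle: "ell2_norm (S \<phi>) \<le> ell2_norm \<phi> / (1 - r)" if "\<phi> \<in> ell2" for \<phi>
    using geo(2,3)[OF that that] by (simp_all add: S_def[abs_def])
  \<comment> \<open>Each value of \<open>D\<close> involves three sites only, so \<open>D\<close>
    commutes with pointwise convergent series.\<close>
  have Dsum: "summable (\<lambda>k. D (f k) n) \<and> D (\<lambda>n. \<Sum>k. f k n) n = (\<Sum>k. D (f k) n)"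
    if "\<And>n. summable (\<lambda>k. f k n)" for f :: "nat \<Rightarrow> int \<Rightarrow> complex" and n
  proof -
    have "(\<lambda>k. f k (n - 1) + f k (n + 1) + complex_of_real (2 * cos (2 * pi * (\<alpha> * of_int n
      + \<theta>))) * f k n - of_real E * f k n)
      sums ((\<Sum>k. f k (n - 1)) + (\<Sum>k. f k (n + 1)) + complex_of_real (2 * cos (2 * pi * (\<alpha> * of_int n
        + \<theta>))) * (\<Sum>k. f k n) - of_real E * (\<Sum>k. f k n))"
      by (intro sums_add sums_diff sums_mult summable_sums that)
    then show ?thesis unfolding D_def H_def critical_almost_mathieu_def by (auto simp: sums_iff)
  qed
  have DDS: "of_real t * D (D (S \<phi>)) n = \<phi> n" if \<phi>: "\<phi> \<in> ell2" for \<phi> n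
  proof -
    have D1: "D (S \<phi>) = (\<lambda>n. \<Sum>k. D (P k \<phi>) n)" "summable (\<lambda>k. D (P k \<phi>) n)" for n
      using Dsum[of "\<lambda>k. P k \<phi>"] sm[OF \<phi>] by (auto simp: S_def[abs_def])
    have D2: "D (D (S \<phi>)) n = (\<Sum>k. D (D (P k \<phi>)) n)" "summable (\<lambda>k. D (D (P k \<phi>)) n)"
      using Dsum[of "\<lambda>k. D (P k \<phi>)" n] D1 by auto
    \<comment> \<open>Successive powers of K differ by - t D^2 K^k, so the series for t D^2 S
      telescopes.\<close>
    have "(\<lambda>k. P (Suc k) \<phi> n - P k \<phi> n) sums (0 - P 0 \<phi> n)"
      by (rule telescope_sums) (rule summable_LIMSEQ_zero[OF sm[OF \<phi>]])
    moreover have "P (Suc k) \<phi> n - P k \<phi> n = - (of_real t * D (D (P k \<phi>)) n)" for k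
      by (simp add: PS K_def)
    ultimately have "(\<lambda>k. - (of_real t * D (D (P k \<phi>)) n)) sums (- \<phi> n)" by (simp add: P0)
    then have "(\<lambda>k. of_real t * D (D (P k \<phi>)) n) sums \<phi> n" using sums_minus by fastforce
    moreover have "(\<lambda>k. of_real t * D (D (P k \<phi>)) n) sums (of_real t * D (D (S \<phi>)) n)"
      unfolding D2(1) by (intro sums_mult summable_sums D2(2))
    ultimately show ?thesis using sums_unique2 by blast
  qed
  have PD: "P k (D \<phi>) = D (P k \<phi>)" for k \<phi>
  proof (induction k)
    case (Suc k)
    have "K (D f) = D (K f)" for f unfolding K_def[abs_def] Dsub ..
    then show ?case unfolding PS Suc .
  qed (simp add: P0)
  have SD: "S (D \<phi>) = D (S \<phi>)" if \<phi>: "\<phi> \<in> ell2" for \<phi>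
    using Dsum[of "\<lambda>k. P k \<phi>"] sm[OF \<phi>] by (auto simp: S_def[abs_def] PD)
  \<comment> \<open>As \<open>S\<close> commutes with \<open>D\<close> and t D^2 S = 1, this is a
    two-sided inverse of \<open>D\<close>.\<close>
  define R where "R \<phi> n = of_real t * D (S \<phi>) n" for \<phi> n
  have Rell: "R \<phi> \<in> ell2" if "\<phi> \<in> ell2" for \<phi>
    using ell2_scale(1)[OF Dell[OF Sell[OF that]]] by (simp add: R_def[abs_def])
  have RB: "ell2_norm (R \<phi>) \<le> t * (B * (1 / (1 - r))) * ell2_norm \<phi>" if \<phi>: "\<phi> \<in> ell2" for \<phi>
  proof -
    have "ell2_norm (R \<phi>) = t * ell2_norm (D (S \<phi>))"
      using ell2_scale(2)[OF Dell[OF Sell[OF \<phi>]], of "of_real t"] t by (simp add: R_def[abs_def])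
    also have "\<dots> \<le> t * (B * (ell2_norm \<phi> / (1 - r)))"
      using DB[OF Sell[OF \<phi>]] mult_left_mono[OF Sle[OF \<phi>], of B] t B
        by (intro mult_left_mono) linarith+
    finally show ?thesis by simp
  qed
  have Padd: "P k (\<lambda>n. f n + g n) = (\<lambda>n. P k f n + P k g n)" for k f g
    by (induction k) (simp_all add: P0 PS K_def[abs_def] Dadd algebra_simps)
  have Psc: "P k (\<lambda>n. a * f n) = (\<lambda>n. a * P k f n)" for k a f
    by (induction k) (simp_all add: P0 PS K_def[abs_def] Dsc algebra_simps)
  have Radd: "R (\<lambda>n. f n + g n) = (\<lambda>n. R f n + R g n)" if "f \<in> ell2" "g \<in> ell2" for f g
  proof -
    have "S (\<lambda>n. f n + g n) = (\<lambda>n. S f n + S g n)"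
      unfolding S_def[abs_def] Padd using sm that by (auto simp: suminf_add)
    then show ?thesis by (simp add: R_def[abs_def] Dadd algebra_simps)
  qed
  have Rsc: "R (\<lambda>n. a * f n) = (\<lambda>n. a * R f n)" if "f \<in> ell2" for f a
  proof -
    have "S (\<lambda>n. a * f n) = (\<lambda>n. a * S f n)"
      unfolding S_def[abs_def] Psc using sm that by (auto simp: suminf_mult)
    then show ?thesis by (simp add: R_def[abs_def] Dsc algebra_simps)
  qed
  have "bounded_operator R"
    unfolding bounded_operator_def using Rell RB Radd Rsc by blast
  moreover have "R (D \<phi>) = \<phi>" if "\<phi> \<in> ell2" for \<phi>
    using DDS[OF that] by (auto simp: R_def[abs_def] SD[OF that])
  moreover have "D (R \<phi>) = \<phi>" if "\<phi> \<in> ell2" for \<phi>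
    using DDS[OF that] by (auto simp: R_def[abs_def] Dsc)
  ultimately show False
    using spec unfolding spectrum_def D_def[abs_def] H_def by blast
qed

text \<open>The strict inequality for a square-summable approximate eigenvector leaves room for
  cutting off its tail.\<close>

lemma spectrum_finite_approximate_eigenvector:
  fixes \<alpha> \<theta> E \<epsilon> :: real
  assumes spec: "complex_of_real E \<in> spectrum (critical_almost_mathieu \<alpha> \<theta>)" and \<epsilon>: "\<epsilon> > 0"
  obtains A :: int and \<phi> where "\<And>n. \<bar>n\<bar> \<ge> A \<Longrightarrow> \<phi> n = 0" "\<phi> \<noteq> (\<lambda>n. 0)"
    "(\<Sum>n\<in>{-A..A}. (cmod (critical_almost_mathieu \<alpha> \<theta> \<phi> n - of_real E * \<phi> n))\<^sup>2)
      \<le> \<epsilon> * (\<Sum>n\<in>{-A..A}. (cmod (\<phi> n))\<^sup>2)"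
proof -
  define c where "c = sqrt \<epsilon>"
  have c: "c > 0" "c\<^sup>2 = \<epsilon>" using \<epsilon> by (auto simp: c_def)
  define D where "D \<phi> n = critical_almost_mathieu \<alpha> \<theta> \<phi> n - of_real E * \<phi> n" for \<phi> n
  obtain \<psi> where \<psi>: "\<psi> \<in> ell2" "ell2_norm (D \<psi>) < c * ell2_norm \<psi>"
    using spectrum_approximate_eigenvector[OF spec c(1)] unfolding D_def[abs_def] by blast
  obtain C where HC: "\<And>\<phi>. \<phi> \<in> ell2 \<Longrightarrow> critical_almost_mathieu \<alpha> \<theta> \<phi> \<in> ell2"
    "\<And>\<phi>. \<phi> \<in> ell2 \<Longrightarrow> ell2_norm (critical_almost_mathieu \<alpha> \<theta> \<phi>) \<le> C * ell2_norm \<phi>"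
    using bounded_operator_critical_almost_mathieu[of \<alpha> \<theta>] unfolding bounded_operator_def by blast
  define B where "B = \<bar>C\<bar> + \<bar>E\<bar>"
  have D: "D \<phi> \<in> ell2" "ell2_norm (D \<phi>) \<le> B * ell2_norm \<phi>" if \<phi>: "\<phi> \<in> ell2" for \<phi>
  proof -
    show "D \<phi> \<in> ell2" using ell2_add(1)[OF HC(1)[OF \<phi>] ell2_scale(1)[OF \<phi>, of "- of_real E"]]
      by (simp add: D_def[abs_def])
    have "ell2_norm (D \<phi>) \<le> ell2_norm (critical_almost_mathieu \<alpha> \<theta> \<phi>) + \<bar>E\<bar> * ell2_norm \<phi>"
      using ell2_add(2)[OF HC(1)[OF \<phi>] ell2_scale(1)[OF \<phi>, of "- of_real E"]] ell2_scale(2)[OF \<phi>, of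
        "- of_real E"]
      by (simp add: D_def[abs_def])
    then show "ell2_norm (D \<phi>) \<le> B * ell2_norm \<phi>"
      using HC(2)[OF \<phi>] mult_right_mono[of C "\<bar>C\<bar>", OF abs_ge_self ell2_norm_nonneg[of \<phi>]]
        by (simp add: B_def algebra_simps)
  qed
  \<comment> \<open>A tail of norm at most \<delta> costs at most B \<delta> in the residual and c
    \<delta> on the other side; the extra 1 keeps the sum strictly below the gap.\<close>
  define \<delta> where "\<delta> = (c * ell2_norm \<psi> - ell2_norm (D \<psi>)) / (B + c + 1)"
  have Bc: "B + c + 1 > 0" "B \<ge> 0" using c by (auto simp: B_def)
  have \<delta>: "\<delta> > 0" using \<psi>(2) Bc by (simp add: \<delta>_def)
  have \<delta>2: "(B + c) * \<delta> < c * ell2_norm \<psi> - ell2_norm (D \<psi>)"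
  proof -
    have "(B + c) * \<delta> < (B + c + 1) * \<delta>" using \<delta> by (simp add: algebra_simps)
    also have "\<dots> = c * ell2_norm \<psi> - ell2_norm (D \<psi>)" using Bc by (simp add: \<delta>_def)
    finally show ?thesis .
  qed
  have "((\<lambda>n. (cmod (\<psi> n))\<^sup>2) has_sum (ell2_norm \<psi>)\<^sup>2) UNIV"
    unfolding ell2_norm_squared using \<psi>(1) by (intro has_sum_infsum) (simp add: ell2_def)
  then obtain F where F: "finite F" "dist (\<Sum>n\<in>F. (cmod (\<psi> n))\<^sup>2) ((ell2_norm \<psi>)\<^sup>2) \<le> \<delta>\<^sup>2"
    using has_sum_finite_approximation[of "\<lambda>n. (cmod (\<psi> n))\<^sup>2" UNIV "(ell2_norm \<psi>)\<^sup>2" "\<delta>\<^sup>2"] \<delta>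
      by auto
  obtain A :: int where A: "\<And>n. n \<in> F \<Longrightarrow> \<bar>n\<bar> < A"
  proof -
    have "\<bar>n\<bar> < Max (abs ` insert 0 F) + 1" if "n \<in> F" for n
      using F(1) that by (intro zle_add1_eq_le[THEN iffD2] Max_ge) auto
    then show thesis by (rule that)
  qed
  define \<phi> where "\<phi> n = (if \<bar>n\<bar> < A then \<psi> n else 0)" for n
  define \<rho> where "\<rho> n = (if \<bar>n\<bar> < A then 0 else \<psi> n)" for n
  have rho: "L2_set (\<lambda>n. cmod (\<rho> n)) G \<le> \<delta>" if G: "finite G" for G
  proof -
    have "(\<Sum>n\<in>F. (cmod (\<psi> n))\<^sup>2) + (\<Sum>n\<in>G. (cmod (\<rho> n))\<^sup>2) \<le> (ell2_norm \<psi>)\<^sup>2"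
    proof -
      have "(\<Sum>n\<in>G. (cmod (\<rho> n))\<^sup>2) = (\<Sum>n\<in>G - F. (cmod (\<rho> n))\<^sup>2)"
        using G A by (intro sum.mono_neutral_right) (auto simp: \<rho>_def)
      also have "\<dots> \<le> (\<Sum>n\<in>G - F. (cmod (\<psi> n))\<^sup>2)" by (intro sum_mono) (auto simp: \<rho>_def)
      finally have "(\<Sum>n\<in>F. (cmod (\<psi> n))\<^sup>2) + (\<Sum>n\<in>G. (cmod (\<rho> n))\<^sup>2)
        \<le> (\<Sum>n\<in>F \<union> (G - F). (cmod (\<psi> n))\<^sup>2)"
        using F(1) G by (subst sum.union_disjoint) auto
      also have "\<dots> \<le> (ell2_norm \<psi>)\<^sup>2"
        unfolding ell2_norm_squared using \<psi>(1) F(1) G by (intro finite_sum_le_infsum) (auto simp: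
          ell2_def)
      finally show ?thesis .
    qed
    then have "(\<Sum>n\<in>G. (cmod (\<rho> n))\<^sup>2) \<le> \<delta>\<^sup>2" using F(2) by (simp add: dist_real_def abs_le_iff)
    then show ?thesis unfolding L2_set_def using \<delta> by (intro real_le_lsqrt) auto
  qed
  have \<rho>: "\<rho> \<in> ell2" "ell2_norm \<rho> \<le> \<delta>" using ell2I[OF rho] by auto
  have \<rho>': "(\<lambda>n. - 1 * \<rho> n) \<in> ell2" "ell2_norm (\<lambda>n. - 1 * \<rho> n) \<le> \<delta>"
    using ell2_scale[OF \<rho>(1), of "- 1"] \<rho>(2) by auto
  have \<phi>eq: "\<phi> = (\<lambda>n. \<psi> n + - 1 * \<rho> n)" by (auto simp: \<phi>_def \<rho>_def)
  have \<phi>ell: "\<phi> \<in> ell2" unfolding \<phi>eq by (rule ell2_add(1)[OF \<psi>(1) \<rho>'(1)])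
  have "ell2_norm (D \<phi>) \<le> ell2_norm (D \<psi>) + B * \<delta>"
  proof -
    have "D \<phi> = (\<lambda>n. D \<psi> n + D (\<lambda>n. - 1 * \<rho> n) n)"
      unfolding \<phi>eq by (auto simp: D_def critical_almost_mathieu_def algebra_simps)
    then have "ell2_norm (D \<phi>) \<le> ell2_norm (D \<psi>) + ell2_norm (D (\<lambda>n. - 1 * \<rho> n))"
      using ell2_add(2)[OF D(1)[OF \<psi>(1)] D(1)[OF \<rho>'(1)]] by simp
    moreover have "ell2_norm (D (\<lambda>n. - 1 * \<rho> n)) \<le> B * \<delta>"
      using D(2)[OF \<rho>'(1)] mult_left_mono[OF \<rho>'(2) Bc(2)] by linarith
    ultimately show ?thesis by linarith
  qed
  moreover have "ell2_norm \<psi> \<le> ell2_norm \<phi> + \<delta>"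
  proof -
    have "\<psi> = (\<lambda>n. \<phi> n + \<rho> n)" by (auto simp: \<phi>_def \<rho>_def)
    then show ?thesis using ell2_add(2)[OF \<phi>ell \<rho>(1)] \<rho>(2) by simp
  qed
  then have "c * ell2_norm \<psi> \<le> c * ell2_norm \<phi> + c * \<delta>"
    using c by (metis distrib_left less_imp_le mult_left_mono)
  ultimately have lt: "ell2_norm (D \<phi>) < c * ell2_norm \<phi>" using \<delta>2 by (simp add: algebra_simps)
  have \<phi>fin: "ell2_norm \<phi> \<le> L2_set (\<lambda>n. cmod (\<phi> n)) {-A..A}"
  proof (rule ell2I(2))
    fix G :: "int set" assume G: "finite G"
    have "(\<Sum>n\<in>G. (cmod (\<phi> n))\<^sup>2) = (\<Sum>n\<in>G \<inter> {-A..A}. (cmod (\<phi> n))\<^sup>2)"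
      using G by (intro sum.mono_neutral_right) (auto simp: \<phi>_def)
    also have "\<dots> \<le> (\<Sum>n\<in>{-A..A}. (cmod (\<phi> n))\<^sup>2)" by (intro sum_mono2) auto
    finally show "L2_set (\<lambda>n. cmod (\<phi> n)) G \<le> L2_set (\<lambda>n. cmod (\<phi> n)) {-A..A}"
      unfolding L2_set_def by simp
  qed
  have "L2_set (\<lambda>n. cmod (D \<phi> n)) {-A..A} \<le> c * L2_set (\<lambda>n. cmod (\<phi> n)) {-A..A}"
    using ell2_finite_le[OF D(1)[OF \<phi>ell] finite_atLeastAtMost_int, of "-A" A] lt mult_left_mono[OF
      \<phi>fin less_imp_le[OF c(1)]] by linarith
  then have "(L2_set (\<lambda>n. cmod (D \<phi> n)) {-A..A})\<^sup>2 \<le> (c * L2_set (\<lambda>n. cmod (\<phi> n)) {-A..A})\<^sup>2"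
    by (intro power_mono) auto
  then have sq: "(\<Sum>n\<in>{-A..A}. (cmod (D \<phi> n))\<^sup>2) \<le> \<epsilon> * (\<Sum>n\<in>{-A..A}. (cmod (\<phi> n))\<^sup>2)"
    by (simp add: L2_set_def power_mult_distrib c(2) sum_nonneg)
  have "\<phi> \<noteq> (\<lambda>n. 0)"
  proof
    assume "\<phi> = (\<lambda>n. 0)"
    then have "ell2_norm \<phi> = 0" by (simp add: ell2_norm_def)
    then show False using lt ell2_norm_nonneg[of "D \<phi>"] by simp
  qed
  then show thesis using that[of A \<phi>] sq by (simp add: \<phi>_def D_def)
qed

section \<open>Covering the spectrum\<close>

lemma hop_shift: "hop \<alpha> y (s + c) = hop \<alpha> (y + \<alpha> * of_int c) s"
  unfolding hop_def by (simp add: algebra_simps)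

lemma hop_periodic:
  assumes "q > 0"
  shows "hop (of_int p / of_nat q) y (s + int q) = hop (of_int p / of_nat q) y s"
proof -
  have "cis (- 2 * pi * (y + of_int p / of_nat q * of_int (s + int q)))
      = cis (- 2 * pi * (y + of_int p / of_nat q * of_int s)) * cis (2 * pi * of_int (- p))"
    unfolding cis_mult using assms by (intro arg_cong[of _ _ cis]) (simp add: field_simps)
  also have "cis (2 * pi * of_int (- p)) = 1" by (rule cis_multiple_2pi) auto
  finally show ?thesis by (simp add: hop_def)
qed

lemma hop_eq_power:
  "hop (of_int p / of_nat q) y (int k) = 1 + cis (- 2 * pi * (of_int p / of_nat q)) ^ k * cis (- 2 *
    pi * y)"
  unfolding hop_def Complex.DeMoivre cis_mult by (simp add: algebra_simps)

lemma cis_eq_1_iff: "cis t = 1 \<longleftrightarrow> (\<exists>m::int. t = of_int m * (2 * pi))"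
proof
  assume "cis t = 1"
  then have "cos t = 1" by (metis cis.sel(1) one_complex.sel(1))
  then show "\<exists>m::int. t = of_int m * (2 * pi)" by (auto simp: cos_one_2pi_int mult_ac)
next
  assume "\<exists>m::int. t = of_int m * (2 * pi)"
  then obtain m :: int where "t = 2 * pi * of_int m" by (auto simp: mult_ac)
  then show "cis t = 1" by (simp add: cis_multiple_2pi)
qed

lemma rational_rotation_primitive:
  assumes "q > 0" "coprime p (int q)"
  defines "w \<equiv> cis (- 2 * pi * (of_int p / of_nat q))"
  shows "cmod w = 1" "w ^ q = 1" "\<And>k. 0 < k \<Longrightarrow> k < q \<Longrightarrow> w ^ k \<noteq> 1"
proof -
  show "cmod w = 1" by (simp add: w_def)
  have "w ^ q = cis (of_int (- p) * (2 * pi))"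
    unfolding w_def Complex.DeMoivre using assms(1) by (intro arg_cong[of _ _ cis]) simp
  then show "w ^ q = 1" using cis_eq_1_iff by metis
  fix k assume k: "0 < k" "k < q"
  show "w ^ k \<noteq> 1"
  proof
    assume "w ^ k = 1"
    then obtain m :: int where "of_nat k * (- 2 * pi * (of_int p / of_nat q)) = of_int m * (2 * pi)"
      unfolding w_def Complex.DeMoivre cis_eq_1_iff by blast
    then have "pi * (of_int (- p) * of_nat k) = pi * (of_int m * real q)" using assms(1)
      by (simp add: field_simps)
    then have "of_int (- p) * of_nat k = of_int m * real q" using pi_neq_zero mult_left_cancel
      by blast
    then have "- p * int k = m * int q" by (metis of_int_eq_iff of_int_mult of_int_of_nat_eq)
    then have "int q dvd p * int k" by (metis dvd_triv_right dvd_minus_iff minus_mult_left)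
    then have "int q dvd int k" using assms(2)
      by (simp add: coprime_commute coprime_dvd_mult_right_iff)
    then show False using k by (simp add: dvd_imp_le nat_dvd_not_less)
  qed
qed

lemma prefix_sum_exists:
  fixes w :: "int \<Rightarrow> real"
  obtains W where "\<And>s. W s - W (s - 1) = w s" "\<And>t k. (\<Sum>r\<in>{1..int k}. w (t + r))
    = W (t + int k) - W t"
proof -
  \<comment> \<open>For every s at least one of the two index ranges is empty.\<close>
  define W where "W s = (\<Sum>r\<in>{1..s}. w r) - (\<Sum>r\<in>{s+1..0}. w r)" for s
  have W: "W s - W (s - 1) = w s" for s
  proof (cases "s \<ge> 1")
    case True
    then have "{1..s} = insert s {1..s - 1}" by auto
    then show ?thesis using True by (simp add: W_def)
  next
    case False
    then have "{s - 1 + 1..0} = insert s {s + 1..0}" by auto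
    then show ?thesis using False by (simp add: W_def)
  qed
  have "(\<Sum>r\<in>{1..int k}. w (t + r)) = W (t + int k) - W t" for t k
  proof (induction k)
    case (Suc k)
    have "{1..int (Suc k)} = insert (int k + 1) {1..int k}" by auto
    then show ?case using Suc W[of "t + int k + 1"] by (simp add: algebra_simps)
  qed simp
  with W show thesis by (rule that)
qed

text \<open>\<open>W\<close> is a discrete primitive of the regularized inverse hopping terms, so it
  grows by at least B = n L / 9 over each block of n sites. A cutoff of width 2 h in
  \<open>W\<close> therefore meets fewer than 2 h / B full blocks, that is 18 h / L sites, plus one
  incomplete block.\<close>

lemma localized_approximate_eigenvector:
  fixes \<alpha> \<theta> E h :: real and p :: int and n q :: nat
  assumes spec: "complex_of_real E \<in> spectrum (critical_almost_mathieu \<alpha> \<theta>)"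
    and n: "n > 0" and cop: "coprime p (int n)" and app: "\<bar>\<alpha> - of_int p / of_nat n\<bar>
      \<le> 1 / (of_nat n)\<^sup>2"
    and h: "h > 0" and L: "L = (\<Sum>i<n. 1 / (real i + 2))"
    and K: "18 * h / L + of_nat n \<le> of_nat K" and Kq: "K + 3 \<le> q"
  obtains y g where "\<And>s. g s \<noteq> 0 \<Longrightarrow> 1 \<le> s \<and> s \<le> int K + 1"
    "(\<Sum>s\<in>{0..<int q}. (cmod (chiral (hop \<alpha> y) g s - of_real E * g s))\<^sup>2)
      < (10 / h)\<^sup>2 * (\<Sum>s\<in>{0..<int q}. (cmod (g s))\<^sup>2)"
proof -
  \<comment> \<open>The gauge change multiplies \<epsilon> by 4 and the localization by another 16,
    which gives 32 / h^2; with the commutator term 64 / h^2 this stays below (10 / h)^2.\<close>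
  define \<epsilon> where "\<epsilon> = 1 / (2 * h\<^sup>2)"
  have \<epsilon>: "\<epsilon> > 0" using h by (simp add: \<epsilon>_def)
  obtain A \<phi> where A: "\<And>n. \<bar>n\<bar> \<ge> A \<Longrightarrow> \<phi> n = 0" "\<phi> \<noteq> (\<lambda>n. 0)"
    "(\<Sum>n\<in>{-A..A}. (cmod (critical_almost_mathieu \<alpha> \<theta> \<phi> n - of_real E * \<phi> n))\<^sup>2)
      \<le> \<epsilon> * (\<Sum>n\<in>{-A..A}. (cmod (\<phi> n))\<^sup>2)"
    by (rule spectrum_finite_approximate_eigenvector[OF spec \<epsilon>]) (rule that; (assumption | simp))
  obtain y f M where f: "\<And>s. \<bar>s\<bar> \<ge> M \<Longrightarrow> f s = 0"
    "(\<Sum>s\<in>{-M..M}. (cmod (chiral (hop \<alpha> y) f s - of_real E * f s))\<^sup>2)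
      < 4 * \<epsilon> * (\<Sum>s\<in>{-M..M}. (cmod (f s))\<^sup>2)"
    by (rule chiral_approximate_eigenvector[where A = A and \<phi> = \<phi> and \<epsilon> = \<epsilon>])
      ((rule A(1), assumption) | rule A(2,3) \<epsilon> | (rule that; (assumption | simp)))+
  have f0: "f \<noteq> (\<lambda>s. 0)"
  proof
    assume "f = (\<lambda>s. 0)"
    then show False using f(2) by (simp add: chiral_def)
  qed
  \<comment> \<open>The summand 1/n keeps the increments finite where a hopping term
    vanishes.\<close>
  define w where "w s = 1 / (cmod (hop \<alpha> y s) + 1 / of_nat n)" for s
  have wpos: "w s > 0" for s using n by (simp add: w_def add_nonneg_pos)
  have wc: "cmod (hop \<alpha> y s) * w s \<le> 1" for s
    using n by (simp add: w_def divide_simps add_nonneg_pos)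
  obtain W where W: "\<And>s. W s - W (s - 1) = w s" "\<And>t k. (\<Sum>r\<in>{1..int k}. w (t + r))
    = W (t + int k) - W t"
    by (rule prefix_sum_exists[of w]) (rule that; assumption)
  define B where "B = of_nat n / 9 * L"
  have block: "W (t + int n) - W t \<ge> B" for t
    using inverse_hop_sum_ge[OF n cop app, of y t] W(2)[of t n] unfolding B_def L w_def by simp
  have Lpos: "L > 0" unfolding L using n by (intro sum_pos) auto
  then have Bpos: "B > 0" using n by (simp add: B_def)
  have Wmono: "W s \<le> W (s + int k)" for s k
  proof -
    have "0 \<le> (\<Sum>r\<in>{1..int k}. w (s + r))" using wpos by (intro sum_nonneg) (simp add: less_imp_le)
    then show ?thesis using W(2)[of s k] by simp
  qed
  have blocks: "W (t + int (m * n)) - W t \<ge> of_nat m * B" for t m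
  proof (induction m)
    case (Suc m)
    show ?case using Suc block[of "t + int (m * n)"] by (simp add: algebra_simps)
  qed simp
  obtain j :: int where j: "(\<Sum>s\<in>{-M..M}. (cmod (chiral (hop \<alpha> y) (\<lambda>s. of_real (hat (W s / h - of_int
    j)) * f s) s
        - of_real E * (of_real (hat (W s / h - of_int j)) * f s)))\<^sup>2)
      < (16 * (4 * \<epsilon>) + 64 / h\<^sup>2) * (\<Sum>s\<in>{-M..M}. (cmod (of_real (hat (W s / h - of_int j)) * f
      s))\<^sup>2)"
  proof (rule localize_approximate_eigenvector[of M f "4 * \<epsilon>" h "hop \<alpha> y" W E])
    show "cmod (hop \<alpha> y s) * \<bar>W s - W (s - 1)\<bar> \<le> 1" for s
      using wc[of s] wpos[of s] unfolding W(1) by simp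
  qed (use f f0 \<epsilon> h in auto)
  define g where "g s = of_real (hat (W s / h - of_int j)) * f s" for s
  define G where "G s = chiral (hop \<alpha> y) g s - of_real E * g s" for s
  have gM: "g s = 0" if "\<bar>s\<bar> \<ge> M" for s using f(1)[OF that] by (simp add: g_def)
  have lt: "(\<Sum>s\<in>{-M..M}. (cmod (G s))\<^sup>2) < (10 / h)\<^sup>2 * (\<Sum>s\<in>{-M..M}. (cmod (g s))\<^sup>2)"
  proof -
    have "16 * (4 * \<epsilon>) + 64 / h\<^sup>2 = 96 / h\<^sup>2" using h by (simp add: \<epsilon>_def field_simps)
    then have "(\<Sum>s\<in>{-M..M}. (cmod (G s))\<^sup>2) < 96 / h\<^sup>2 * (\<Sum>s\<in>{-M..M}. (cmod (g s))\<^sup>2)"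
      using j by (simp add: G_def g_def[abs_def])
    also have "\<dots> \<le> (10 / h)\<^sup>2 * (\<Sum>s\<in>{-M..M}. (cmod (g s))\<^sup>2)"
      by (intro mult_right_mono sum_nonneg) (auto simp: power_divide divide_right_mono)
    finally show ?thesis .
  qed
  have diam: "t - s \<le> int K" if "g s \<noteq> 0" "g t \<noteq> 0" "s \<le> t" for s t
  proof -
    have "\<bar>W s / h - of_int j\<bar> < 1" "\<bar>W t / h - of_int j\<bar> < 1"
      using that by (auto simp: g_def hat_def max_def split: if_splits)
    then have "W t / h - W s / h < 2" by linarith
    then have Wd: "W t - W s < 2 * h" using h by (simp add: field_simps)
    define k where "k = nat (t - s)"
    have k: "t = s + int k" using that by (simp add: k_def)
    define m where "m = k div n"
    have "m * n \<le> k" unfolding m_def by (rule div_times_less_eq_dividend)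
    then have "W (s + int (m * n)) \<le> W t"
      using Wmono[of "s + int (m * n)" "k - m * n"] k by (simp add: of_nat_diff)
    then have "of_nat m * B < 2 * h" using blocks[of m s] Wd by linarith
    then have "of_nat m < 2 * h / B" using Bpos by (simp add: field_simps)
    moreover have "of_nat n * (2 * h / B) = 18 * h / L" using n Lpos
      by (simp add: B_def field_simps)
    ultimately have "of_nat n * of_nat m \<le> 18 * h / L"
      by (metis less_imp_le mult_left_mono of_nat_0_le_iff)
    moreover have "real k \<le> of_nat n * of_nat m + of_nat n"
    proof -
      have "k = m * n + k mod n" unfolding m_def by simp
      moreover have "k mod n < n" using n by simp
      ultimately have "k \<le> n * m + n" by (simp add: mult.commute)
      then show ?thesis by (metis of_nat_add of_nat_le_iff of_nat_mult)
    qed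
    ultimately have "real k \<le> real K" using K by linarith
    then show ?thesis using k by simp
  qed
  have "\<exists>s. g s \<noteq> 0"
  proof (rule ccontr)
    assume "\<not> ?thesis"
    then show False using lt by (simp add: G_def chiral_def)
  qed
  then obtain s0 where s0: "g s0 \<noteq> 0" by blast
  have finsupp: "finite {s. g s \<noteq> 0}"
    by (rule finite_subset[of _ "{-M..M}"]) (use gM in \<open>auto, force+\<close>)
  define s1 where "s1 = Min {s. g s \<noteq> 0}"
  have s1: "g s1 \<noteq> 0" unfolding s1_def using Min_in[OF finsupp] s0 by blast
  have s1min: "s1 \<le> s" if "g s \<noteq> 0" for s unfolding s1_def using Min_le[OF finsupp] that by blast
  \<comment> \<open>The translated support starts at 1, so site 0 and, by
    \<open>K + 3 \<le> q\<close>, site q - 1 stay free, and the residual lies within one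
    period.\<close>
  define c where "c = s1 - 1"
  have gsupp: "1 \<le> s \<and> s \<le> int K + 1" if "g (s + c) \<noteq> 0" for s
    using s1min[OF that] diam[OF s1 that] by (auto simp: c_def)
  have gbox: "g s = 0" if "s - c < 1 \<or> s - c > int K + 1" for s
    using gsupp[of "s - c"] that by fastforce
  have Gbox: "G s = 0" if "s \<notin> {c..<c + int q}" for s
  proof -
    have "g s = 0" "g (s - 1) = 0" "g (s + 1) = 0" using that Kq by (auto intro!: gbox)
    then show ?thesis by (simp add: G_def chiral_def)
  qed
  have GM: "G s = 0" if "s \<notin> {-M..M}" for s
  proof -
    have "g s = 0" "g (s - 1) = 0" "g (s + 1) = 0" using that by (auto intro!: gM)
    then show ?thesis by (simp add: G_def chiral_def)
  qed
  have move: "(\<Sum>s\<in>{-M..M}. F s) = (\<Sum>s\<in>{0..<int q}. F (s + c))"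
    if "\<And>s. s \<notin> {c..<c + int q} \<Longrightarrow> F s = 0" "\<And>s. s \<notin> {-M..M} \<Longrightarrow> F s = 0" for F :: "int \<Rightarrow> real"
  proof -
    have "(\<Sum>s\<in>{-M..M}. F s) = (\<Sum>s\<in>{-M..M} \<inter> {c..<c + int q}. F s)"
      using that(1) by (intro sum.mono_neutral_right) blast+
    also have "\<dots> = (\<Sum>s\<in>{c..<c + int q}. F s)"
      using that(2) by (intro sum.mono_neutral_left) blast+
    also have "\<dots> = (\<Sum>s\<in>{0..<int q}. F (s + c))"
      by (rule sum.reindex_bij_witness[of _ "\<lambda>s. s + c" "\<lambda>s. s - c"]) auto
    finally show ?thesis .
  qed
  have moveG: "(\<Sum>s\<in>{-M..M}. (cmod (G s))\<^sup>2) = (\<Sum>s\<in>{0..<int q}. (cmod (G (s + c)))\<^sup>2)"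
    by (rule move) (simp_all add: Gbox GM del: atLeastLessThan_iff atLeastAtMost_iff)
  have moveg: "(\<Sum>s\<in>{-M..M}. (cmod (g s))\<^sup>2) = (\<Sum>s\<in>{0..<int q}. (cmod (g (s + c)))\<^sup>2)"
  proof (rule move)
    fix s
    show "(cmod (g s))\<^sup>2 = 0" if "s \<notin> {c..<c + int q}" using gbox[of s] that Kq by auto
    show "(cmod (g s))\<^sup>2 = 0" if "s \<notin> {-M..M}" using gM[of s] that by auto
  qed
  have Gs: "G (s + c) = chiral (hop \<alpha> (y + \<alpha> * of_int c)) (\<lambda>s. g (s + c)) s - of_real E * g (s + c)"
    for s
    unfolding G_def chiral_def hop_shift[symmetric] by (simp add: algebra_simps)
  show thesis
    by (rule that[of "\<lambda>s. g (s + c)" "y + \<alpha> * of_int c"]) (use gsupp lt in \<open>simp_all add: moveG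
      moveg Gs\<close>)
qed

lemma chiral_perturbation:
  fixes a b g :: "int \<Rightarrow> complex"
  assumes \<kappa>: "\<And>s. s \<in> {0..int q} \<Longrightarrow> cmod (a s - b s) \<le> \<kappa>" and supp: "\<And>s. g s \<noteq> 0 \<Longrightarrow> 1 \<le> s \<and> s
    \<le> int q - 2"
  shows "(\<Sum>s\<in>{0..<int q}. (cmod (chiral b g s - z * g s))\<^sup>2) \<le>
    2 * (\<Sum>s\<in>{0..<int q}. (cmod (chiral a g s - z * g s))\<^sup>2) + 8 * \<kappa>\<^sup>2 * (\<Sum>s\<in>{0..<int q}. (cmod (g
      s))\<^sup>2)"
proof -
  let ?I = "{0..<int q}"
  have g0: "g s = 0" if "s < 1 \<or> s > int q - 2" for s using supp[of s] that by force
  have pt: "(cmod (chiral b g s - z * g s))\<^sup>2 \<le> 2 * (cmod (chiral a g s - z * g s))\<^sup>2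
    + 4 * \<kappa>\<^sup>2 * (cmod (g (s - 1)))\<^sup>2 + 4 * \<kappa>\<^sup>2 * (cmod (g (s + 1)))\<^sup>2"
    if s: "s \<in> ?I" for s
  proof -
    have "chiral b g s - z * g s = (chiral a g s - z * g s) + (b s - a s) * g (s - 1) + cnj (b (s
      + 1) - a (s + 1)) * g (s + 1)"
      by (simp add: chiral_def algebra_simps)
    then have "(cmod (chiral b g s - z * g s))\<^sup>2 \<le> 2 * (cmod (chiral a g s - z * g s))\<^sup>2
        + 4 * (cmod ((b s - a s) * g (s - 1)))\<^sup>2 + 4 * (cmod (cnj (b (s + 1) - a (s + 1)) * g (s +
        1)))\<^sup>2"
      using cmod_add3_squared_le by presburger
    also have "\<dots> \<le> 2 * (cmod (chiral a g s - z * g s))\<^sup>2 + 4 * (\<kappa>\<^sup>2 * (cmod (g (s - 1)))\<^sup>2)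
      + 4 * (\<kappa>\<^sup>2 * (cmod (g (s + 1)))\<^sup>2)"
      unfolding norm_mult complex_mod_cnj power_mult_distrib
      using \<kappa>[of s] \<kappa>[of "s + 1"] s
      by (intro add_mono mult_left_mono mult_right_mono power_mono order_refl) (auto simp:
        norm_minus_commute)
    finally show ?thesis by simp
  qed
  have s1: "(\<Sum>s\<in>?I. (cmod (g (s - 1)))\<^sup>2) \<le> (\<Sum>s\<in>?I. (cmod (g s))\<^sup>2)"
  proof -
    have "(\<Sum>s\<in>?I. (cmod (g (s - 1)))\<^sup>2) = (\<Sum>s\<in>{-1..<int q - 1}. (cmod (g s))\<^sup>2)"
      by (rule sum.reindex_bij_witness[of _ "\<lambda>s. s + 1" "\<lambda>s. s - 1"]) auto
    also have "\<dots> = (\<Sum>s\<in>{-1..<int q - 1} \<inter> ?I. (cmod (g s))\<^sup>2)"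
      by (rule sum.mono_neutral_right) (auto simp: g0)
    also have "\<dots> \<le> (\<Sum>s\<in>?I. (cmod (g s))\<^sup>2)" by (intro sum_mono2) auto
    finally show ?thesis .
  qed
  have s2: "(\<Sum>s\<in>?I. (cmod (g (s + 1)))\<^sup>2) \<le> (\<Sum>s\<in>?I. (cmod (g s))\<^sup>2)"
  proof -
    have "(\<Sum>s\<in>?I. (cmod (g (s + 1)))\<^sup>2) = (\<Sum>s\<in>{1..<int q + 1}. (cmod (g s))\<^sup>2)"
      by (rule sum.reindex_bij_witness[of _ "\<lambda>s. s - 1" "\<lambda>s. s + 1"]) auto
    also have "\<dots> = (\<Sum>s\<in>{1..<int q + 1} \<inter> ?I. (cmod (g s))\<^sup>2)"
      by (rule sum.mono_neutral_right) (auto simp: g0)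
    also have "\<dots> \<le> (\<Sum>s\<in>?I. (cmod (g s))\<^sup>2)" by (intro sum_mono2) auto
    finally show ?thesis .
  qed
  have "(\<Sum>s\<in>?I. (cmod (chiral b g s - z * g s))\<^sup>2) \<le>
      2 * (\<Sum>s\<in>?I. (cmod (chiral a g s - z * g s))\<^sup>2) + 4 * \<kappa>\<^sup>2 * (\<Sum>s\<in>?I. (cmod (g (s - 1)))\<^sup>2) + 4 *
        \<kappa>\<^sup>2 * (\<Sum>s\<in>?I. (cmod (g (s + 1)))\<^sup>2)"
    unfolding sum_distrib_left sum.distrib[symmetric] by (intro sum_mono pt)
  also have "\<dots> \<le> 2 * (\<Sum>s\<in>?I. (cmod (chiral a g s - z * g s))\<^sup>2) + 4 * \<kappa>\<^sup>2 * (\<Sum>s\<in>?I. (cmod (g s))\<^sup>2)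
    + 4 * \<kappa>\<^sup>2 * (\<Sum>s\<in>?I. (cmod (g s))\<^sup>2)"
    by (intro add_mono mult_left_mono s1 s2) auto
  finally show ?thesis by simp
qed

text \<open>A vanishing hopping term determines \<open>cis (- 2 * pi * (q * x))\<close>, where \<open>x\<close> is the phase,
  and a small
  shift of the phase changes this number.\<close>

lemma nonvanishing_phase:
  assumes q: "q > 0"
  obtains \<eta> :: real where "0 \<le> \<eta>" "\<eta> \<le> 1 / (real q)\<^sup>2" "\<And>s. hop (of_int p / of_nat q) (y + \<eta>) s \<noteq> 0"
proof -
  define u where "u x = cis (- 2 * pi * (of_nat q * x))" for x
  have key: "u x = (- 1) ^ q" if "hop (of_int p / of_nat q) x s = 0" for x s
  proof -
    have "cis (- 2 * pi * (x + of_int p / of_nat q * of_int s)) = - 1"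
      using that unfolding hop_def by (metis add.commute add_eq_0_iff)
    then have "cis (- 2 * pi * (x + of_int p / of_nat q * of_int s)) ^ q = (- 1) ^ q" by simp
    moreover have "cis (- 2 * pi * (x + of_int p / of_nat q * of_int s)) ^ q
      = u x * cis (of_int (- p * s) * (2 * pi))"
      unfolding Complex.DeMoivre u_def cis_mult using q by (intro arg_cong[of _ _ cis]) (simp add:
        field_simps)
    moreover have "cis (of_int (- p * s) * (2 * pi)) = 1" using cis_eq_1_iff by metis
    ultimately show ?thesis by simp
  qed
  show thesis
  proof (cases "u y = (- 1) ^ q")
    case False
    then show thesis using key[of "y + 0"] by (intro that[of 0]) auto
  next
    case True
    \<comment> \<open>This shift multiplies \<open>u\<close> by cis (- pi / q), which is not
      1.\<close>
    define \<eta> where "\<eta> = 1 / (2 * (real q)\<^sup>2)"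
    have "u (y + \<eta>) = u y * cis (- (pi / q))"
      unfolding u_def cis_mult \<eta>_def using q by (intro arg_cong[of _ _ cis]) (simp add: field_simps
        power2_eq_square)
    moreover have "cis (- (pi / q)) \<noteq> 1"
    proof
      assume "cis (- (pi / q)) = 1"
      then obtain m :: int where "- (pi / q) = of_int m * (2 * pi)" unfolding cis_eq_1_iff by blast
      then have "pi * - 1 = pi * (of_int m * 2 * real q)" using q by (simp add: field_simps)
      then have "- 1 = of_int m * 2 * real q" using pi_neq_zero mult_left_cancel by blast
      then have "real_of_int (- 1) = real_of_int (2 * (m * int q))" by simp
      then have "- 1 = 2 * (m * int q)" unfolding of_int_eq_iff .
      then have "even (- 1 :: int)" unfolding dvd_def by blast
      then show False by simp
    qed
    ultimately have "u (y + \<eta>) \<noteq> (- 1) ^ q" using True by simp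
    moreover have "0 \<le> \<eta>" "\<eta> \<le> 1 / (real q)\<^sup>2" using q by (auto simp: \<eta>_def divide_simps)
    ultimately show thesis using key[of "y + \<eta>"] by (intro that[of \<eta>]) auto
  qed
qed

text \<open>The localized vector sees \<alpha> only on about \<open>K\<close> sites. There the
  frequency p/q with a perturbed phase changes the hopping terms by at most \<kappa>: the frequency
  accounts for (K + 2)/q^2, the phase for 1/q^2, and 8 bounds 2 pi.\<close>

lemma spectrum_near_periodic:
  fixes \<alpha> \<theta> E h :: real and p p' :: int and n q :: nat
  assumes spec: "complex_of_real E \<in> spectrum (critical_almost_mathieu \<alpha> \<theta>)"
    and n: "n > 0" and cop: "coprime p' (int n)" and app: "\<bar>\<alpha> - of_int p' / of_nat n\<bar>
      \<le> 1 / (of_nat n)\<^sup>2"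
    and h: "h > 0" and L: "L = (\<Sum>i<n. 1 / (real i + 2))"
    and K: "18 * h / L + of_nat n \<le> of_nat K" and Kq: "K + 3 \<le> q"
    and copq: "coprime p (int q)" and appq: "\<bar>\<alpha> - of_int p / of_nat q\<bar> \<le> 1 / (of_nat q)\<^sup>2"
  defines "w \<equiv> cis (- 2 * pi * (of_int p / of_nat q))"
  shows "\<exists>E'. \<bar>E' - E\<bar> \<le> 15 / h + 24 * (of_nat K + 3) / (of_nat q)\<^sup>2 \<and>
     cmod (poly (jacobi_poly (\<lambda>k. (cmod (1 - w ^ k))\<^sup>2) q) (of_real E')) \<le> 4"
proof -
  have q: "q > 0" using Kq by simp
  obtain y g where gsupp: "\<And>s. g s \<noteq> 0 \<Longrightarrow> 1 \<le> s \<and> s \<le> int K + 1"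
    and glt: "(\<Sum>s\<in>{0..<int q}. (cmod (chiral (hop \<alpha> y) g s - of_real E * g s))\<^sup>2)
      < (10 / h)\<^sup>2 * (\<Sum>s\<in>{0..<int q}. (cmod (g s))\<^sup>2)"
    by (rule localized_approximate_eigenvector[OF spec n cop app h L K Kq]) (rule that; (assumption
      | simp))
  obtain \<eta> :: real where \<eta>: "0 \<le> \<eta>" "\<eta> \<le> 1 / (real q)\<^sup>2" "\<And>s. hop (of_int p / of_nat q) (y
    + \<eta>) s \<noteq> 0"
    by (rule nonvanishing_phase[OF q]) (rule that; (assumption | simp))
  define a where "a = hop (of_int p / of_nat q) (y + \<eta>)"
  define \<kappa> where "\<kappa> = 8 * (of_nat K + 3) / (real q)\<^sup>2"
  \<comment> \<open>Agrees with the periodic \<open>a\<close> on all bonds touching the support of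
    \<open>g\<close> and with the original hopping terms elsewhere, so the bound \<kappa> holds at
    every site.\<close>
  define b where "b s = (if s \<in> {0..int K + 2} then a s else hop \<alpha> y s)" for s
  have \<kappa>: "cmod (hop \<alpha> y s - b s) \<le> \<kappa>" for s
  proof (cases "s \<in> {0..int K + 2}")
    case True
    have "\<bar>(y + \<alpha> * of_int s) - (y + \<eta> + of_int p / of_nat q * of_int s)\<bar>
      = \<bar>(\<alpha> - of_int p / of_nat q) * of_int s - \<eta>\<bar>"
      by (simp add: algebra_simps)
    also have "\<dots> \<le> \<bar>\<alpha> - of_int p / of_nat q\<bar> * of_int s + \<eta>" using True \<eta>(1)
      by (simp add: abs_mult order_trans[OF abs_triangle_ineq4])
    also have "\<dots> \<le> 1 / (real q)\<^sup>2 * (of_nat K + 2) + 1 / (real q)\<^sup>2"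
    proof (intro add_mono mult_mono appq \<eta>(2))
      show "real_of_int s \<le> of_nat K + 2" using True by auto
    qed (use True in auto)
    also have "\<dots> = (of_nat K + 3) / (real q)\<^sup>2" by (simp add: add_divide_distrib)
    finally have "\<bar>(y + \<alpha> * of_int s) - (y + \<eta> + of_int p / of_nat q * of_int s)\<bar>
      \<le> (of_nat K + 3) / (real q)\<^sup>2" .
    then have "2 * pi * \<bar>(y + \<alpha> * of_int s) - (y + \<eta> + of_int p / of_nat q * of_int s)\<bar>
      \<le> 8 * ((of_nat K + 3) / (real q)\<^sup>2)"
      using pi_less_4 by (intro mult_mono) auto
    then show ?thesis using cmod_hop_diff_le[of \<alpha> y s "of_int p / of_nat q" "y + \<eta>"] True
      by (simp add: b_def a_def \<kappa>_def)
  qed (auto simp: b_def \<kappa>_def)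
  have cb: "chiral b g s = chiral a g s" for s
  proof -
    have "b s * g (s - 1) = a s * g (s - 1)" using gsupp[of "s - 1"] by (cases "g (s - 1)
      = 0") (auto simp: b_def)
    moreover have "cnj (b (s + 1)) * g (s + 1) = cnj (a (s + 1)) * g (s + 1)"
      using gsupp[of "s + 1"] by (cases "g (s + 1) = 0") (auto simp: b_def)
    ultimately show ?thesis unfolding chiral_def by (simp only:)
  qed
  define N where "N = (\<Sum>s\<in>{0..<int q}. (cmod (g s))\<^sup>2)"
  \<comment> \<open>Chosen so that \<open>\<delta>\<^sup>2\<close> dominates 200 / h^2 + 8
    \<kappa>^2: 15^2 = 225 and 3^2 = 9.\<close>
  define \<delta> where "\<delta> = 15 / h + 3 * \<kappa>"
  have \<delta>0: "\<delta> \<ge> 0" using h by (simp add: \<delta>_def \<kappa>_def)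
  have N0: "N \<ge> 0" unfolding N_def by (intro sum_nonneg) auto
  have "(\<Sum>s\<in>{0..<int q}. (cmod (chiral b g s - of_real E * g s))\<^sup>2) \<le>
      2 * (\<Sum>s\<in>{0..<int q}. (cmod (chiral (hop \<alpha> y) g s - of_real E * g s))\<^sup>2) + 8 * \<kappa>\<^sup>2 * N"
    unfolding N_def
  proof (rule chiral_perturbation)
    show "1 \<le> s \<and> s \<le> int q - 2" if "g s \<noteq> 0" for s using gsupp[OF that] Kq by auto
  qed (rule \<kappa>)
  also have "\<dots> \<le> 2 * ((10 / h)\<^sup>2 * N) + 8 * \<kappa>\<^sup>2 * N" using glt by (simp add: N_def)
  also have "\<dots> = (200 / h\<^sup>2 + 8 * \<kappa>\<^sup>2) * N" by (simp add: power_divide algebra_simps)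
  also have "\<dots> \<le> \<delta>\<^sup>2 * N"
  proof (rule mult_right_mono[OF _ N0])
    have "0 \<le> 2 * (15 / h) * (3 * \<kappa>)" using h by (simp add: \<kappa>_def)
    moreover have "\<delta>\<^sup>2 = (15 / h)\<^sup>2 + (3 * \<kappa>)\<^sup>2 + 2 * (15 / h) * (3 * \<kappa>)"
      unfolding \<delta>_def by (simp only: power2_sum)
    moreover have "(15 / h)\<^sup>2 = 225 / h\<^sup>2" "(3 * \<kappa>)\<^sup>2 = 9 * \<kappa>\<^sup>2"
      by (simp_all add: power_divide power_mult_distrib)
    moreover have "200 / h\<^sup>2 \<le> 225 / h\<^sup>2" by (intro divide_right_mono) auto
    ultimately show "200 / h\<^sup>2 + 8 * \<kappa>\<^sup>2 \<le> \<delta>\<^sup>2" using zero_le_power2[of \<kappa>] by linarith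
  qed
  finally have gle: "(\<Sum>s\<in>{0..<int q}. (cmod (chiral a g s - of_real E * g s))\<^sup>2) \<le> \<delta>\<^sup>2 * N"
    by (simp add: cb)
  \<comment> \<open>Since \<open>g\<close> vanishes at both ends of the period, wrapping it around
    creates no new term in the residual.\<close>
  define G where "G s = g (s mod int q)" for s
  have GI: "G s = g s" if "s \<in> {-1..int q}" for s
  proof (cases "s \<in> {0..<int q}")
    case False
    then have "s = -1 \<or> s = int q" using that by auto
    then show ?thesis
    proof
      assume 1: "s = -1"
      have "(-1) mod int q = int q - 1" using q by (simp add: zmod_minus1)
      then show ?thesis using 1 gsupp[of "int q - 1"] gsupp[of "-1"] Kq unfolding G_def by fastforce
    next
      assume "s = int q"
      then show ?thesis using gsupp[of 0] gsupp[of "int q"] Kq unfolding G_def by fastforce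
    qed
  qed (simp add: G_def)
  have GN: "(\<Sum>s\<in>{0..<int q}. (cmod (G s))\<^sup>2) = N"
    unfolding N_def by (intro sum.cong refl) (simp add: GI)
  have cG: "chiral a G s - of_real E * G s = chiral a g s - of_real E * g s" if "s \<in> {0..<int q}"
    for s
    using that by (simp add: chiral_def GI)
  have G0: "G \<noteq> (\<lambda>s. 0)"
  proof
    assume "G = (\<lambda>s. 0)"
    then have "N = 0" unfolding GN[symmetric] by simp
    moreover have "0 \<le> (\<Sum>s\<in>{0..<int q}. (cmod (chiral (hop \<alpha> y) g s - of_real E * g s))\<^sup>2)"
      by (intro sum_nonneg) auto
    ultimately show False using glt by (simp add: N_def)
  qed
  have Gle: "(\<Sum>s\<in>{0..<int q}. (cmod (chiral a G s - of_real E * G s))\<^sup>2)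
    \<le> \<delta>\<^sup>2 * (\<Sum>s\<in>{0..<int q}. (cmod (G s))\<^sup>2)"
  proof -
    have "(\<Sum>s\<in>{0..<int q}. (cmod (chiral a G s - of_real E * G s))\<^sup>2)
        = (\<Sum>s\<in>{0..<int q}. (cmod (chiral a g s - of_real E * g s))\<^sup>2)"
      by (intro sum.cong refl) (simp only: cG)
    then show ?thesis unfolding GN using gle by simp
  qed
  have aper: "a (s + int q) = a s" for s unfolding a_def by (rule hop_periodic[OF q])
  have Gper: "G (s + int q) = G s" for s by (simp add: G_def)
  obtain E' f where E': "\<bar>E' - E\<bar> \<le> \<delta>" "\<And>s. f (s + int q) = f s" "f \<noteq> (\<lambda>s. 0)" "\<And>s. chiral a f s
    = of_real E' * f s"
    by (rule periodic_near_eigenvalue[of q a G \<delta> E, OF q aper Gper G0 \<delta>0 Gle]) (rule that;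
      (assumption | simp))
  have "cmod (poly (jacobi_poly (\<lambda>k. (cmod (1 - w ^ k))\<^sup>2) q) (of_real E')) \<le> 4"
  proof (rule periodic_eigenvalue_bound[where z = "cis (- 2 * pi * (y + \<eta>))" and a = a and f = f])
    show "a (int k) = 1 + w ^ k * cis (- 2 * pi * (y + \<eta>))" for k
      unfolding a_def w_def by (rule hop_eq_power)
    show "chiral a f s = of_real E' * f s" for s by (rule E'(4))
    show "cmod w = 1" "w ^ q = 1" "\<And>k. 0 < k \<Longrightarrow> k < q \<Longrightarrow> w ^ k \<noteq> 1"
      unfolding w_def using rational_rotation_primitive[OF q copq] by auto
  qed (use q E' \<eta> in \<open>auto simp: a_def\<close>)
  moreover have "\<delta> = 15 / h + 24 * (of_nat K + 3) / (of_nat q)\<^sup>2" by (simp add: \<delta>_def \<kappa>_def)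
  ultimately show ?thesis using E'(1) by auto
qed

text \<open>Where |P| \<le> 4, some root e satisfies |E' - e| |P' e| \<le> 4 exp 1 \<le> 12. The
  resulting intervals have total length at most 24/q, and enlarging q of them by \<delta> on both
  sides adds 2 q \<delta>.\<close>

lemma jacobi_sublevel_cover:
  fixes p :: int and q :: nat and \<delta> :: real
  assumes q: "q > 0" and copq: "coprime p (int q)" and \<delta>: "\<delta> \<ge> 0"
  defines "w \<equiv> cis (- 2 * pi * (of_int p / of_nat q))"
  obtains T :: "real set" where "T \<in> lmeasurable" "measure lebesgue T \<le> 24 / of_nat q
    + 2 * of_nat q * \<delta>"
    "\<And>E E'. \<bar>E' - E\<bar> \<le> \<delta> \<Longrightarrow> cmod (poly (jacobi_poly (\<lambda>k. (cmod (1 - w ^ k))\<^sup>2) q) (of_real E')) \<le> 4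
      \<Longrightarrow> E \<in> T"
proof -
  define b where "b k = (cmod (1 - w ^ k))\<^sup>2" for k
  have w: "w ^ q = 1" "\<And>k. 0 < k \<Longrightarrow> k < q \<Longrightarrow> w ^ k \<noteq> 1"
    unfolding w_def using rational_rotation_primitive[OF q copq] by auto
  have bpos: "b k > 0" if "1 \<le> k" "k < q" for k using w(2)[of k] that by (simp add: b_def)
  obtain S :: "real set" where S: "finite S" "card S = q"
    "\<And>x. poly (jacobi_poly b q) (of_real x) = of_real (\<Prod>e\<in>S. x - e)"
    "(\<Sum>e\<in>S. 1 / (\<Prod>d\<in>S - {e}. \<bar>e - d\<bar>)) \<le> 1 / sqrt (\<Prod>k=1..<q. b k)"
    using q bpos by (rule_tac jacobi_poly_roots[of q b]) (assumption | rule that)+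
  have "(\<Prod>k=1..<q. b k) = (cmod (\<Prod>k=1..<q. 1 - w ^ k))\<^sup>2"
    by (simp add: b_def prod_norm[symmetric] prod_power_distrib)
  also have "(\<Prod>k=1..<q. 1 - w ^ k) = of_nat q" using q w by (rule prod_one_minus_roots)
  finally have sq: "sqrt (\<Prod>k=1..<q. b k) = of_nat q" by simp
  define D where "D e = (\<Prod>d\<in>S - {e}. \<bar>e - d\<bar>)" for e
  have Dpos: "D e > 0" for e unfolding D_def by (intro prod_pos) auto
  define r where "r e = 12 / D e + \<delta>" for e
  have r0: "r e \<ge> 0" for e using Dpos[of e] \<delta> by (simp add: r_def)
  define T where "T = (\<Union>e\<in>S. {e - r e..e + r e})"
  have "T \<in> lmeasurable" unfolding T_def using S(1) by (intro fmeasurable.finite_UN) auto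
  moreover have "measure lebesgue T \<le> 24 / of_nat q + 2 * of_nat q * \<delta>"
  proof -
    have "measure lebesgue T \<le> (\<Sum>e\<in>S. measure lebesgue {e - r e..e + r e})"
      unfolding T_def using S(1) by (intro measure_UNION_le) auto
    also have "\<dots> = (\<Sum>e\<in>S. 2 * r e)" using r0 by (intro sum.cong refl) simp
    also have "\<dots> = 24 * (\<Sum>e\<in>S. 1 / D e) + 2 * of_nat q * \<delta>"
      unfolding r_def by (simp add: sum.distrib sum_distrib_left S(2) algebra_simps)
    also have "\<dots> \<le> 24 * (1 / of_nat q) + 2 * of_nat q * \<delta>"
      using S(4) unfolding sq D_def by (intro add_right_mono mult_left_mono) auto
    finally show ?thesis by simp
  qed
  moreover have "E \<in> T" if E: "\<bar>E' - E\<bar> \<le> \<delta>" "cmod (poly (jacobi_poly b q) (of_real E')) \<le> 4"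
    for E E'
  proof -
    have "S \<noteq> {}" using S(2) q by auto
    then obtain e where e: "e \<in> S" "\<bar>E' - e\<bar> * D e \<le> exp 1 * (\<Prod>d\<in>S. \<bar>E' - d\<bar>)"
      using root_near_point[OF S(1), of E'] unfolding D_def by blast
    have "(\<Prod>d\<in>S. \<bar>E' - d\<bar>) \<le> 4" using E(2) unfolding S(3) by (simp add: abs_prod del: of_real_prod)
    then have "exp 1 * (\<Prod>d\<in>S. \<bar>E' - d\<bar>) \<le> 3 * 4" using exp_le by (intro mult_mono prod_nonneg) auto
    then have "\<bar>E' - e\<bar> * D e \<le> 12" using e(2) by linarith
    then have "\<bar>E' - e\<bar> \<le> 12 / D e" using Dpos[of e] by (simp add: field_simps)
    then have "E \<in> {e - r e..e + r e}" using E(1) unfolding r_def by auto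
    then show ?thesis using e(1) unfolding T_def by blast
  qed
  ultimately show thesis using that[of T] unfolding b_def by blast
qed

section \<open>Divergence of the logarithm, Dirichlet approximation and the choice of
  parameters\<close>

lemma shifted_harmonic_unbounded: "\<exists>n0. \<forall>n\<ge>n0. (\<Sum>i<n. 1 / (real i + 2)) \<ge> X"
proof -
  have "\<not> summable (\<lambda>i. 1 / (real i + 2))"
  proof
    assume "summable (\<lambda>i. 1 / (real i + 2))"
    then have "summable (\<lambda>i. inverse (real (i + 2)))" by (simp add: divide_inverse add.commute)
    then show False using not_summable_harmonic[where 'a = real] summable_iff_shift[of
      "\<lambda>i. inverse (real i)" 2] by simp
  qed
  then obtain n0 where n0: "(\<Sum>i<n0. 1 / (real i + 2)) > X"
    by (metis not_le summableI_nonneg_bounded divide_nonneg_nonneg of_nat_0_le_iff zero_le_one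
      add_nonneg_nonneg zero_le_numeral)
  have "(\<Sum>i<n. 1 / (real i + 2)) \<ge> X" if "n \<ge> n0" for n
  proof -
    have "(\<Sum>i<n0. 1 / (real i + 2)) \<le> (\<Sum>i<n. 1 / (real i + 2))" using that by (intro sum_mono2) auto
    then show ?thesis using n0 by linarith
  qed
  then show ?thesis by blast
qed

lemma irrational_approximation:
  fixes \<alpha> :: real
  assumes "\<alpha> \<notin> \<rat>"
  obtains p :: int and q :: nat where "q > m" "coprime p (int q)" "\<bar>\<alpha> - of_int p / of_nat q\<bar>
    \<le> 1 / (of_nat q)\<^sup>2"
proof -
  have "infinite (approx_set \<alpha>)" using assms rational_iff_finite_approx_set by blast
  then obtain h k where hk: "(h, k) \<in> approx_set \<alpha>" "k > int m" using infinite_approx_set by blast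
  then have *: "k > 0" "coprime h k" "\<bar>\<alpha> - of_int h / of_int k\<bar> < 1 / (of_int k)\<^sup>2"
    by (auto simp: approx_set_def)
  define q where "q = nat k"
  have "k = int q" using *(1) by (simp add: q_def)
  then show thesis using that[of q h] * hk(2) by simp
qed

text \<open>The order of the choices matters: \<tau> determines \<open>n\<close>, which fixes the
  gain L, and \<open>q\<close> is chosen last, so large that the \<open>n\<close> sites of an
  incomplete block are negligible against \<tau> q.\<close>

lemma spectrum_small_cover:
  fixes \<alpha> \<theta> \<tau> :: real
  assumes irr: "\<alpha> \<notin> \<rat>" and \<tau>: "0 < \<tau>" "\<tau> \<le> 1"
  shows "\<exists>T. {E :: real. complex_of_real E \<in> spectrum (critical_almost_mathieu \<alpha> \<theta>)} \<subseteq> T \<and>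
     T \<in> lmeasurable \<and> measure lebesgue T \<le> 50 * \<tau>"
proof -
  obtain n0 where n0: "\<And>n. n \<ge> n0 \<Longrightarrow> (\<Sum>i<n. 1 / (real i + 2)) \<ge> 1080 / \<tau>\<^sup>2"
    using shifted_harmonic_unbounded by blast
  obtain p' :: int and n :: nat where n: "n > n0" "coprime p' (int n)" "\<bar>\<alpha> - of_int p' / of_nat n\<bar>
    \<le> 1 / (of_nat n)\<^sup>2"
    by (rule irrational_approximation[OF irr]) (rule that; (assumption | simp))
  define L where "L = (\<Sum>i<n. 1 / (real i + 2))"
  have L: "L \<ge> 1080 / \<tau>\<^sup>2" unfolding L_def using n0 n by simp
  then have Lpos: "L > 0" using \<tau> by (smt (verit) zero_less_divide_iff zero_less_power)
  obtain p :: int and q :: nat where q: "q > nat \<lceil>4 * (of_nat n + 4) / \<tau>\<rceil>" "coprime p (int q)"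
    "\<bar>\<alpha> - of_int p / of_nat q\<bar> \<le> 1 / (of_nat q)\<^sup>2"
    by (rule irrational_approximation[OF irr]) (rule that; (assumption | simp))
  have qbig: "4 * (of_nat n + 4) \<le> \<tau> * of_nat q"
  proof -
    have "4 * (of_nat n + 4) / \<tau> \<le> of_nat q" using q(1) by linarith
    then show ?thesis using \<tau> by (simp add: field_simps)
  qed
  have q0: "q > 0" using q(1) by simp
  \<comment> \<open>Makes the localization length 18 h / L equal to \<tau> q / 4; then 15 q / h =
    1080 / (\<tau> L), which is where the lower bound 1080 / \<tau>^2 on L comes from.\<close>
  define h where "h = \<tau> * L * of_nat q / 72"
  have h: "h > 0" using \<tau> Lpos q0 by (simp add: h_def)
  define K where "K = nat \<lceil>\<tau> * of_nat q / 4 + of_nat n\<rceil>"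
  have "18 * h / L = \<tau> * of_nat q / 4" using Lpos by (simp add: h_def)
  then have K: "18 * h / L + of_nat n \<le> of_nat K" unfolding K_def by linarith
  have "\<tau> * of_nat q / 4 + of_nat n \<ge> 0" using \<tau> by simp
  then have "of_nat K \<le> \<tau> * of_nat q / 4 + of_nat n + 1" unfolding K_def by linarith
  then have K3: "of_nat K + 3 \<le> \<tau> * of_nat q / 2" using qbig by (simp add: field_simps)
  also have "\<dots> \<le> of_nat q" using \<tau> q0 mult_right_mono[of \<tau> 1 "real q"] by simp
  finally have Kq: "K + 3 \<le> q" by linarith
  define \<delta> where "\<delta> = 15 / h + 24 * (of_nat K + 3) / (real q)\<^sup>2"
  have \<delta>0: "\<delta> \<ge> 0" using h by (simp add: \<delta>_def)
  have q\<delta>: "of_nat q * \<delta> \<le> 13 * \<tau>"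
  proof -
    have "of_nat q * (15 / h) = 1080 / (\<tau> * L)" using q0 by (simp add: h_def)
    also have "\<dots> \<le> \<tau>" using L Lpos \<tau> by (simp add: divide_simps power2_eq_square mult_ac split:
      if_splits)
    finally have "of_nat q * (15 / h) \<le> \<tau>" .
    moreover have "of_nat q * (24 * (of_nat K + 3) / (real q)\<^sup>2) = 24 * (of_nat K + 3) / real q"
      using q0 by (simp add: power2_eq_square)
    moreover have "24 * (of_nat K + 3) / real q \<le> 12 * \<tau>" using K3 q0 by (simp add: field_simps)
    ultimately show ?thesis unfolding \<delta>_def distrib_left by linarith
  qed
  obtain T :: "real set" where T: "T \<in> lmeasurable" "measure lebesgue T \<le> 24 / of_nat q
    + 2 * of_nat q * \<delta>"
    "\<And>E E'. \<bar>E' - E\<bar> \<le> \<delta> \<Longrightarrow>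
      cmod (poly (jacobi_poly (\<lambda>k. (cmod (1 - cis (- 2 * pi * (of_int p / of_nat q)) ^ k))\<^sup>2) q)
        (of_real E')) \<le> 4 \<Longrightarrow> E \<in> T"
    by (rule jacobi_sublevel_cover[OF q0 q(2) \<delta>0]) (rule that; (assumption | simp))
  have "E \<in> T" if "complex_of_real E \<in> spectrum (critical_almost_mathieu \<alpha> \<theta>)" for E
    using spectrum_near_periodic[OF that _ n(2,3) h L_def K Kq q(2,3)] n(1) T(3) unfolding \<delta>_def
      by auto
  \<comment> \<open>The total is 24 \<tau> from the sublevel set and 2 * 13 \<tau> from enlarging
    the intervals.\<close>
  moreover have "measure lebesgue T \<le> 50 * \<tau>"
  proof -
    have "1 \<le> \<tau> * of_nat q" using qbig by simp
    then have "24 / of_nat q \<le> 24 * \<tau>" using q0 by (simp add: field_simps)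
    then show ?thesis using T(2) q\<delta> by simp
  qed
  ultimately show ?thesis using T(1) by blast
qed

theorem theorem1p2:
  fixes \<alpha> \<theta> :: real
  assumes "\<alpha> \<notin> \<rat>"
  shows "{E :: real. complex_of_real E \<in> spectrum (critical_almost_mathieu \<alpha> \<theta>)}
           \<in> null_sets lebesgue"
proof -
  \<comment> \<open>Covers of arbitrarily small measure give negligibility directly, without first
    proving that the spectrum is measurable.\<close>
  have "negligible {E :: real. complex_of_real E \<in> spectrum (critical_almost_mathieu \<alpha> \<theta>)}"
    unfolding negligible_outer_le
  proof (intro allI impI)
    fix e :: real assume "e > 0"
    then obtain T where "{E. complex_of_real E \<in> spectrum (critical_almost_mathieu \<alpha> \<theta>)} \<subseteq> T"
      "T \<in> lmeasurable" "measure lebesgue T \<le> 50 * min (e / 50) 1"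
      using spectrum_small_cover[OF assms, of "min (e / 50) 1" \<theta>] by auto
    moreover have "50 * min (e / 50) 1 \<le> e" by simp
    ultimately show "\<exists>T. {E. complex_of_real E \<in> spectrum (critical_almost_mathieu \<alpha> \<theta>)} \<subseteq> T
        \<and> T \<in> lmeasurable \<and> measure lebesgue T \<le> e"
      by (meson order_trans)
  qed
  then show ?thesis by (simp add: negligible_iff_null_sets)
qed

end
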